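(* Let $[\cdot]$ stand either for $\{\cdot\}$ throughout (Roumieu case) or for $(\cdot)$ throughout (Beurling case). Let $E$ be a Banach space, $U\subseteq E$ an open subset, and $f:U\to\mathbb{C}$ a function. (a) Let $\mathfrak{M}$ be an [admissible] weight matrix (R-admissible in the Roumieu case, B-admissible in the Beurling case). If $f^j,f^{j+1}\in\mathcal{E}^{[\mathfrak{M}]}(U)$ for some positive integer $j$, then $f\in\mathcal{E}^{[\mathfrak{M}]}(U)$. (b) Let $\omega$ be a concave weight function. If $f^j,f^{j+1}\in\mathcal{E}^{[\omega]}(U)$ for some positive integer $j$, then $f\in\mathcal{E}^{[\omega]}(U)$.
   Context: Weight sequences and matrices. A weight sequence is a positive sequence $M=(M_k)_{k\ge 0}$ that is log-convex, with $M_0=1\le M_1$ and $M_k^{1/k}\to\infty$. A weight matrix $\mathfrak{M}$ is a (nonempty) family of weight sequences that is totally ordered with respect to the pointwise order relation on sequences. With $M$ one associates the sequence $m=(m_k)$ given by $k!\,m_k = M_k$ (similarly $n$ for $N$). If $m_k^{1/k}\to\infty$, define for $t>0$ $$h_m(t):=\inf_{k\in\mathbb{N}} m_k t^k,\quad \overline{\Gamma}_m(t):=\min\{k\in\mathbb N : h_m(t)=m_kt^k\},\quad \underline{\Gamma}_m(t):=\min\Big\{k\in\mathbb N: \frac{m_{k+1}}{m_k}\ge \frac1t\Big\},$$ where $\mathbb{N}=\{0,1,2,\dots\}$. For positive sequences $M,N$ set $\operatorname{mg}(M,N):=\sup_{j,k\ge 0,\ j+k\ge 1}\big(\frac{M_{j+k}}{N_jN_k}\big)^{1/(j+k)}\in(0,\infty]$.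 Admissibility. A weight matrix $\mathfrak{M}$ with $m_k^{1/k}\to\infty$ for all $M\in\mathfrak{M}$ is called: - R-admissible (= {admissible}) if: for every $M\in\mathfrak{M}$ there are $N\in\mathfrak{M}$ and $C\ge1$ with $\overline{\Gamma}_n(Ct)\le\underline{\Gamma}_m(t)$ for all $t>0$; and for every $M\in\mathfrak{M}$ there is $N\in\mathfrak{M}$ with $\operatorname{mg}(M,N)<\infty$. - B-admissible (= (admissible)) if: for every $M\in\mathfrak{M}$ there are $N\in\mathfrak{M}$ and $C\ge1$ with $\overline{\Gamma}_m(Ct)\le\underline{\Gamma}_n(t)$ for all $t>0$; and for every $M\in\mathfrak{M}$ there is $N\in\mathfrak{M}$ with $\operatorname{mg}(N,M)<\infty$. Function classes on a Banach space. For $U\subseteq E$ open and $f\in C^\infty(U,\mathbb{C})$ (smooth in the real Fréchet sense), $K\subseteq U$, $\rho>0$, put $\|f\|^M_{K,\rho}:=\sup_{x\in K}\sup_{k\in\mathbb{N}}\frac{\|f^{(k)}(x)\|_{L^k(E,\mathbb{C})}}{\rho^kM_k}$, where $f^{(k)}$ is the $k$-th Fréchet derivative with the operator norm on bounded $k$-linear maps. $\mathcal{E}^{\{\mathfrak{M}\}}(U)$ is the set of $f\in C^\infty(U,\mathbb{C})$ such that for every compact $K\subseteq U$ there exist $M\in\mathfrak{M}$ and $\rho>0$ with $\|f\|^M_{K,\rho}<\infty$; $\mathcal{E}^{(\mathfrak{M})}(U)$ is the set of $f\in C^\infty(U,\mathbb{C})$ such that $\|f\|^M_{K,\rho}<\infty$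 for all compact $K\subseteq U$, all $M\in\mathfrak{M}$ and all $\rho>0$. Weight functions. A weight function is a continuous increasing function $\omega:[0,\infty)\to[0,\infty)$ such that $\omega(2t)=O(\omega(t))$, $\omega(t)=o(t)$ and $\log t=o(\omega(t))$ as $t\to\infty$, and $\varphi_\omega(t):=\omega(e^t)$ is convex on $[0,\infty)$. Let $\varphi_\omega^*(y):=\sup_{x\ge0}(xy-\varphi_\omega(x))$, $y\ge0$. $\mathcal{E}^{\{\omega\}}(U)$ (resp. $\mathcal{E}^{(\omega)}(U)$) is the set of $f\in C^\infty(U,\mathbb{C})$ such that for every compact $K\subseteq U$ there exists $\rho>0$ (resp. for every compact $K\subseteq U$ and every $\rho>0$) one has $\sup_{x\in K}\sup_{k\in\mathbb{N}}\|f^{(k)}(x)\|_{L^k(E,\mathbb{C})}\exp(-\frac1\rho\varphi_\omega^*(\rho k))<\infty$. *)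

theory Defs
  imports "HOL-Analysis.Analysis" "HOL-Library.Landau_Symbols"
begin

section \<open>Higher Frechet derivatives on a Banach space\<close>

text \<open>
  A \<open>k\<close>-linear form on \<open>E\<close> is represented by a function on lists of vectors, of which only the
  values on lists of length \<open>k\<close> matter.  Setting it to zero on all other lists makes
  \<open>mlin k\<close> a faithful copy of the space \<open>L\<^sup>k(E, \<complex>)\<close> of bounded real \<open>k\<close>-linear forms.
\<close>

definition mlin :: "nat \<Rightarrow> ('a::real_normed_vector list \<Rightarrow> complex) set" where
  "mlin k = {T. (\<forall>vs. length vs \<noteq> k \<longrightarrow> T vs = 0) \<and>
                (\<forall>vs i. length vs = k \<and> i < k \<longrightarrow> linear (\<lambda>v. T (vs[i := v]))) \<and>
                (\<exists>B. \<forall>vs. length vs = k \<longrightarrow> norm (T vs) \<le> B * (\<Prod>v\<leftarrow>vs. norm v))}"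

text \<open>The operator norm, in the style of \<^const>\<open>onorm\<close>; quotients with a zero denominator are 0.\<close>

definition mnorm :: "nat \<Rightarrow> ('a::real_normed_vector list \<Rightarrow> complex) \<Rightarrow> real" where
  "mnorm k T = (SUP vs\<in>{vs. length vs = k}. norm (T vs) / (\<Prod>v\<leftarrow>vs. norm v))"

text \<open>
  \<open>T\<close> is the Frechet derivative at \<open>x\<close> of the \<open>L\<^sup>k(E, \<complex>)\<close>-valued map \<open>F\<close>, under the isometry
  \<open>L(E, L\<^sup>k(E, \<complex>)) = L\<^sup>k\<^sup>+\<^sup>1(E, \<complex>)\<close> given by \<open>(T h) vs = T (h # vs)\<close>.
\<close>

definition has_mderiv ::
  "nat \<Rightarrow> ('a::real_normed_vector \<Rightarrow> 'a list \<Rightarrow> complex) \<Rightarrow> ('a list \<Rightarrow> complex) \<Rightarrow> 'a \<Rightarrow> bool" where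
  "has_mderiv k F T x \<longleftrightarrow>
     (\<forall>\<^sub>F y in nhds x. F y \<in> mlin k) \<and> T \<in> mlin (Suc k) \<and>
     ((\<lambda>y. mnorm k (\<lambda>vs. F y vs - F x vs - T ((y - x) # vs)) / norm (y - x)) \<longlongrightarrow> 0) (at x)"

text \<open>
  \<open>fderiv k f x\<close> is the \<open>k\<close>-th derivative of \<open>f\<close> at \<open>x\<close>; it is meaningful where the derivatives
  exist, and depends only on the germ of \<open>f\<close> at \<open>x\<close>.
\<close>

primrec fderiv :: "nat \<Rightarrow> ('a::real_normed_vector \<Rightarrow> complex) \<Rightarrow> 'a \<Rightarrow> 'a list \<Rightarrow> complex" where
  "fderiv 0 f = (\<lambda>x vs. if vs = [] then f x else 0)"
| "fderiv (Suc k) f = (\<lambda>x. THE T. has_mderiv k (fderiv k f) T x)"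

definition smooth_on :: "'a::real_normed_vector set \<Rightarrow> ('a \<Rightarrow> complex) \<Rightarrow> bool" where
  "smooth_on U f \<longleftrightarrow> (\<forall>k. \<forall>x\<in>U. \<exists>T. has_mderiv k (fderiv k f) T x)"

lemma mlin_le_mnorm:
  assumes "\<And>vs. length vs = k \<Longrightarrow> norm (T vs) \<le> B * (\<Prod>v\<leftarrow>vs. norm v)" "length vs = k"
  shows "norm (T vs) \<le> mnorm k T * (\<Prod>v\<leftarrow>vs. norm v)"
proof (cases "(\<Prod>v\<leftarrow>vs. norm v) = 0")
  case True
  then show ?thesis using assms(1)[OF assms(2)] by simp
next
  case False
  have nonneg: "0 \<le> (\<Prod>v\<leftarrow>ws. norm v)" for ws :: "'a list"
    by (induction ws) auto
  have "norm (T ws) / (\<Prod>v\<leftarrow>ws. norm v) \<le> max B 0" if "length ws = k" for ws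
    using assms(1)[OF that] nonneg[of ws]
    by (cases "(\<Prod>v\<leftarrow>ws. norm v) = 0")
       (auto simp: divide_le_eq intro: order_trans mult_right_mono)
  then have "bdd_above ((\<lambda>vs. norm (T vs) / (\<Prod>v\<leftarrow>vs. norm v)) ` {vs. length vs = k})"
    by (intro bdd_aboveI2[of _ _ "max B 0"]) auto
  then have "norm (T vs) / (\<Prod>v\<leftarrow>vs. norm v) \<le> mnorm k T"
    unfolding mnorm_def using assms(2) by (intro cSUP_upper) auto
  then show ?thesis
    using False nonneg[of vs] by (simp add: divide_le_eq)
qed

lemma mderiv_directional:
  fixes T :: "'a::real_normed_vector list \<Rightarrow> complex"
  assumes "has_mderiv k F T x" "length vs = k"
  shows "((\<lambda>y. F y vs) has_derivative (\<lambda>h. T (h # vs))) (at x)"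
proof -
  have F: "\<forall>\<^sub>F y in nhds x. F y \<in> mlin k" and T: "T \<in> mlin (Suc k)"
    and lim: "((\<lambda>y. mnorm k (\<lambda>vs. F y vs - F x vs - T ((y - x) # vs)) / norm (y - x)) \<longlongrightarrow> 0) (at x)"
    using assms(1) by (auto simp: has_mderiv_def)
  have Fx: "F x \<in> mlin k" using F by (rule eventually_nhds_x_imp_x)
  have "\<forall>vs i. length vs = Suc k \<and> i < Suc k \<longrightarrow> linear (\<lambda>v. T (vs[i := v]))"
    using T unfolding mlin_def by blast
  from this[rule_format, of "0 # vs" 0] have lin: "linear (\<lambda>h. T (h # vs))"
    using assms(2) by simp
  obtain BT where BT: "\<And>ws. length ws = Suc k \<Longrightarrow> norm (T ws) \<le> BT * (\<Prod>v\<leftarrow>ws. norm v)"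
    using T unfolding mlin_def by blast
  obtain BF where BF: "\<And>ws. length ws = k \<Longrightarrow> norm (F x ws) \<le> BF * (\<Prod>v\<leftarrow>ws. norm v)"
    using Fx unfolding mlin_def by blast
  have "norm (T (h # vs)) \<le> norm h * (BT * (\<Prod>v\<leftarrow>vs. norm v))" for h
    using BT[of "h # vs"] assms(2) by (simp add: mult_ac)
  with lin have bl: "bounded_linear (\<lambda>h. T (h # vs))"
    by (intro bounded_linear.intro) (auto simp: bounded_linear_axioms_def)
  have est: "norm (F y vs - F x vs - T ((y - x) # vs)) / norm (y - x)
      \<le> mnorm k (\<lambda>vs. F y vs - F x vs - T ((y - x) # vs)) / norm (y - x) * (\<Prod>v\<leftarrow>vs. norm v)"
    if y: "F y \<in> mlin k" for y
  proof -
    obtain B where B: "\<And>ws. length ws = k \<Longrightarrow> norm (F y ws) \<le> B * (\<Prod>v\<leftarrow>ws. norm v)"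
      using y unfolding mlin_def by blast
    have "norm (F y ws - F x ws - T ((y - x) # ws))
        \<le> (B + BF + BT * norm (y - x)) * (\<Prod>v\<leftarrow>ws. norm v)" if ws: "length ws = k" for ws
    proof -
      have "norm (F y ws - F x ws - T ((y - x) # ws))
          \<le> norm (F y ws) + norm (F x ws) + norm (T ((y - x) # ws))"
        by (meson norm_triangle_ineq4 order_trans add_right_mono)
      also have "\<dots> \<le> B * (\<Prod>v\<leftarrow>ws. norm v) + BF * (\<Prod>v\<leftarrow>ws. norm v)
          + BT * (\<Prod>v\<leftarrow>(y - x) # ws. norm v)"
        using ws by (intro add_mono B BF BT) auto
      finally show ?thesis by (simp add: algebra_simps)
    qed
    from mlin_le_mnorm[of k "\<lambda>vs. F y vs - F x vs - T ((y - x) # vs)", OF this assms(2)]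
    show ?thesis by (simp add: divide_right_mono)
  qed
  have "((\<lambda>y. norm (F y vs - F x vs - T ((y - x) # vs)) / norm (y - x)) \<longlongrightarrow> 0) (at x)"
  proof (rule tendsto_sandwich[OF _ _ tendsto_const])
    show "\<forall>\<^sub>F y in at x. norm (F y vs - F x vs - T ((y - x) # vs)) / norm (y - x)
        \<le> mnorm k (\<lambda>vs. F y vs - F x vs - T ((y - x) # vs)) / norm (y - x) * (\<Prod>v\<leftarrow>vs. norm v)"
      using F unfolding eventually_at_filter by (rule eventually_mono) (use est in auto)
    show "((\<lambda>y. mnorm k (\<lambda>vs. F y vs - F x vs - T ((y - x) # vs)) / norm (y - x)
        * (\<Prod>v\<leftarrow>vs. norm v)) \<longlongrightarrow> 0) (at x)"
      using tendsto_mult_left_zero[OF lim] by simp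
  qed auto
  with bl show ?thesis
    by (simp add: has_derivative_iff_norm)
qed

lemma has_mderiv_unique:
  assumes "has_mderiv k F S x" "has_mderiv k F T x"
  shows "S = T"
proof
  fix ws
  show "S ws = T ws"
  proof (cases "length ws = Suc k")
    case True
    then obtain h vs where "ws = h # vs" "length vs = k" by (auto simp: length_Suc_conv)
    with has_derivative_unique[OF mderiv_directional[OF assms(1)] mderiv_directional[OF assms(2)]]
    show ?thesis by metis
  next
    case False
    then show ?thesis using assms by (auto simp: has_mderiv_def mlin_def)
  qed
qed

lemma fderiv_Suc_eq: "has_mderiv k (fderiv k f) T x \<Longrightarrow> fderiv (Suc k) f x = T"
  by (auto intro: the_equality has_mderiv_unique)


section \<open>Weight sequences and weight matrices\<close>

definition weight_sequence :: "(nat \<Rightarrow> real) \<Rightarrow> bool" where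
  "weight_sequence M \<longleftrightarrow>
     (\<forall>k. M k > 0) \<and> (\<forall>k. (M (Suc k))\<^sup>2 \<le> M k * M (Suc (Suc k))) \<and>
     M 0 = 1 \<and> 1 \<le> M 1 \<and> filterlim (\<lambda>k. root k (M k)) at_top sequentially"

definition weight_matrix :: "(nat \<Rightarrow> real) set \<Rightarrow> bool" where
  "weight_matrix \<MM> \<longleftrightarrow>
     \<MM> \<noteq> {} \<and> (\<forall>M\<in>\<MM>. weight_sequence M) \<and> (\<forall>M\<in>\<MM>. \<forall>N\<in>\<MM>. M \<le> N \<or> N \<le> M)"

definition redseq :: "(nat \<Rightarrow> real) \<Rightarrow> nat \<Rightarrow> real" where
  "redseq M k = M k / fact k"

definition hfun :: "(nat \<Rightarrow> real) \<Rightarrow> real \<Rightarrow> real" where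
  "hfun m t = (INF k. m k * t ^ k)"

text \<open>For \<open>t > 0\<close> both minima exist when \<open>m\<^sub>k\<close> is positive with \<open>m\<^sub>k\<^sup>1\<^sup>/\<^sup>k \<rightarrow> \<infinity>\<close>.\<close>

definition Gamma_upper :: "(nat \<Rightarrow> real) \<Rightarrow> real \<Rightarrow> nat" where
  "Gamma_upper m t = (LEAST k. hfun m t = m k * t ^ k)"

definition Gamma_lower :: "(nat \<Rightarrow> real) \<Rightarrow> real \<Rightarrow> nat" where
  "Gamma_lower m t = (LEAST k. m (Suc k) / m k \<ge> 1 / t)"

definition mg :: "(nat \<Rightarrow> real) \<Rightarrow> (nat \<Rightarrow> real) \<Rightarrow> ennreal" where
  "mg M N = (SUP (j, k)\<in>{(j, k). j + k \<ge> 1}.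
               ennreal (root (j + k) (M (j + k) / (N j * N k))))"

datatype regime = Roumieu | Beurling

primrec admissible :: "regime \<Rightarrow> (nat \<Rightarrow> real) set \<Rightarrow> bool" where
  "admissible Roumieu \<MM> \<longleftrightarrow>
     (\<forall>M\<in>\<MM>. filterlim (\<lambda>k. root k (redseq M k)) at_top sequentially) \<and>
     (\<forall>M\<in>\<MM>. \<exists>N\<in>\<MM>. \<exists>C\<ge>1. \<forall>t>0.
        Gamma_upper (redseq N) (C * t) \<le> Gamma_lower (redseq M) t) \<and>
     (\<forall>M\<in>\<MM>. \<exists>N\<in>\<MM>. mg M N < \<infinity>)"
| "admissible Beurling \<MM> \<longleftrightarrow>
     (\<forall>M\<in>\<MM>. filterlim (\<lambda>k. root k (redseq M k)) at_top sequentially) \<and>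
     (\<forall>M\<in>\<MM>. \<exists>N\<in>\<MM>. \<exists>C\<ge>1. \<forall>t>0.
        Gamma_upper (redseq M) (C * t) \<le> Gamma_lower (redseq N) t) \<and>
     (\<forall>M\<in>\<MM>. \<exists>N\<in>\<MM>. mg N M < \<infinity>)"

definition seminorm_M ::
  "(nat \<Rightarrow> real) \<Rightarrow> 'a::real_normed_vector set \<Rightarrow> real \<Rightarrow> ('a \<Rightarrow> complex) \<Rightarrow> ennreal" where
  "seminorm_M M K \<rho> f =
     (SUP x\<in>K. SUP k. ennreal (mnorm k (fderiv k f x) / (\<rho> ^ k * M k)))"

text \<open>
  Functions on \<open>U\<close> are represented by total functions whose values outside \<open>U\<close> are irrelevant;
  both kinds of classes are meant for open \<open>U\<close>.
\<close>

primrec E_matrix ::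
  "regime \<Rightarrow> (nat \<Rightarrow> real) set \<Rightarrow> 'a::real_normed_vector set \<Rightarrow> ('a \<Rightarrow> complex) set" where
  "E_matrix Roumieu \<MM> U = {f. smooth_on U f \<and>
     (\<forall>K. compact K \<and> K \<subseteq> U \<longrightarrow> (\<exists>M\<in>\<MM>. \<exists>\<rho>>0. seminorm_M M K \<rho> f < \<infinity>))}"
| "E_matrix Beurling \<MM> U = {f. smooth_on U f \<and>
     (\<forall>K. compact K \<and> K \<subseteq> U \<longrightarrow> (\<forall>M\<in>\<MM>. \<forall>\<rho>>0. seminorm_M M K \<rho> f < \<infinity>))}"


section \<open>Weight functions\<close>

text \<open>Weight functions are maps on \<open>[0, \<infinity>)\<close>; their values at negative arguments are irrelevant.\<close>

definition weight_function :: "(real \<Rightarrow> real) \<Rightarrow> bool" where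
  "weight_function \<omega> \<longleftrightarrow>
     continuous_on {0..} \<omega> \<and> mono_on {0..} \<omega> \<and> (\<forall>t\<ge>0. \<omega> t \<ge> 0) \<and>
     (\<lambda>t. \<omega> (2 * t)) \<in> O[at_top](\<omega>) \<and>
     \<omega> \<in> o[at_top](\<lambda>t. t) \<and>
     ln \<in> o[at_top](\<omega>) \<and>
     convex_on {0..} (\<lambda>t. \<omega> (exp t))"

text \<open>The supremum is finite for weight functions, since \<open>log t = o(\<omega>(t))\<close>.\<close>

definition phi_conj :: "(real \<Rightarrow> real) \<Rightarrow> real \<Rightarrow> real" where
  "phi_conj \<omega> y = (SUP x\<in>{0..}. x * y - \<omega> (exp x))"

definition seminorm_w ::
  "(real \<Rightarrow> real) \<Rightarrow> 'a::real_normed_vector set \<Rightarrow> real \<Rightarrow> ('a \<Rightarrow> complex) \<Rightarrow> ennreal" where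
  "seminorm_w \<omega> K \<rho> f =
     (SUP x\<in>K. SUP k. ennreal (mnorm k (fderiv k f x) * exp (- (1 / \<rho>) * phi_conj \<omega> (\<rho> * real k))))"

primrec E_weight ::
  "regime \<Rightarrow> (real \<Rightarrow> real) \<Rightarrow> 'a::real_normed_vector set \<Rightarrow> ('a \<Rightarrow> complex) set" where
  "E_weight Roumieu \<omega> U = {f. smooth_on U f \<and>
     (\<forall>K. compact K \<and> K \<subseteq> U \<longrightarrow> (\<exists>\<rho>>0. seminorm_w \<omega> K \<rho> f < \<infinity>))}"
| "E_weight Beurling \<omega> U = {f. smooth_on U f \<and>
     (\<forall>K. compact K \<and> K \<subseteq> U \<longrightarrow> (\<forall>\<rho>>0. seminorm_w \<omega> K \<rho> f < \<infinity>))}"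

end

theory Submission
  imports Defs "HOL-Complex_Analysis.Complex_Analysis"
    "HOL-Computational_Algebra.Fundamental_Theorem_Algebra"
begin

text \<open>
  Write \<open>g = f\<^sup>j\<close> and \<open>h = f\<^sup>j\<^sup>+\<^sup>1\<close>.  Along a line, the Taylor series \<open>G, H\<close> of \<open>g, h\<close> satisfy
  \<open>G\<^sup>j\<^sup>+\<^sup>1 = H\<^sup>j\<close>, so there is a formal power series \<open>F\<close> with \<open>F\<^sup>j = G\<close>, \<open>F\<^sup>j\<^sup>+\<^sup>1 = H\<close>.  The main estimate
  bounds the \<open>k\<close>-th coefficient of \<open>F\<close> geometrically by finitely many coefficients of \<open>G\<close> and \<open>H\<close>, those
  up to order \<open>D k\<close> with \<open>D\<close> depending on \<open>j\<close> only.  The coefficient is the residue at \<open>0\<close> of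
  \<open>H / (G z\<^sup>k\<^sup>+\<^sup>1)\<close> for the truncated \<open>G, H\<close>; where \<open>G\<close> is not too small, \<open>G\<^sup>j\<^sup>+\<^sup>1 \<approx> H\<^sup>j\<close> makes \<open>H / G\<close> bounded,
  and contours avoiding the zeros of \<open>G\<close> exist by a Cartan-type lower bound for polynomials.

  The closeness of \<open>f\<close> to the expansions \<open>F\<close> is uniform in the line, and functions with such uniform expansions
  are smooth in the Frechet sense.  Polarization then bounds the derivatives of \<open>f\<close> by those of \<open>g, h\<close> of
  order at most \<open>D k\<close>.  This loss is absorbed by the weights: orders below \<open>k\<close> by the Gamma condition
  (respectively by concavity of \<open>\<omega>\<close>), orders between \<open>k\<close> and \<open>D k\<close> by moderate growth (respectively by
  convexity of the conjugate).
\<close>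

section \<open>Residues of quotients of polynomials\<close>

text \<open>The obstacle is the zero set of f. Where f does not vanish, f = h / g, but every direct
  estimate of this quotient degenerates near zeros, and no lower bound for g is available. The
  coefficient estimate must therefore not depend on the size of G at the origin.

  This explains D = 2 j (j + 1). Truncating at order n = D k perturbs G^(j+1) = H^j by about t^n at
  distance t from 0. Hence H / G is under control only where |G| exceeds about t^(2 j k), and just
  above that threshold |H / G| is about |G|^(1/j), that is t^(2 k). Dividing by z^(k+1) and
  integrating over a length of order t leaves t^k, so the errors made at the scales t, t/4, t/16,
  ... sum geometrically. With j (j + 1) instead of 2 j (j + 1) there would be no decay in t, while
  the number of scales is unbounded.

  A second obstacle: f itself is not assumed smooth, or even continuous. Knowing f^j and f^(j+1) up
  to O(s^M) gives f only up to O(s^(M/(j+1))). This is harmless because expansions of every order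
  are available.

  A third: balls in E need not be relatively compact, so bounds on compact sets must first be turned
  into bounds on balls.\<close>

text \<open>Chebyshev's bound for monic polynomials on an interval, up to a factor 2. On [-1, 1]
  write the point as Re w with |w| = 1: then |Re w - y| is the modulus of (w^2 - 2 y w + 1) / 2, a
  polynomial in w with value 1/2 at 0. The maximum principle for the product of these factors gives
  a point of the circle where it is at least (1/2)^n.\<close>

lemma prod_dist_lower_bound:
  fixes x :: "nat \<Rightarrow> real"
  assumes "u \<le> v"
  shows "\<exists>\<rho>\<in>{u..v}. (\<Prod>i<n. \<bar>\<rho> - x i\<bar>) \<ge> ((v - u) / 4) ^ n"
proof (cases "u = v")
  case True
  then show ?thesis by (cases n) (auto intro!: mult_nonneg_nonneg prod_nonneg)
next
  case False
  define c h where "c = (u + v) / 2" and "h = (v - u) / 2"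
  have h: "h > 0" using False assms by (simp add: h_def)
  define y where "y i = (x i - c) / h" for i
  define p where "p w = (\<Prod>i<n. (w\<^sup>2 - 2 * of_real (y i) * w + 1) / (2::complex))" for w
  have "\<exists>w. norm w = 1 \<and> norm (p w) \<ge> (1/2) ^ n"
  proof (rule ccontr)
    assume "\<not> ?thesis"
    then have lt: "norm (p w) < (1/2) ^ n" if "norm w = 1" for w using that by force
    have nb: "norm (p 0) = (1/2) ^ n" by (simp add: p_def norm_power norm_divide power_divide)
    have cont: "continuous_on S p" for S
      unfolding p_def by (intro continuous_intros) auto
    have "compact (sphere (0::complex) 1)" "sphere (0::complex) 1 \<noteq> {}" by auto
    from continuous_attains_sup[OF this continuous_on_norm[OF cont]]
    obtain w0 where w0: "norm w0 = 1" "\<And>w. norm w = 1 \<Longrightarrow> norm (p w) \<le> norm (p w0)"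
      by (auto simp: sphere_def)
    have "norm (p 0) \<le> norm (p w0)"
      by (rule maximum_modulus_frontier[where S = "cball 0 1"])
        (use w0 cont in \<open>auto simp: p_def intro!: holomorphic_intros\<close>)
    also have "\<dots> < (1/2) ^ n" using lt w0 by blast
    finally show False using nb by simp
  qed
  then obtain w where w: "norm w = 1" "norm (p w) \<ge> (1/2) ^ n" by blast
  have wcnj: "w * cnj w = 1" using w(1) by (simp add: complex_norm_square[symmetric])
  have fac: "w\<^sup>2 - 2 * of_real a * w + 1 = w * of_real (2 * (Re w - a))" for a
  proof -
    have "w\<^sup>2 - 2 * of_real a * w + 1 = w * (w + cnj w - 2 * of_real a)"
      using wcnj by (simp add: algebra_simps power2_eq_square)
    then show ?thesis by (simp add: complex_add_cnj algebra_simps)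
  qed
  have "norm (w * of_real (2 * (Re w - a)) / 2) = \<bar>Re w - a\<bar>" for a
    by (simp only: norm_divide norm_mult w(1) norm_of_real abs_mult) simp
  then have "norm (p w) = (\<Prod>i<n. \<bar>Re w - y i\<bar>)"
    unfolding p_def fac prod_norm[symmetric] by simp
  then have 1: "(1/2) ^ n \<le> (\<Prod>i<n. \<bar>Re w - y i\<bar>)" using w(2) by simp
  define \<rho> where "\<rho> = c + h * Re w"
  have "\<bar>Re w\<bar> \<le> 1" using abs_Re_le_cmod[of w] w(1) by simp
  then have "\<bar>h * Re w\<bar> \<le> h" using h by (simp add: abs_mult mult_left_le)
  then have "\<rho> \<in> {u..v}" by (auto simp: \<rho>_def c_def h_def field_simps abs_le_iff)
  moreover have "\<rho> - x i = h * (Re w - y i)" for i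
    using h by (simp add: \<rho>_def y_def field_simps)
  then have "(\<Prod>i<n. \<bar>\<rho> - x i\<bar>) = h ^ n * (\<Prod>i<n. \<bar>Re w - y i\<bar>)"
    using h by (simp add: abs_mult prod.distrib)
  moreover have "h ^ n * (1/2) ^ n \<le> h ^ n * (\<Prod>i<n. \<bar>Re w - y i\<bar>)"
    using 1 h by (intro mult_left_mono) auto
  moreover have "h ^ n * (1/2) ^ n = ((v - u) / 4) ^ n"
    by (simp add: h_def power_mult_distrib[symmetric])
  ultimately show ?thesis by (intro bexI[of _ \<rho>]) simp_all
qed

text \<open>A polynomial cannot be much smaller on a well-chosen line than at a nearby point: every
  factor loses at most a constant, except for those whose zero is close to the line.\<close>

lemma poly_good_line:
  fixes G :: "complex poly" and p :: "complex \<Rightarrow> real"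
  assumes p: "\<And>z w. \<bar>p z - p w\<bar> \<le> norm (z - w)"
    and uv: "u < v" "v - u \<le> \<Delta>" and deg: "degree G \<le> n"
  shows "\<exists>\<xi>\<in>{u..v}. \<forall>z. p z = \<xi> \<and> norm (z - w0) \<le> \<Delta> \<longrightarrow>
           norm (poly G z) \<ge> ((v - u) / (8 * \<Delta>)) ^ n * norm (poly G w0)"
proof -
  obtain a where G: "smult (lead_coeff G) (\<Prod>i<degree G. [:- a i, 1:]) = G"
    using complex_poly_decompose' by blast
  define N where "N = degree G"
  \<comment> \<open>Projecting to [u, v] keeps \<open>\<bar>\<xi> - x i\<bar>\<close> below both |z
    - a i| and \<Delta>. In \<open>fac\<close> the first bound handles zeros near the line, the
    second handles distant ones.\<close>
  define x where "x i = max u (min v (p (a i)))" for i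
  obtain \<xi> where \<xi>: "\<xi> \<in> {u..v}" "(\<Prod>i<N. \<bar>\<xi> - x i\<bar>) \<ge> ((v - u) / 4) ^ N"
    using prod_dist_lower_bound[of u v N x] uv by auto
  have D: "\<Delta> > 0" using uv by simp
  have val: "norm (poly G z) = norm (lead_coeff G) * (\<Prod>i<N. norm (z - a i))" for z
    by (subst G[symmetric]) (simp add: poly_prod norm_mult prod_norm N_def norm_minus_commute)
  have main: "((v - u) / (8 * \<Delta>)) ^ n * norm (poly G w0) \<le> norm (poly G z)"
    if z: "p z = \<xi>" "norm (z - w0) \<le> \<Delta>" for z
  proof -
    have fac: "\<bar>\<xi> - x i\<bar> * norm (w0 - a i) \<le> 2 * \<Delta> * norm (z - a i)" for i
    proof -
      have 1: "\<bar>\<xi> - x i\<bar> \<le> \<bar>\<xi> - p (a i)\<bar>" "\<bar>\<xi> - x i\<bar> \<le> \<Delta>"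
        using \<xi>(1) uv by (auto simp: x_def max_def min_def)
      have 2: "\<bar>\<xi> - x i\<bar> \<le> norm (z - a i)" using 1(1) p[of z "a i"] z(1) by linarith
      have "norm (w0 - a i) \<le> norm (w0 - z) + norm (z - a i)"
        using norm_triangle_ineq[of "w0 - z" "z - a i"] by simp
      then have "norm (w0 - a i) \<le> \<Delta> + norm (z - a i)" using z(2) by (simp add: norm_minus_commute)
      then have "\<bar>\<xi> - x i\<bar> * norm (w0 - a i) \<le> \<bar>\<xi> - x i\<bar> * (\<Delta> + norm (z - a i))"
        by (intro mult_left_mono) auto
      also have "\<dots> \<le> norm (z - a i) * \<Delta> + \<Delta> * norm (z - a i)"
        unfolding distrib_left using 1 2 D by (intro add_mono mult_right_mono) auto
      finally show ?thesis by simp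
    qed
    have "((v - u) / 4) ^ N * (\<Prod>i<N. norm (w0 - a i))
        \<le> (\<Prod>i<N. \<bar>\<xi> - x i\<bar>) * (\<Prod>i<N. norm (w0 - a i))"
      using \<xi>(2) by (intro mult_right_mono prod_nonneg) auto
    also have "\<dots> \<le> (\<Prod>i<N. 2 * \<Delta> * norm (z - a i))"
      unfolding prod.distrib[symmetric] using fac by (intro prod_mono) auto
    finally have *: "((v - u) / 4) ^ N * (\<Prod>i<N. norm (w0 - a i))
        \<le> (2 * \<Delta>) ^ N * (\<Prod>i<N. norm (z - a i))"
      by (simp add: prod.distrib)
    have "((v - u) / (8 * \<Delta>)) ^ n \<le> ((v - u) / (8 * \<Delta>)) ^ N"
      using uv D deg by (intro power_decreasing) (auto simp: N_def)
    also have "\<dots> = ((v - u) / 4 / (2 * \<Delta>)) ^ N" by simp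
    also have "\<dots> = ((v - u) / 4) ^ N / (2 * \<Delta>) ^ N"
      by (rule power_divide)
    finally have "((v - u) / (8 * \<Delta>)) ^ n * norm (poly G w0)
        \<le> ((v - u) / 4) ^ N / (2 * \<Delta>) ^ N * norm (poly G w0)"
      by (rule mult_right_mono) simp
    also have "\<dots> = norm (lead_coeff G) * (((v - u) / 4) ^ N * (\<Prod>i<N. norm (w0 - a i))) / (2 * \<Delta>) ^ N"
      by (simp add: val)
    also have "\<dots> \<le> norm (lead_coeff G) * ((2 * \<Delta>) ^ N * (\<Prod>i<N. norm (z - a i))) / (2 * \<Delta>) ^ N"
      using * D by (intro divide_right_mono mult_left_mono) auto
    also have "\<dots> = norm (poly G z)" using D by (simp add: val)
    finally show ?thesis .
  qed
  with \<xi>(1) show ?thesis by blast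
qed

section \<open>Contour integrals and residues over subdivided rectangles\<close>

lemma contour_integral_rectpath_bound:
  assumes "continuous_on (path_image (rectpath a b)) f" "0 \<le> B"
    and "\<And>z. z \<in> path_image (rectpath a b) \<Longrightarrow> norm (f z) \<le> B"
    and "Re a \<le> Re b" "Im a \<le> Im b"
  shows "norm (contour_integral (rectpath a b) f) \<le> B * (2 * (Re b - Re a) + 2 * (Im b - Im a))"
proof -
  define a2 a4 where "a2 = Complex (Re b) (Im a)" and "a4 = Complex (Re a) (Im b)"
  have rp: "rectpath a b = linepath a a2 +++ linepath a2 b +++ linepath b a4 +++ linepath a4 a"
    by (simp add: rectpath_def Let_def a2_def a4_def)
  have pim: "path_image (rectpath a b) = closed_segment a a2 \<union> closed_segment a2 b \<union>
      closed_segment b a4 \<union> closed_segment a4 a"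
    unfolding rp by (simp add: path_image_join Un_assoc)
  have int: "f contour_integrable_on linepath p q" if "closed_segment p q \<subseteq> path_image (rectpath a b)" for p q
    using that assms(1) by (intro contour_integrable_continuous_linepath) (auto intro: continuous_on_subset)
  have ii: "f contour_integrable_on linepath a a2" "f contour_integrable_on linepath a2 b"
     "f contour_integrable_on linepath b a4" "f contour_integrable_on linepath a4 a"
    by (rule int; auto simp: pim)+
  have bd: "norm (contour_integral (linepath p q) f) \<le> B * norm (q - p)"
    if "f contour_integrable_on linepath p q" "closed_segment p q \<subseteq> path_image (rectpath a b)" for p q
    using that assms(2,3) by (intro contour_integral_bound_linepath) auto
  have nn: "norm (a2 - a) = Re b - Re a" "norm (b - a2) = Im b - Im a"
    "norm (a4 - b) = Re b - Re a" "norm (a - a4) = Im b - Im a"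
    using assms(4,5) by (auto simp: a2_def a4_def cmod_def)
  have "contour_integral (rectpath a b) f = contour_integral (linepath a a2) f +
     (contour_integral (linepath a2 b) f + (contour_integral (linepath b a4) f +
       contour_integral (linepath a4 a) f))"
    unfolding rp using ii by (simp add: contour_integral_join contour_integrable_joinI)
  also have "norm \<dots> \<le> B * norm (a2 - a) + (B * norm (b - a2) + (B * norm (a4 - b) + B * norm (a - a4)))"
    by (intro norm_triangle_le add_mono bd ii) (auto simp: pim)
  finally show ?thesis unfolding nn by (simp add: algebra_simps)
qed

lemma residue_theorem_rectpath:
  assumes "finite P" "f holomorphic_on (UNIV - P)" "Re a \<le> Re b" "Im a \<le> Im b"
    and "P \<inter> path_image (rectpath a b) = {}"
  shows "contour_integral (rectpath a b) f = 2 * pi * \<i> * (\<Sum>p\<in>P \<inter> cbox a b. residue f p)"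
proof -
  have "contour_integral (rectpath a b) f =
      2 * pi * \<i> * (\<Sum>p\<in>P. winding_number (rectpath a b) p * residue f p)"
    using assms by (intro Residue_theorem[of UNIV]) auto
  also have "(\<Sum>p\<in>P. winding_number (rectpath a b) p * residue f p)
      = (\<Sum>p\<in>P. if p \<in> cbox a b then residue f p else 0)"
  proof (intro sum.cong refl)
    fix p assume "p \<in> P"
    show "winding_number (rectpath a b) p * residue f p = (if p \<in> cbox a b then residue f p else 0)"
    proof (cases "p \<in> cbox a b")
      case True
      then have "p \<in> box a b"
        using path_image_rectpath_cbox_minus_box[OF assms(3,4)] assms(5) \<open>p \<in> P\<close> by blast
      then show ?thesis using True by (simp add: winding_number_rectpath)
    next
      case False
      then show ?thesis using winding_number_rectpath_outside[OF assms(3,4)] by simp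
    qed
  qed
  also have "\<dots> = (\<Sum>p\<in>P \<inter> cbox a b. residue f p)"
    using assms(1) by (simp add: sum.inter_restrict)
  finally show ?thesis .
qed

text \<open>The longer side, of length w, is cut in its middle half. It is at least half of the sum
  of both sides, so each piece loses at least w/4, an eighth of that sum. The constant is the ratio
  of \<open>poly_good_line\<close> for an interval of length w/2 and distances at most 2 w: (w/2) /
  (8 * 2 w) = 1/32.\<close>

lemma rect_split:
  fixes G :: "complex poly"
  assumes le: "Re a \<le> Re b" "Im a \<le> Im b" and ne: "a \<noteq> b" and w0: "w0 \<in> cbox a b"
    and deg: "degree G \<le> n"
  defines "m \<equiv> (1 / 32) ^ n * norm (poly G w0)"
  shows "\<exists>a' b'. a' \<in> cbox a b \<and> b' \<in> cbox a b \<and> cbox a b = cbox a b' \<union> cbox a' b \<and>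
      (\<forall>z \<in> path_image (rectpath a b') \<union> path_image (rectpath a' b).
         z \<in> path_image (rectpath a b) \<or> m \<le> norm (poly G z)) \<and>
      (\<forall>z \<in> cbox a b' \<inter> cbox a' b. m \<le> norm (poly G z)) \<and>
      (Re b' - Re a) + (Im b' - Im a) \<le> 7 / 8 * ((Re b - Re a) + (Im b - Im a)) \<and>
      (Re b - Re a') + (Im b - Im a') \<le> 7 / 8 * ((Re b - Re a) + (Im b - Im a))"
proof -
  have ne': "Re a < Re b \<or> Im a < Im b" using le ne by (auto simp: complex_eq_iff)
  have dist: "norm (z - w0) \<le> (Re b - Re a) + (Im b - Im a)" if "z \<in> cbox a b" for z
  proof -
    have "norm (z - w0) \<le> \<bar>Re (z - w0)\<bar> + \<bar>Im (z - w0)\<bar>" by (rule cmod_le)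
    also have "\<bar>Re (z - w0)\<bar> \<le> Re b - Re a" using that w0 by (auto simp: in_cbox_complex_iff)
    also have "\<bar>Im (z - w0)\<bar> \<le> Im b - Im a" using that w0 by (auto simp: in_cbox_complex_iff)
    finally show ?thesis by simp
  qed
  show ?thesis
  proof (cases "Re b - Re a \<ge> Im b - Im a")
    case True
    define w where "w = Re b - Re a"
    have w: "w > 0" using True ne' by (auto simp: w_def)
    obtain \<xi> where \<xi>: "\<xi> \<in> {Re a + w/4 .. Re a + 3*w/4}"
      "\<And>z. Re z = \<xi> \<Longrightarrow> norm (z - w0) \<le> 2 * w \<Longrightarrow>
        ((Re a + 3*w/4 - (Re a + w/4)) / (8 * (2*w))) ^ n * norm (poly G w0) \<le> norm (poly G z)"
      using poly_good_line[of Re "Re a + w/4" "Re a + 3*w/4" "2*w" G n w0] w deg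
      by (force simp: abs_Re_le_cmod simp flip: minus_complex.sel)
    have q: "(Re a + 3*w/4 - (Re a + w/4)) / (8 * (2*w)) = 1 / 32" using w by (simp add: field_simps)
    have line: "m \<le> norm (poly G z)" if "Re z = \<xi>" "z \<in> cbox a b" for z
    proof -
      have "norm (z - w0) \<le> 2 * w" using dist[OF that(2)] True by (simp add: w_def)
      from \<xi>(2)[OF that(1) this] show ?thesis unfolding m_def q .
    qed
    have \<xi>': "Re a \<le> \<xi>" "\<xi> \<le> Re b" "\<xi> - Re a \<le> 3 / 4 * w" "Re b - \<xi> \<le> 3 / 4 * w"
      using \<xi>(1) w by (auto simp: w_def field_simps)
    have w': "w / 4 \<ge> 1 / 8 * ((Re b - Re a) + (Im b - Im a))" using True by (simp add: w_def)
    let ?a = "Complex \<xi> (Im a)" and ?b = "Complex \<xi> (Im b)"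
    show ?thesis
    proof (rule exI[of _ ?a], rule exI[of _ ?b], intro conjI ballI)
      show "?a \<in> cbox a b" "?b \<in> cbox a b" "cbox a b = cbox a ?b \<union> cbox ?a b"
        using \<xi>'(1,2) le by (auto simp: in_cbox_complex_iff)
      show "m \<le> norm (poly G z)" if "z \<in> cbox a ?b \<inter> cbox ?a b" for z
        using that \<xi>'(1,2) by (intro line) (auto simp: in_cbox_complex_iff)
      show "z \<in> path_image (rectpath a b) \<or> m \<le> norm (poly G z)"
        if "z \<in> path_image (rectpath a ?b) \<union> path_image (rectpath ?a b)" for z
      proof (cases "Re z = \<xi>")
        case True
        have "z \<in> cbox a b"
          using that \<xi>'(1,2) le by (auto simp: in_cbox_complex_iff path_image_rectpath)
        with line True show ?thesis by blast
      next
        case False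
        with that \<xi>'(1,2) le show ?thesis by (auto simp: path_image_rectpath)
      qed
      show "(Re ?b - Re a) + (Im ?b - Im a) \<le> 7 / 8 * ((Re b - Re a) + (Im b - Im a))"
        "(Re b - Re ?a) + (Im b - Im ?a) \<le> 7 / 8 * ((Re b - Re a) + (Im b - Im a))"
        using \<xi>'(3,4) w' by (simp_all add: w_def field_simps)
    qed
  next
    case False
    define w where "w = Im b - Im a"
    have w: "w > 0" using False ne' le by (auto simp: w_def)
    obtain \<xi> where \<xi>: "\<xi> \<in> {Im a + w/4 .. Im a + 3*w/4}"
      "\<And>z. Im z = \<xi> \<Longrightarrow> norm (z - w0) \<le> 2 * w \<Longrightarrow>
        ((Im a + 3*w/4 - (Im a + w/4)) / (8 * (2*w))) ^ n * norm (poly G w0) \<le> norm (poly G z)"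
      using poly_good_line[of Im "Im a + w/4" "Im a + 3*w/4" "2*w" G n w0] w deg
      by (force simp: abs_Im_le_cmod simp flip: minus_complex.sel)
    have q: "(Im a + 3*w/4 - (Im a + w/4)) / (8 * (2*w)) = 1 / 32" using w by (simp add: field_simps)
    have line: "m \<le> norm (poly G z)" if "Im z = \<xi>" "z \<in> cbox a b" for z
    proof -
      have "norm (z - w0) \<le> 2 * w" using dist[OF that(2)] False by (simp add: w_def)
      from \<xi>(2)[OF that(1) this] show ?thesis unfolding m_def q .
    qed
    have \<xi>': "Im a \<le> \<xi>" "\<xi> \<le> Im b" "\<xi> - Im a \<le> 3 / 4 * w" "Im b - \<xi> \<le> 3 / 4 * w"
      using \<xi>(1) w by (auto simp: w_def field_simps)
    have w': "w / 4 \<ge> 1 / 8 * ((Re b - Re a) + (Im b - Im a))" using False by (simp add: w_def)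
    let ?a = "Complex (Re a) \<xi>" and ?b = "Complex (Re b) \<xi>"
    show ?thesis
    proof (rule exI[of _ ?a], rule exI[of _ ?b], intro conjI ballI)
      show "?a \<in> cbox a b" "?b \<in> cbox a b" "cbox a b = cbox a ?b \<union> cbox ?a b"
        using \<xi>'(1,2) le by (auto simp: in_cbox_complex_iff)
      show "m \<le> norm (poly G z)" if "z \<in> cbox a ?b \<inter> cbox ?a b" for z
        using that \<xi>'(1,2) by (intro line) (auto simp: in_cbox_complex_iff)
      show "z \<in> path_image (rectpath a b) \<or> m \<le> norm (poly G z)"
        if "z \<in> path_image (rectpath a ?b) \<union> path_image (rectpath ?a b)" for z
      proof (cases "Im z = \<xi>")
        case True
        have "z \<in> cbox a b"
          using that \<xi>'(1,2) le by (auto simp: in_cbox_complex_iff path_image_rectpath)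
        with line True show ?thesis by blast
      next
        case False
        with that \<xi>'(1,2) le show ?thesis by (auto simp: path_image_rectpath)
      qed
      show "(Re ?b - Re a) + (Im ?b - Im a) \<le> 7 / 8 * ((Re b - Re a) + (Im b - Im a))"
        "(Re b - Re ?a) + (Im b - Im ?a) \<le> 7 / 8 * ((Re b - Re a) + (Im b - Im a))"
        using \<xi>'(3,4) w' by (simp_all add: w_def field_simps)
    qed
  qed
qed

text \<open>The rectangle is cut along good lines until \<open>G\<close> is at most \<open>r1\<close> on every piece that contains
  a pole.  The residues in such a piece are then controlled by its boundary integral.\<close>

lemma rect_residues_bound:
  fixes G :: "complex poly" and \<phi> :: "complex \<Rightarrow> complex" and r r1 B L :: real
  assumes P: "finite P" "\<phi> holomorphic_on (UNIV - P)" "\<And>p. p \<in> P \<inter> cbox a0 b0 \<Longrightarrow> poly G p = 0"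
    and bnd: "\<And>z. z \<in> cbox a0 b0 \<Longrightarrow> r \<le> norm (poly G z) \<Longrightarrow> norm (poly G z) \<le> r1 \<Longrightarrow> norm (\<phi> z) \<le> B"
    and r: "0 < r" "r \<le> (1 / 32) ^ n * r1" and deg: "degree G \<le> n" and B: "0 \<le> B"
    and L: "2 * (Re b0 - Re a0) + 2 * (Im b0 - Im a0) \<le> L"
    and le: "Re a0 \<le> Re b0" "Im a0 \<le> Im b0"
    and bdry: "\<And>z. z \<in> path_image (rectpath a0 b0) \<Longrightarrow> r \<le> norm (poly G z)"
  shows "norm (2 * pi * \<i> * (\<Sum>p\<in>P \<inter> cbox a0 b0. residue \<phi> p)) \<le> card (P \<inter> cbox a0 b0) * (B * L)"
proof -
  have "0 < (1 / 32) ^ n * r1" using r by linarith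
  then have r1: "r1 > 0" by (simp add: zero_less_mult_iff)
  have "uniformly_continuous_on (cbox a0 b0) (poly G)"
    by (intro compact_uniformly_continuous continuous_intros compact_cbox)
  \<comment> \<open>This ends the subdivision: a rectangle with \<open>s a b\<close> below \<eta>
    that contains a pole, hence a zero of \<open>G\<close>, has |G| < r1 throughout.\<close>
  then obtain \<eta> where \<eta>: "\<eta> > 0" "\<And>z w. z \<in> cbox a0 b0 \<Longrightarrow> w \<in> cbox a0 b0 \<Longrightarrow> dist z w < \<eta> \<Longrightarrow>
      dist (poly G z) (poly G w) < r1"
    using r1 unfolding uniformly_continuous_on_def by metis
  define s :: "complex \<Rightarrow> complex \<Rightarrow> real" where "s a b = (Re b - Re a) + (Im b - Im a)" for a b
  \<comment> \<open>A piece without poles contributes nothing, and any other piece is charged to one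
    of its poles. The bound thus counts poles, which is additive under cuts, and does not grow with
    the depth of the subdivision.\<close>
  have leaf: "norm (2 * pi * \<i> * (\<Sum>p\<in>P \<inter> cbox a b. residue \<phi> p)) \<le> card (P \<inter> cbox a b) * (B * L)"
    if ab: "a \<in> cbox a0 b0" "b \<in> cbox a0 b0" "Re a \<le> Re b" "Im a \<le> Im b"
      and bd: "\<And>z. z \<in> path_image (rectpath a b) \<Longrightarrow> r \<le> norm (poly G z)"
      and small: "P \<inter> cbox a b \<noteq> {} \<Longrightarrow> \<forall>z\<in>cbox a b. norm (poly G z) \<le> r1" for a b
  proof (cases "P \<inter> cbox a b = {}")
    case False
    have sub: "path_image (rectpath a b) \<subseteq> cbox a b" "cbox a b \<subseteq> cbox a0 b0"
      using ab path_image_rectpath_subset_cbox by (auto simp: in_cbox_complex_iff)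
    have disj: "P \<inter> path_image (rectpath a b) = {}"
      using bd P(3) sub r(1) by (fastforce)
    have "2 * pi * \<i> * (\<Sum>p\<in>P \<inter> cbox a b. residue \<phi> p) = contour_integral (rectpath a b) \<phi>"
      using residue_theorem_rectpath[OF P(1,2) ab(3,4) disj] by simp
    also have "norm \<dots> \<le> B * (2 * (Re b - Re a) + 2 * (Im b - Im a))"
    proof (rule contour_integral_rectpath_bound)
      show "continuous_on (path_image (rectpath a b)) \<phi>"
        using P(2) disj by (intro holomorphic_on_imp_continuous_on) (auto elim: holomorphic_on_subset)
      show "norm (\<phi> z) \<le> B" if "z \<in> path_image (rectpath a b)" for z
        using that bnd[of z] bd[of z] small False sub by blast
    qed (use B ab in auto)
    also have "\<dots> \<le> B * L"
      using B L ab by (intro mult_left_mono) (auto simp: in_cbox_complex_iff)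
    also have "\<dots> \<le> card (P \<inter> cbox a b) * (B * L)"
    proof -
      have "card (P \<inter> cbox a b) \<ge> 1" using False P(1) by (simp add: Suc_le_eq card_gt_0_iff)
      moreover have "0 \<le> B * L" using B L le by simp
      ultimately show ?thesis using mult_right_mono[of 1 "real (card (P \<inter> cbox a b))" "B * L"] by simp
    qed
    finally show ?thesis .
  qed simp
  \<comment> \<open>\<open>d\<close> bounds the number of cuts still to be made, as each cut shrinks
    \<open>s\<close> by the factor 7/8.\<close>
  have main: "norm (2 * pi * \<i> * (\<Sum>p\<in>P \<inter> cbox a b. residue \<phi> p)) \<le> card (P \<inter> cbox a b) * (B * L)"
    if "a \<in> cbox a0 b0" "b \<in> cbox a0 b0" "Re a \<le> Re b" "Im a \<le> Im b"
      "\<And>z. z \<in> path_image (rectpath a b) \<Longrightarrow> r \<le> norm (poly G z)" "s a b < \<eta> * (8 / 7) ^ d" for a b d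
    using that
  proof (induction d arbitrary: a b)
    case 0
    have sub: "cbox a b \<subseteq> cbox a0 b0" using 0 by (auto simp: in_cbox_complex_iff)
    show ?case
    proof (rule leaf)
      assume "P \<inter> cbox a b \<noteq> {}"
      then obtain p where p: "p \<in> P" "p \<in> cbox a b" by blast
      then have p0: "poly G p = 0" using P(3) sub by blast
      show "\<forall>z\<in>cbox a b. norm (poly G z) \<le> r1"
      proof
        fix z assume z: "z \<in> cbox a b"
        have "dist z p \<le> \<bar>Re (z - p)\<bar> + \<bar>Im (z - p)\<bar>" unfolding dist_norm by (rule cmod_le)
        also have "\<dots> \<le> s a b" using z p by (auto simp: in_cbox_complex_iff s_def)
        finally have "dist (poly G z) (poly G p) < r1" using 0 z p sub by (intro \<eta>(2)) auto
        then show "norm (poly G z) \<le> r1" by (simp add: p0)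
      qed
    qed (use 0 in auto)
  next
    case (Suc d)
    have sub: "cbox a b \<subseteq> cbox a0 b0" using Suc.prems by (auto simp: in_cbox_complex_iff)
    show ?case
    proof (cases "P \<inter> cbox a b = {} \<or> (\<forall>z\<in>cbox a b. norm (poly G z) \<le> r1)")
      case True
      show ?thesis by (rule leaf) (use Suc.prems True in auto)
    next
      case False
      then obtain w0 p where w0: "w0 \<in> cbox a b" "norm (poly G w0) > r1" and p: "p \<in> P" "p \<in> cbox a b"
        by fastforce
      have "a \<noteq> b"
      proof
        assume "a = b"
        then have "p = a" "a \<in> path_image (rectpath a b)"
          using p by (auto simp: in_cbox_complex_iff complex_eq_iff path_image_rectpath)
        then show False using Suc.prems(5) P(3)[of p] p sub r(1) by force
      qed
      \<comment> \<open>The cut is made relative to a point where |G| exceeds r1, so |G| is at least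
        r on the new edges. They may therefore serve as boundaries, and no pole lies on
        them.\<close>
      have rr: "r \<le> (1 / 32) ^ n * norm (poly G w0)"
        using r(2) w0(2) by (meson less_imp_le mult_left_mono order_trans zero_le_divide_1_iff zero_le_numeral zero_le_power)
      from rect_split[OF Suc.prems(3,4) \<open>a \<noteq> b\<close> w0(1) deg]
      obtain a' b' where s: "a' \<in> cbox a b" "b' \<in> cbox a b" "cbox a b = cbox a b' \<union> cbox a' b"
        "\<And>z. z \<in> path_image (rectpath a b') \<union> path_image (rectpath a' b) \<Longrightarrow>
           z \<in> path_image (rectpath a b) \<or> (1 / 32) ^ n * norm (poly G w0) \<le> norm (poly G z)"
        "\<And>z. z \<in> cbox a b' \<inter> cbox a' b \<Longrightarrow> (1 / 32) ^ n * norm (poly G w0) \<le> norm (poly G z)"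
        "s a b' \<le> 7 / 8 * s a b" "s a' b \<le> 7 / 8 * s a b"
        unfolding s_def by blast
      have bd: "r \<le> norm (poly G z)" if "z \<in> path_image (rectpath a b') \<union> path_image (rectpath a' b)" for z
        using s(4)[OF that] Suc.prems(5) rr by force
      have sm: "s a b' < \<eta> * (8 / 7) ^ d" "s a' b < \<eta> * (8 / 7) ^ d" using s(6,7) Suc.prems(6) by auto
      have 1: "norm (2 * pi * \<i> * (\<Sum>p\<in>P \<inter> cbox a b'. residue \<phi> p)) \<le> card (P \<inter> cbox a b') * (B * L)"
        using s(1,2) Suc.prems sub bd sm by (intro Suc.IH) (auto simp: in_cbox_complex_iff)
      have 2: "norm (2 * pi * \<i> * (\<Sum>p\<in>P \<inter> cbox a' b. residue \<phi> p)) \<le> card (P \<inter> cbox a' b) * (B * L)"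
        using s(1,2) Suc.prems sub bd sm by (intro Suc.IH) (auto simp: in_cbox_complex_iff)
      have disj: "(P \<inter> cbox a b') \<inter> (P \<inter> cbox a' b) = {}"
        using s(5) rr P(3) sub s(3) r(1) by fastforce
      have un: "P \<inter> cbox a b = (P \<inter> cbox a b') \<union> (P \<inter> cbox a' b)" using s(3) by blast
      have "norm (2 * pi * \<i> * (\<Sum>p\<in>P \<inter> cbox a b. residue \<phi> p))
         \<le> norm (2 * pi * \<i> * (\<Sum>p\<in>P \<inter> cbox a b'. residue \<phi> p)) +
            norm (2 * pi * \<i> * (\<Sum>p\<in>P \<inter> cbox a' b. residue \<phi> p))"
        unfolding un using disj P(1)
        by (subst sum.union_disjoint) (auto simp: distrib_left intro: norm_triangle_ineq)
      also have "\<dots> \<le> (card (P \<inter> cbox a b') + card (P \<inter> cbox a' b)) * (B * L)"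
        using 1 2 by (simp add: distrib_right)
      also have "card (P \<inter> cbox a b') + card (P \<inter> cbox a' b) = card (P \<inter> cbox a b)"
        unfolding un using disj P(1) by (subst card_Un_disjoint) auto
      finally show ?thesis by simp
    qed
  qed
  obtain d where "s a0 b0 / \<eta> < (8 / 7) ^ d"
    using real_arch_pow[of "8/7" "s a0 b0 / \<eta>"] by auto
  then have "s a0 b0 < \<eta> * (8 / 7) ^ d" using \<eta>(1) by (simp add: field_simps)
  then show ?thesis using le bdry by (intro main) (auto simp: in_cbox_complex_iff)
qed

lemma path_image_rectpath_cases:
  assumes "z \<in> path_image (rectpath a b)" "Re a \<le> Re b" "Im a \<le> Im b"
  shows "z \<in> cbox a b \<and> (Re z = Re a \<or> Re z = Re b \<or> Im z = Im a \<or> Im z = Im b)"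
  using assms by (auto simp: path_image_rectpath in_cbox_complex_iff)

text \<open>Two polynomials with \<open>G\<^sup>j\<^sup>+\<^sup>1 \<approx> H\<^sup>j\<close> up to order \<open>n = Dk\<close> at the origin.  At scale \<open>t\<close>
  the regions where \<open>G\<close> exceeds \<open>low t\<close> and where it is below \<open>high t\<close> overlap, and in the overlap
  \<open>H / G\<close> is exponentially small in \<open>k\<close>.  The residue of \<open>H / (G z\<^sup>k\<^sup>+\<^sup>1)\<close> at \<open>0\<close>
  is the coefficient to be estimated.\<close>

locale jet_pair =
  fixes G H :: "complex poly" and j k :: nat
  assumes j: "j > 0" and k: "k > 0"
    and deg: "degree G \<le> 2 * j * (j + 1) * k"
    and G0: "poly G 0 \<noteq> 0"
    and G2: "\<And>z. norm z \<le> 1 / 2 \<Longrightarrow> norm (poly G z) \<le> 2"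
    and E: "\<And>z. norm z \<le> 1 / 2 \<Longrightarrow> norm (poly G z ^ (j + 1) - poly H z ^ j)
              \<le> (2 ^ (j + 3) * norm z) ^ (2 * j * (j + 1) * k)"
begin

definition n where "n = 2 * j * (j + 1) * k"
text \<open>Chosen so that \<open>low t ^ (j + 1)\<close> is exactly (2^(j+3) * 2 t)^n, the bound of
  assumption \<open>E\<close> on the disc of radius 2 t.\<close>

definition K :: real where "K = 2 ^ (j + 4) * 256 ^ (j + 1)"
text \<open>Its j-th root is (K t)^(2 k). Divided by |z|^(k+1) and integrated over a contour of
  length about t, this leaves a multiple of t^k.\<close>

definition high :: "real \<Rightarrow> real" where "high t = (K * t) ^ (2 * j * k)"
text \<open>The factor 1/256 is the loss of \<open>poly_good_line\<close> for an interval of length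
  t/8 and distances at most 4 t: (t/8) / (8 * 4 t). It also leaves room for the loss (1/32)^n in
  \<open>rect_split\<close>.\<close>

definition low :: "real \<Rightarrow> real" where "low t = (1 / 256) ^ n * high t"
definition \<phi> where "\<phi> z = poly H z / poly G z / z ^ Suc k"
definition poles where "poles = {z. poly G z = 0} \<union> {0}"
definition err :: "real \<Rightarrow> real" where "err t = 512 * real n * (8 * K\<^sup>2 * t) ^ k"

lemma K_ge: "K \<ge> 1"
  unfolding K_def by (intro mult_ge1_I one_le_power) auto

lemma low_pos: "t > 0 \<Longrightarrow> low t > 0" and high_pos: "t > 0 \<Longrightarrow> high t > 0"
  using K_ge by (simp_all add: low_def high_def)

lemma high_mono: "0 \<le> s \<Longrightarrow> s \<le> t \<Longrightarrow> high s \<le> high t"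
  unfolding high_def using K_ge by (intro power_mono mult_left_mono) auto

lemma low_mono: "0 \<le> s \<Longrightarrow> s \<le> t \<Longrightarrow> low s \<le> low t"
  unfolding low_def using high_mono by (intro mult_left_mono) auto

lemma G_nonzero: "G \<noteq> 0"
  using G0 by auto

lemma finite_poles: "finite poles"
  using poly_roots_finite[OF G_nonzero] by (auto simp: poles_def)

lemma holo: "\<phi> holomorphic_on (UNIV - poles)"
  unfolding \<phi>_def poles_def by (intro holomorphic_intros) auto

lemma card_poles: "card (poles \<inter> S) \<le> n" if "0 \<notin> S"
proof -
  have "card (poles \<inter> S) \<le> card {z. poly G z = 0}"
    using that poly_roots_finite[OF G_nonzero] by (intro card_mono) (auto simp: poles_def)
  also have "\<dots> \<le> degree G" using G_nonzero by (intro card_poly_roots_bound) auto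
  also have "\<dots> \<le> n" using deg by (simp add: n_def)
  finally show ?thesis .
qed

text \<open>Where |G| is at least \<open>low t\<close>, the defect of G^(j+1) = H^j is at most
  \<open>low t ^ (j + 1)\<close> and hence at most |G|^(j+1). So |H|^j is at most 2
  |G|^(j+1).\<close>

lemma quotient_le:
  assumes "0 < t" "t \<le> 1 / 4" "norm z \<le> 2 * t" "low t \<le> norm (poly G z)"
  shows "norm (poly H z / poly G z) ^ j \<le> 2 * norm (poly G z)"
proof -
  let ?g = "norm (poly G z)" and ?h = "norm (poly H z)"
  have gpos: "?g > 0" using low_pos[OF assms(1)] assms(4) by linarith
  have "norm (poly G z ^ (j + 1) - poly H z ^ j) \<le> (2 ^ (j + 3) * norm z) ^ n"
    unfolding n_def using assms by (intro E) auto
  also have "\<dots> \<le> (2 ^ (j + 3) * (2 * t)) ^ n" using assms by (intro power_mono mult_left_mono) auto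
  also have "\<dots> = low t ^ (j + 1)"
  proof -
    have e: "2 * j * k * (j + 1) = n" by (simp add: n_def algebra_simps)
    have "low t ^ (j + 1) = ((1 / 256) ^ (j + 1)) ^ n * (K * t) ^ n"
      unfolding low_def high_def power_mult_distrib e[symmetric] by (simp only: power_mult[symmetric] mult_ac)
    also have "\<dots> = ((1 / 256) ^ (j + 1) * (K * t)) ^ n" by (simp only: power_mult_distrib)
    also have "(1 / 256) ^ (j + 1) * (K * t) = 2 ^ (j + 3) * (2 * t)"
      by (simp add: K_def power_divide field_simps power_add)
    finally show ?thesis by simp
  qed
  also have "\<dots> \<le> ?g ^ (j + 1)" using assms(4) low_pos[OF assms(1)] by (intro power_mono) auto
  finally have "norm (poly H z ^ j) \<le> ?g ^ (j + 1) + ?g ^ (j + 1)"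
    using norm_triangle_ineq2[of "poly H z ^ j" "poly G z ^ (j + 1)"]
    by (simp add: norm_minus_commute norm_power norm_mult)
  then have "?h ^ j \<le> 2 * ?g * ?g ^ j" by (simp add: norm_power)
  then show ?thesis using gpos by (simp add: norm_divide power_divide divide_le_eq)
qed

text \<open>Two scales are kept apart because the last case of \<open>residue_bound\<close> uses a
  frame of scale u/4 while the smallness of \<open>G\<close> is known at scale u.\<close>

lemma quotient_le_high:
  assumes "0 < t" "t \<le> 1 / 4" "norm z \<le> 2 * t" "low t \<le> norm (poly G z)"
    and "norm (poly G z) \<le> high s" "0 < s"
  shows "norm (poly H z / poly G z) \<le> 2 * (K * s) ^ (2 * k)"
proof -
  have "norm (poly H z / poly G z) ^ j \<le> 2 * high s"
    using quotient_le[OF assms(1-4)] assms(5) by linarith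
  also have "\<dots> \<le> 2 ^ j * high s"
    using j high_pos[OF assms(6)] by (intro mult_right_mono) (auto intro: self_le_power)
  also have "\<dots> = (2 * (K * s) ^ (2 * k)) ^ j"
    unfolding high_def by (simp only: power_mult_distrib power_mult[symmetric] mult_ac)
  finally show ?thesis
    using K_ge assms(6) j by (subst (asm) power_mono_iff) auto
qed

text \<open>Each side may move within an interval of length t/2, so it can be placed on a good line;
  the boundary then avoids all zeros of \<open>G\<close>.\<close>

definition frame where
  "frame t a b \<longleftrightarrow> Re a \<in> {-t..-t/2} \<and> Im a \<in> {-t..-t/2} \<and> Re b \<in> {t/2..t} \<and> Im b \<in> {t/2..t} \<and>
     (\<forall>z\<in>path_image (rectpath a b). low t \<le> norm (poly G z))"

text \<open>Supplies the reference point that \<open>poly_good_line\<close> needs at scale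
  t.\<close>

definition big where "big t \<longleftrightarrow> (\<exists>w0. norm w0 \<le> 2 * t \<and> high t \<le> norm (poly G w0))"

lemma frame_norm: assumes "frame t a b" "z \<in> cbox a b" shows "norm z \<le> 2 * t"
  using assms cmod_le[of z] by (auto simp: frame_def in_cbox_complex_iff)

lemma frame_norm_ge: assumes "frame t a b" "z \<in> path_image (rectpath a b)" "t > 0" shows "norm z \<ge> t / 2"
proof -
  from assms have "\<bar>Re z\<bar> \<ge> t / 2 \<or> \<bar>Im z\<bar> \<ge> t / 2"
    using path_image_rectpath_cases[OF assms(2)] by (auto simp: frame_def)
  then show ?thesis using abs_Re_le_cmod[of z] abs_Im_le_cmod[of z] by linarith
qed

lemma good_line:
  fixes p :: "complex \<Rightarrow> real"
  assumes p: "\<And>z w. \<bar>p z - p w\<bar> \<le> norm (z - w)"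
    and t: "t > 0" and w0: "norm w0 \<le> 2 * t" "high t \<le> norm (poly G w0)"
    and uv: "v - u \<ge> t / 8" "v - u \<le> 4 * t"
  shows "\<exists>\<xi>\<in>{u..v}. \<forall>z. p z = \<xi> \<and> norm z \<le> 2 * t \<longrightarrow> low t \<le> norm (poly G z)"
proof -
  obtain \<xi> where \<xi>: "\<xi> \<in> {u..v}" "\<And>z. p z = \<xi> \<Longrightarrow> norm (z - w0) \<le> 4 * t \<Longrightarrow>
      ((v - u) / (8 * (4 * t))) ^ n * norm (poly G w0) \<le> norm (poly G z)"
    using poly_good_line[OF p, of u v "4 * t" G n w0] uv t deg by (force simp: n_def)
  have "low t \<le> norm (poly G z)" if z: "p z = \<xi>" "norm z \<le> 2 * t" for z
  proof -
    have "norm (z - w0) \<le> 4 * t" using z(2) w0(1) norm_triangle_ineq4[of z w0] by linarith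
    from \<xi>(2)[OF z(1) this] have *: "((v - u) / (8 * (4 * t))) ^ n * norm (poly G w0) \<le> norm (poly G z)" .
    have "low t \<le> ((v - u) / (8 * (4 * t))) ^ n * norm (poly G w0)"
      unfolding low_def using uv t w0(2) high_pos[OF t]
      by (intro mult_mono power_mono) (auto simp: field_simps)
    with * show ?thesis by linarith
  qed
  with \<xi>(1) show ?thesis by blast
qed

lemma Re_1: "\<bar>Re z - Re w\<bar> \<le> norm (z - w)" and Im_1: "\<bar>Im z - Im w\<bar> \<le> norm (z - w)"
  using abs_Re_le_cmod[of "z - w"] abs_Im_le_cmod[of "z - w"] by simp_all

lemma frame_exists:
  assumes t: "t > 0" and big: "big t"
  shows "\<exists>a b. frame t a b"
proof -
  from big obtain w0 where w0: "norm w0 \<le> 2 * t" "high t \<le> norm (poly G w0)" by (auto simp: big_def)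
  note gl = good_line[OF _ t w0]
  obtain x1 where x1: "x1 \<in> {-t..-t/2}" "\<And>z. Re z = x1 \<Longrightarrow> norm z \<le> 2 * t \<Longrightarrow> low t \<le> norm (poly G z)"
    using gl[of Re "-t/2" "-t"] Re_1 t by auto
  obtain x2 where x2: "x2 \<in> {t/2..t}" "\<And>z. Re z = x2 \<Longrightarrow> norm z \<le> 2 * t \<Longrightarrow> low t \<le> norm (poly G z)"
    using gl[of Re "t" "t/2"] Re_1 t by auto
  obtain y1 where y1: "y1 \<in> {-t..-t/2}" "\<And>z. Im z = y1 \<Longrightarrow> norm z \<le> 2 * t \<Longrightarrow> low t \<le> norm (poly G z)"
    using gl[of Im "-t/2" "-t"] Im_1 t by auto
  obtain y2 where y2: "y2 \<in> {t/2..t}" "\<And>z. Im z = y2 \<Longrightarrow> norm z \<le> 2 * t \<Longrightarrow> low t \<le> norm (poly G z)"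
    using gl[of Im "t" "t/2"] Im_1 t by auto
  have "frame t (Complex x1 y1) (Complex x2 y2)"
    unfolding frame_def
  proof (intro conjI ballI)
    fix z assume "z \<in> path_image (rectpath (Complex x1 y1) (Complex x2 y2))"
    from path_image_rectpath_cases[OF this] x1(1) x2(1) y1(1) y2(1) t
    have z: "z \<in> cbox (Complex x1 y1) (Complex x2 y2)" "Re z = x1 \<or> Re z = x2 \<or> Im z = y1 \<or> Im z = y2"
      by auto
    have "norm z \<le> 2 * t"
      using z(1) x1(1) x2(1) y1(1) y2(1) cmod_le[of z] by (auto simp: in_cbox_complex_iff)
    then show "low t \<le> norm (poly G z)" using z(2) x1(2) x2(2) y1(2) y2(2) by blast
  qed (use x1(1) x2(1) y1(1) y2(1) in auto)
  then show ?thesis by blast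
qed

end

section \<open>Residue sums over nested frames\<close>

context jet_pair
begin

definition res_sum where "res_sum S = 2 * pi * \<i> * (\<Sum>p\<in>poles \<inter> S. residue \<phi> p)"

lemma res_sum_Un:
  assumes "poles \<inter> S \<inter> T = {}"
  shows "res_sum (S \<union> T) = res_sum S + res_sum T"
proof -
  have "(\<Sum>p\<in>poles \<inter> (S \<union> T). residue \<phi> p) =
      (\<Sum>p\<in>poles \<inter> S. residue \<phi> p) + (\<Sum>p\<in>poles \<inter> T. residue \<phi> p)"
    unfolding Int_Un_distrib using finite_poles assms by (intro sum.union_disjoint) auto
  then show ?thesis by (simp add: res_sum_def distrib_left)
qed

text \<open>The origin is outside, so the poles are zeros of \<open>G\<close>, at most n of them,
  and the perimeter is at most 8 t. Between \<open>low t\<close> and \<open>high t\<close> the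
  integrand is bounded by 2 (K t)^(2 k) times (8/t)^(k+1).\<close>

lemma res_sum_rect:
  assumes t: "0 < t" "t \<le> 1 / 4"
    and le: "Re a \<le> Re b" "Im a \<le> Im b"
    and sub: "\<And>z. z \<in> cbox a b \<Longrightarrow> t / 8 \<le> norm z \<and> norm z \<le> 2 * t"
    and per: "Re b - Re a \<le> 2 * t" "Im b - Im a \<le> 2 * t"
    and bdry: "\<And>z. z \<in> path_image (rectpath a b) \<Longrightarrow> low t \<le> norm (poly G z)"
  shows "norm (res_sum (cbox a b)) \<le> err t / 4"
proof -
  define B where "B = 2 * (K * t) ^ (2 * k) * (8 / t) ^ Suc k"
  have B: "B \<ge> 0" using K_ge t by (simp add: B_def)
  have 0: "0 \<notin> cbox a b" using sub[of 0] t by auto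
  have "norm (res_sum (cbox a b)) \<le> card (poles \<inter> cbox a b) * (B * (8 * t))"
    unfolding res_sum_def
  proof (rule rect_residues_bound[where r = "low t" and ?r1.0 = "high t" and n = n and G = G])
    show "poly G p = 0" if "p \<in> poles \<inter> cbox a b" for p using that 0 by (auto simp: poles_def)
    show "norm (\<phi> z) \<le> B" if z: "z \<in> cbox a b" "low t \<le> norm (poly G z)" "norm (poly G z) \<le> high t" for z
    proof -
      have zn: "t / 8 \<le> norm z" "norm z \<le> 2 * t" using sub[OF z(1)] by auto
      have "norm (\<phi> z) = norm (poly H z / poly G z) * (1 / norm z) ^ Suc k"
        by (simp add: \<phi>_def norm_divide norm_power power_divide norm_mult)
      also have "\<dots> \<le> 2 * (K * t) ^ (2 * k) * (8 / t) ^ Suc k"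
      proof (intro mult_mono power_mono)
        have "1 / norm z \<le> 1 / (t / 8)" using zn t by (intro frac_le) auto
        then show "1 / norm z \<le> 8 / t" by simp
      qed (use quotient_le_high[OF t zn(2) z(2,3) t(1)] t K_ge in auto)
      finally show ?thesis by (simp add: B_def)
    qed
    show "low t \<le> (1 / 32) ^ n * high t"
      unfolding low_def using high_pos[OF t(1)] by (intro mult_right_mono power_mono) auto
    show "degree G \<le> n" using deg by (simp add: n_def)
  qed (use finite_poles holo low_pos t B le bdry per in auto)
  also have "\<dots> \<le> n * (B * (8 * t))"
    using card_poles[OF 0] B t by (intro mult_right_mono) auto
  also have "\<dots> = err t / 4"
  proof -
    have "(K * t) ^ (2 * k) * (8 / t) ^ k = ((K * t)\<^sup>2 * (8 / t)) ^ k"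
      by (simp only: power_mult power_mult_distrib)
    also have "(K * t)\<^sup>2 * (8 / t) = 8 * K\<^sup>2 * t"
      using t by (simp add: power2_eq_square)
    finally have "B * (8 * t) = 128 * (8 * K\<^sup>2 * t) ^ k"
      using t by (simp add: B_def)
    then show ?thesis by (simp add: err_def)
  qed
  finally show ?thesis .
qed

text \<open>The region between the two frames is covered by a left and a right rectangle of full
  height and by a lower and an upper one between them. Those that touch each other or the inner
  frame do so only along good lines. These avoid the zeros of \<open>G\<close> as well as the
  origin, so no pole is counted twice.\<close>

lemma annulus:
  assumes t: "0 < t" "t \<le> 1 / 4" and fr: "frame t a b" and big: "big t"
  shows "\<exists>a' b'. frame (t / 4) a' b' \<and> norm (res_sum (cbox a b) - res_sum (cbox a' b')) \<le> err t"
proof -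
  from big obtain w0 where w0: "norm w0 \<le> 2 * t" "high t \<le> norm (poly G w0)" by (auto simp: big_def)
  note gl = good_line[OF _ t(1) w0]
  obtain x1 where x1: "x1 \<in> {-t/4..-t/8}" "\<And>z. Re z = x1 \<Longrightarrow> norm z \<le> 2 * t \<Longrightarrow> low t \<le> norm (poly G z)"
    using gl[of Re "-t/8" "-t/4"] Re_1 t by auto
  obtain x2 where x2: "x2 \<in> {t/8..t/4}" "\<And>z. Re z = x2 \<Longrightarrow> norm z \<le> 2 * t \<Longrightarrow> low t \<le> norm (poly G z)"
    using gl[of Re "t/4" "t/8"] Re_1 t by auto
  obtain y1 where y1: "y1 \<in> {-t/4..-t/8}" "\<And>z. Im z = y1 \<Longrightarrow> norm z \<le> 2 * t \<Longrightarrow> low t \<le> norm (poly G z)"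
    using gl[of Im "-t/8" "-t/4"] Im_1 t by auto
  obtain y2 where y2: "y2 \<in> {t/8..t/4}" "\<And>z. Im z = y2 \<Longrightarrow> norm z \<le> 2 * t \<Longrightarrow> low t \<le> norm (poly G z)"
    using gl[of Im "t/4" "t/8"] Im_1 t by auto
  define a' b' where "a' = Complex x1 y1" and "b' = Complex x2 y2"
  have ab: "-t \<le> Re a" "Re a \<le> -t/2" "-t \<le> Im a" "Im a \<le> -t/2"
      "t/2 \<le> Re b" "Re b \<le> t" "t/2 \<le> Im b" "Im b \<le> t"
    using fr by (auto simp: frame_def)
  have xy: "-t/4 \<le> x1" "x1 \<le> -t/8" "-t/4 \<le> y1" "y1 \<le> -t/8" "t/8 \<le> x2" "x2 \<le> t/4" "t/8 \<le> y2" "y2 \<le> t/4"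
    using x1(1) x2(1) y1(1) y2(1) by auto
  have lines: "low t \<le> norm (poly G z)"
    if "z \<in> cbox a b" "Re z = x1 \<or> Re z = x2 \<or> Im z = y1 \<or> Im z = y2" for z
    using that frame_norm[OF fr, of z] x1(2) x2(2) y1(2) y2(2) by blast
  have border: "low t \<le> norm (poly G z)"
    if "z \<in> cbox a b" "Re z = Re a \<or> Re z = Re b \<or> Im z = Im a \<or> Im z = Im b" for z
    using that fr ab t by (auto simp: frame_def path_image_rectpath in_cbox_complex_iff)
  have fr': "frame (t / 4) a' b'"
    unfolding frame_def
  proof (intro conjI ballI)
    fix z assume "z \<in> path_image (rectpath a' b')"
    from path_image_rectpath_cases[OF this] xy t
    have z: "z \<in> cbox a' b'" "Re z = x1 \<or> Re z = x2 \<or> Im z = y1 \<or> Im z = y2"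
      by (auto simp: a'_def b'_def)
    have "z \<in> cbox a b" using z(1) ab xy t by (auto simp: in_cbox_complex_iff a'_def b'_def)
    then have "low t \<le> norm (poly G z)" using lines z(2) by blast
    moreover have "low (t / 4) \<le> low t" using t by (intro low_mono) auto
    ultimately show "low (t / 4) \<le> norm (poly G z)" by linarith
  qed (use xy in \<open>auto simp: a'_def b'_def\<close>)
  have np: "0 \<in> cbox a' b'" using xy t by (auto simp: in_cbox_complex_iff a'_def b'_def)
  define R1 where "R1 = cbox a (Complex x1 (Im b))"
  define R2 where "R2 = cbox (Complex x2 (Im a)) b"
  define R3 where "R3 = cbox (Complex x1 (Im a)) (Complex x2 y1)"
  define R4 where "R4 = cbox (Complex x1 y2) (Complex x2 (Im b))"
  note R = R1_def R2_def R3_def R4_def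
  have pole_not: "Re p \<noteq> x1 \<and> Re p \<noteq> x2 \<and> Im p \<noteq> y1 \<and> Im p \<noteq> y2" if "p \<in> poles" "p \<in> cbox a b" for p
  proof (cases "p = 0")
    case True
    then show ?thesis using xy t by auto
  next
    case False
    then have "poly G p = 0" using that by (auto simp: poles_def)
    then show ?thesis using lines[OF that(2)] low_pos[OF t(1)] by fastforce
  qed
  have nz: "t / 8 \<le> norm z \<and> norm z \<le> 2 * t" if "z \<in> cbox a b" "\<bar>Re z\<bar> \<ge> t / 8 \<or> \<bar>Im z\<bar> \<ge> t / 8" for z
    using that frame_norm[OF fr, of z] abs_Re_le_cmod[of z] abs_Im_le_cmod[of z] by linarith
  have rect: "norm (res_sum (cbox p q)) \<le> err t / 4"
    if pq: "p \<in> cbox a b" "q \<in> cbox a b" "Re p \<le> Re q" "Im p \<le> Im q"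
      "\<And>z. z \<in> cbox p q \<Longrightarrow> \<bar>Re z\<bar> \<ge> t / 8 \<or> \<bar>Im z\<bar> \<ge> t / 8"
      "Re p \<in> {Re a, Re b, x1, x2}" "Im p \<in> {Im a, Im b, y1, y2}"
      "Re q \<in> {Re a, Re b, x1, x2}" "Im q \<in> {Im a, Im b, y1, y2}" for p q
  proof (rule res_sum_rect[OF t pq(3,4)])
    fix z assume z: "z \<in> cbox p q"
    then have "z \<in> cbox a b" using pq by (auto simp: in_cbox_complex_iff)
    then show "t / 8 \<le> norm z \<and> norm z \<le> 2 * t" using nz pq(5)[OF z] by blast
  next
    fix z assume "z \<in> path_image (rectpath p q)"
    from path_image_rectpath_cases[OF this pq(3,4)]
    have z: "z \<in> cbox p q" "Re z = Re p \<or> Re z = Re q \<or> Im z = Im p \<or> Im z = Im q" by auto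
    then have "z \<in> cbox a b" using pq by (auto simp: in_cbox_complex_iff)
    moreover have "Re z \<in> {Re a, Re b, x1, x2} \<or> Im z \<in> {Im a, Im b, y1, y2}"
      using z(2) pq(6-9) by metis
    ultimately show "low t \<le> norm (poly G z)" using lines border by blast
  qed (use pq ab in \<open>auto simp: in_cbox_complex_iff\<close>)
  have r: "norm (res_sum R1) \<le> err t / 4" "norm (res_sum R2) \<le> err t / 4"
     "norm (res_sum R3) \<le> err t / 4" "norm (res_sum R4) \<le> err t / 4"
    unfolding R by (rule rect; use ab xy t in \<open>(simp add: in_cbox_complex_iff abs_if; linarith)?\<close>)+
  have Un: "cbox a b = cbox a' b' \<union> R1 \<union> R2 \<union> R3 \<union> R4"
    unfolding R a'_def b'_def using ab xy t by (auto simp: in_cbox_complex_iff)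
  have disj: "\<not> (p \<in> cbox a' b' \<and> p \<in> R1)" "\<not> (p \<in> cbox a' b' \<and> p \<in> R2)"
    "\<not> (p \<in> cbox a' b' \<and> p \<in> R3)" "\<not> (p \<in> cbox a' b' \<and> p \<in> R4)"
    "\<not> (p \<in> R1 \<and> p \<in> R2)" "\<not> (p \<in> R1 \<and> p \<in> R3)" "\<not> (p \<in> R1 \<and> p \<in> R4)"
    "\<not> (p \<in> R2 \<and> p \<in> R3)" "\<not> (p \<in> R2 \<and> p \<in> R4)" "\<not> (p \<in> R3 \<and> p \<in> R4)"
    if p: "p \<in> poles" for p
  proof -
    have Rp: "p \<in> R1 \<Longrightarrow> p \<in> cbox a b \<and> Re p \<le> x1" "p \<in> R2 \<Longrightarrow> p \<in> cbox a b \<and> x2 \<le> Re p"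
      "p \<in> R3 \<Longrightarrow> p \<in> cbox a b \<and> x1 \<le> Re p \<and> Re p \<le> x2 \<and> Im p \<le> y1"
      "p \<in> R4 \<Longrightarrow> p \<in> cbox a b \<and> x1 \<le> Re p \<and> Re p \<le> x2 \<and> y2 \<le> Im p"
      "p \<in> cbox a' b' \<Longrightarrow> p \<in> cbox a b \<and> x1 \<le> Re p \<and> Re p \<le> x2 \<and> y1 \<le> Im p \<and> Im p \<le> y2"
      unfolding Un by (auto simp: R in_cbox_complex_iff a'_def b'_def)
    have x: "x1 < x2" "y1 < y2" using xy t by linarith+
    note pn = pole_not[OF p]
    show "\<not> (p \<in> cbox a' b' \<and> p \<in> R1)" using Rp(5,1) pn by force
    show "\<not> (p \<in> cbox a' b' \<and> p \<in> R2)" using Rp(5,2) pn by force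
    show "\<not> (p \<in> cbox a' b' \<and> p \<in> R3)" using Rp(5,3) pn by force
    show "\<not> (p \<in> cbox a' b' \<and> p \<in> R4)" using Rp(5,4) pn by force
    show "\<not> (p \<in> R1 \<and> p \<in> R2)" using Rp(1,2) x by force
    show "\<not> (p \<in> R1 \<and> p \<in> R3)" using Rp(1,3) pn by force
    show "\<not> (p \<in> R1 \<and> p \<in> R4)" using Rp(1,4) pn by force
    show "\<not> (p \<in> R2 \<and> p \<in> R3)" using Rp(2,3) pn by force
    show "\<not> (p \<in> R2 \<and> p \<in> R4)" using Rp(2,4) pn by force
    show "\<not> (p \<in> R3 \<and> p \<in> R4)" using Rp(3,4) x by force
  qed
  have "res_sum (cbox a b) = res_sum (cbox a' b' \<union> R1 \<union> R2 \<union> R3) + res_sum R4"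
    unfolding Un by (rule res_sum_Un) (use disj in blast)
  also have "res_sum (cbox a' b' \<union> R1 \<union> R2 \<union> R3) = res_sum (cbox a' b' \<union> R1 \<union> R2) + res_sum R3"
    by (rule res_sum_Un) (use disj in blast)
  also have "res_sum (cbox a' b' \<union> R1 \<union> R2) = res_sum (cbox a' b' \<union> R1) + res_sum R2"
    by (rule res_sum_Un) (use disj in blast)
  also have "res_sum (cbox a' b' \<union> R1) = res_sum (cbox a' b') + res_sum R1"
    by (rule res_sum_Un) (use disj in blast)
  finally have e: "res_sum (cbox a b) = res_sum (cbox a' b') + res_sum R1 + res_sum R2 + res_sum R3 + res_sum R4" .
  have "norm (res_sum (cbox a b) - res_sum (cbox a' b')) = norm (res_sum R1 + res_sum R2 + res_sum R3 + res_sum R4)"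
    by (simp add: e add.assoc)
  also have "\<dots> \<le> err t / 4 + err t / 4 + err t / 4 + err t / 4"
    using r by (intro norm_triangle_mono) auto
  finally show ?thesis using fr' by auto
qed

lemma err_nonneg: "t > 0 \<Longrightarrow> err t \<ge> 0"
  by (simp add: err_def)

lemma err_quarter:
  assumes "t > 0" shows "err (t / 4) \<le> err t / 4"
proof -
  define X where "X = (8 * K\<^sup>2 * t) ^ k"
  have "(8 * K\<^sup>2 * (t / 4)) ^ k = X / 4 ^ k"
    unfolding X_def power_divide[symmetric] by simp
  also have "\<dots> \<le> X / 4"
    using k assms K_ge by (intro divide_left_mono) (auto simp: X_def intro: self_le_power)
  finally have "512 * real n * (8 * K\<^sup>2 * (t / 4)) ^ k \<le> 512 * real n * (X / 4)"
    by (intro mult_left_mono) auto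
  then show ?thesis by (simp add: err_def X_def)
qed

text \<open>The frames of scales t / 4^i are compared successively. By \<open>err_quarter\<close>
  the errors shrink by a factor 4, so that err + 2 (err / 4) \<le> 2 err closes the induction. The
  descent stops at depth \<open>J\<close>, where the frame lies in a disc without zeros of
  \<open>G\<close> and only the residue at 0 remains.\<close>

lemma res_sum_frame:
  assumes t: "0 < t" "t \<le> 1 / 4" and fr: "frame t a b" and big: "\<And>i. big (t / 4 ^ i)"
  shows "norm (res_sum (cbox a b) - 2 * pi * \<i> * residue \<phi> 0) \<le> 2 * err t"
proof -
  have "isCont (poly G) 0" by (intro continuous_intros)
  then obtain e where e: "e > 0" "\<And>z. norm z < e \<Longrightarrow> poly G z \<noteq> 0"
    using continuous_at_avoid[of 0 "poly G" 0] G0 by (auto simp: dist_norm)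
  obtain J where "2 * t / e < 4 ^ J" using real_arch_pow[of 4 "2 * t / e"] by auto
  then have J: "2 * (t / 4 ^ J) < e" using e(1) by (simp add: field_simps)
  have "norm (res_sum (cbox a b) - 2 * pi * \<i> * residue \<phi> 0) \<le> 2 * err (t / 4 ^ i)"
    if "frame (t / 4 ^ i) a b" "i + m = J" for a b i m
    using that
  proof (induction m arbitrary: i a b)
    case 0
    have "poles \<inter> cbox a b = {0}"
    proof (intro equalityI subsetI)
      fix p assume p: "p \<in> poles \<inter> cbox a b"
      then have "norm p < e" using frame_norm[OF 0(1), of p] J 0(2) by simp
      then show "p \<in> {0}" using e(2)[of p] p by (auto simp: poles_def)
    next
      fix p :: complex assume "p \<in> {0}"
      moreover have "- (t / 4 ^ i) / 2 \<le> 0" "0 \<le> t / 4 ^ i / 2" using t by simp_all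
      ultimately show "p \<in> poles \<inter> cbox a b"
        using 0(1) by (auto simp: poles_def frame_def in_cbox_complex_iff)
    qed
    then show ?case using err_nonneg t by (simp add: res_sum_def)
  next
    case (Suc m)
    have "t / 4 ^ i \<le> t" using t frac_le[of t t 1 "4 ^ i"] by auto
    then have ti: "0 < t / 4 ^ i" "t / 4 ^ i \<le> 1 / 4" using t by (simp, linarith)
    from annulus[OF ti Suc.prems(1) big] obtain a' b' where
      ab': "frame (t / 4 ^ Suc i) a' b'" "norm (res_sum (cbox a b) - res_sum (cbox a' b')) \<le> err (t / 4 ^ i)"
      by (auto simp: mult.commute)
    have "norm (res_sum (cbox a b) - 2 * pi * \<i> * residue \<phi> 0) \<le>
       norm (res_sum (cbox a b) - res_sum (cbox a' b')) + norm (res_sum (cbox a' b') - 2 * pi * \<i> * residue \<phi> 0)"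
      using norm_triangle_ineq[of "res_sum (cbox a b) - res_sum (cbox a' b')"
          "res_sum (cbox a' b') - 2 * pi * \<i> * residue \<phi> 0"] by simp
    also have "\<dots> \<le> err (t / 4 ^ i) + 2 * err (t / 4 ^ i / 4)"
      using ab' Suc.IH[of "Suc i" a' b'] Suc.prems(2) by (simp add: mult.commute)
    also have "\<dots> \<le> 2 * err (t / 4 ^ i)" using err_quarter[OF ti(1)] err_nonneg[OF ti(1)] by simp
    finally show ?case .
  qed
  from this[of 0 a b J] fr show ?thesis by simp
qed

lemma frame_integral:
  assumes t: "0 < t" "t \<le> 1 / 4" and fr: "frame t a b" and B: "0 \<le> B"
    and q: "\<And>z. z \<in> path_image (rectpath a b) \<Longrightarrow> norm (poly H z / poly G z) \<le> B"
  shows "norm (res_sum (cbox a b)) \<le> 16 * B * (2 / t) ^ k"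
proof -
  have le: "Re a \<le> Re b" "Im a \<le> Im b" using fr t by (auto simp: frame_def)
  have disj: "poles \<inter> path_image (rectpath a b) = {}"
  proof (safe, goal_cases)
    case (1 p)
    then have "norm p \<ge> t / 2" "low t \<le> norm (poly G p)" using fr frame_norm_ge[OF fr _ t(1)] by (auto simp: frame_def)
    then show ?case using 1 low_pos[OF t(1)] t by (auto simp: poles_def)
  qed
  have "res_sum (cbox a b) = contour_integral (rectpath a b) \<phi>"
    unfolding res_sum_def using residue_theorem_rectpath[OF finite_poles holo le disj] by simp
  also have "norm \<dots> \<le> B * (2 / t) ^ Suc k * (2 * (Re b - Re a) + 2 * (Im b - Im a))"
  proof (rule contour_integral_rectpath_bound)
    show "continuous_on (path_image (rectpath a b)) \<phi>"
      using holo disj by (intro holomorphic_on_imp_continuous_on) (auto elim: holomorphic_on_subset)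
    fix z assume z: "z \<in> path_image (rectpath a b)"
    have "norm (\<phi> z) = norm (poly H z / poly G z) * (1 / norm z) ^ Suc k"
      by (simp add: \<phi>_def norm_divide norm_power power_divide norm_mult)
    also have "\<dots> \<le> B * (2 / t) ^ Suc k"
    proof (intro mult_mono power_mono)
      have zn: "norm z \<ge> t / 2" using frame_norm_ge[OF fr z t(1)] .
      then have "1 / norm z \<le> 1 / (t / 2)" using zn t by (intro frac_le) auto
      then show "1 / norm z \<le> 2 / t" by simp
    qed (use q[OF z] B t in auto)
    finally show "norm (\<phi> z) \<le> B * (2 / t) ^ Suc k" .
  qed (use B t le in auto)
  also have "\<dots> \<le> B * (2 / t) ^ Suc k * (8 * t)"
    using fr B t by (intro mult_left_mono) (auto simp: frame_def)
  also have "\<dots> = 16 * B * (2 / t) ^ k" using t by simp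
  finally show ?thesis .
qed

text \<open>A frame is needed on which the integral can be bounded directly and below which every
  scale is \<open>big\<close>. If all scales t / 4^i are \<open>big\<close>, the frame of scale t
  serves, with \<open>G2\<close> bounding G. Otherwise let u be the smallest scale that is not
  \<open>big\<close>: then |G| \<le> \<open>high u\<close> on the disc of radius 2 u, and a frame of
  scale u/4 serves.\<close>

lemma residue_bound: "norm (residue \<phi> 0) \<le> (1024 * j * (j + 1) * 2 + 64) * (128 * K\<^sup>2) ^ k"
proof -
  \<comment> \<open>Makes 8 K^2 t = 1/8, whose k-th power absorbs the factor k contained in
    n.\<close>
  define t where "t = 1 / (64 * K\<^sup>2)"
  have K2: "K\<^sup>2 \<ge> 1" "K \<noteq> 0" using K_ge by auto
  have t: "0 < t" "t \<le> 1 / 64" using K2 K_ge by (auto simp: t_def divide_le_eq)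
  have ti: "0 < t / 4 ^ i" "t / 4 ^ i \<le> t" "t / 4 ^ i \<le> 1 / 4" for i
  proof -
    show 1: "0 < t / 4 ^ i" using t by simp
    show "t / 4 ^ i \<le> t" using t by (simp add: divide_le_eq)
    then show "t / 4 ^ i \<le> 1 / 4" using t by linarith
  qed
  have K2t: "8 * K\<^sup>2 * t = 1 / 8" using K2 by (simp add: t_def)
  have err: "2 * err (t / 4 ^ i) \<le> 1024 * (2 * j * (j + 1))" for i
  proof -
    have "(8 * K\<^sup>2 * (t / 4 ^ i)) ^ k \<le> (1 / 8) ^ k"
      unfolding K2t[symmetric] using ti[of i] by (intro power_mono mult_left_mono) auto
    moreover have "real k * (1 / 8) ^ k \<le> 1"
    proof -
      have "real k \<le> 2 ^ k" by (rule less_imp_le[OF of_nat_less_two_power])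
      also have "\<dots> \<le> 8 ^ k" by (intro power_mono) auto
      finally have "real k \<le> 8 ^ k" .
      then show ?thesis by (simp add: power_divide divide_le_eq)
    qed
    ultimately have "real k * (8 * K\<^sup>2 * (t / 4 ^ i)) ^ k \<le> 1"
      by (meson mult_left_mono of_nat_0_le_iff order_trans)
    then have "1024 * (2 * real j * (real j + 1)) * (real k * (8 * K\<^sup>2 * (t / 4 ^ i)) ^ k) \<le> 1024 * (2 * real j * (real j + 1)) * 1"
      by (intro mult_left_mono) auto
    then show ?thesis by (simp add: err_def n_def algebra_simps)
  qed
  have c: "2 / t = 128 * K\<^sup>2" by (simp add: t_def)
  have c1: "(128 * K\<^sup>2) ^ k \<ge> 1" using K2 by (intro one_le_power) auto
  have key: "norm (res_sum (cbox a b)) \<le> 64 * (128 * K\<^sup>2) ^ k \<Longrightarrow> ?thesis"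
    if fr: "frame (t / 4 ^ i) a b" and bg: "\<And>i'. i' \<ge> i \<Longrightarrow> big (t / 4 ^ i')" for a b i
  proof -
    assume I: "norm (res_sum (cbox a b)) \<le> 64 * (128 * K\<^sup>2) ^ k"
    have "big (t / 4 ^ i / 4 ^ m)" for m using bg[of "i + m"] by (simp add: power_add)
    then have "norm (res_sum (cbox a b) - 2 * pi * \<i> * residue \<phi> 0) \<le> 2 * err (t / 4 ^ i)"
      using res_sum_frame[OF ti(1,3) fr] by blast
    also have "\<dots> \<le> 1024 * (2 * j * (j + 1))" by (rule err)
    also have "\<dots> \<le> 1024 * (2 * j * (j + 1)) * (128 * K\<^sup>2) ^ k" using mult_left_mono[OF c1] by fastforce
    finally have D: "norm (res_sum (cbox a b) - 2 * pi * \<i> * residue \<phi> 0) \<le> 1024 * (2 * j * (j + 1)) * (128 * K\<^sup>2) ^ k" .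
    have "norm (residue \<phi> 0) \<le> norm (2 * pi * \<i> * residue \<phi> 0)"
      using pi_gt3 by (simp add: norm_mult mult_le_cancel_right1)
    also have "\<dots> \<le> norm (res_sum (cbox a b)) + norm (res_sum (cbox a b) - 2 * pi * \<i> * residue \<phi> 0)"
      using norm_triangle_ineq4[of "res_sum (cbox a b)" "res_sum (cbox a b) - 2 * pi * \<i> * residue \<phi> 0"] by simp
    finally show ?thesis using I D by (simp add: algebra_simps)
  qed
  show ?thesis
  proof (cases "\<forall>i. big (t / 4 ^ i)")
    case True
    obtain a b where fr: "frame t a b" using frame_exists[OF t(1)] True[rule_format, of 0] by auto
    have "norm (res_sum (cbox a b)) \<le> 16 * 4 * (2 / t) ^ k"
    proof (rule frame_integral[OF t(1) _ fr])
      fix z assume z: "z \<in> path_image (rectpath a b)"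
      have zb: "norm z \<le> 2 * t" "low t \<le> norm (poly G z)"
        using z fr frame_norm[OF fr, of z] path_image_rectpath_cases[OF z] t by (auto simp: frame_def)
      have "norm (poly H z / poly G z) ^ j \<le> 2 * norm (poly G z)"
        using t zb by (intro quotient_le[of t]) auto
      also have "\<dots> \<le> 4" using G2[of z] zb t by simp
      also have "\<dots> \<le> 4 ^ j" using j by (intro self_le_power) auto
      finally show "norm (poly H z / poly G z) \<le> 4" using j by (subst (asm) power_mono_iff) auto
    qed (use t in auto)
    then show ?thesis using fr True by (intro key[of 0 a b]) (auto simp: c)
  next
    case False
    \<comment> \<open>As \<open>high\<close> tends to 0 while G(0) is nonzero, the origin itself is
      the reference point at all small scales. Hence a last scale that is not \<open>big\<close>
      exists.\<close>
    have "\<exists>J. \<forall>i\<ge>J. big (t / 4 ^ i)"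
    proof -
      have "(\<lambda>i. high (t * (1/4) ^ i)) \<longlonglongrightarrow> (K * (t * 0)) ^ (2 * j * k)"
        unfolding high_def by (intro tendsto_intros LIMSEQ_realpow_zero) auto
      also have "(K * (t * 0)) ^ (2 * j * k) = 0" using j k by simp
      finally have "eventually (\<lambda>i. high (t * (1/4) ^ i) < norm (poly G 0)) sequentially"
        using G0 by (intro order_tendstoD) auto
      then obtain J where "\<And>i. i \<ge> J \<Longrightarrow> high (t * (1/4) ^ i) < norm (poly G 0)"
        by (auto simp: eventually_sequentially)
      then show ?thesis
        using t(1) by (intro exI[of _ J]) (auto simp: big_def power_divide intro!: exI[of _ 0] less_imp_le)
    qed
    then obtain J where J: "\<And>i. i \<ge> J \<Longrightarrow> big (t / 4 ^ i)" by blast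
    then have "{i. \<not> big (t / 4 ^ i)} \<subseteq> {..<J}" using not_less by blast
    then have fin: "finite {i. \<not> big (t / 4 ^ i)}" by (rule finite_subset) simp
    define i where "i = Max {i. \<not> big (t / 4 ^ i)}"
    have i: "\<not> big (t / 4 ^ i)" using Max_in[OF fin] False by (auto simp: i_def)
    have gt: "big (t / 4 ^ i')" if "i' > i" for i'
      using Max_ge[OF fin, of i'] that unfolding i_def by force
    define u where "u = t / 4 ^ i"
    have u: "t / 4 ^ Suc i = u / 4" "u > 0" "u \<le> 1 / 4" "u \<le> t"
      using ti[of i] by (simp_all add: u_def)
    obtain a b where fr: "frame (t / 4 ^ Suc i) a b" using frame_exists[OF ti(1) gt[of "Suc i"]] by auto
    have "norm (res_sum (cbox a b)) \<le> 16 * (2 * (K * u) ^ (2 * k)) * (2 / (u / 4)) ^ k"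
    proof (rule frame_integral[OF _ _ fr[unfolded u(1)]])
      fix z assume z: "z \<in> path_image (rectpath a b)"
      have zb: "norm z \<le> 2 * (u / 4)" "low (u / 4) \<le> norm (poly G z)"
        using z fr frame_norm[OF fr, of z] path_image_rectpath_cases[OF z] ti[of "Suc i"]
        unfolding u(1) by (auto simp: frame_def)
      have "norm z \<le> 2 * u" using zb(1) u(2) by linarith
      then have "norm (poly G z) \<le> high u"
        using i unfolding big_def u_def[symmetric] by force
      then show "norm (poly H z / poly G z) \<le> 2 * (K * u) ^ (2 * k)"
        using zb u by (intro quotient_le_high[of "u / 4"]) auto
    qed (use u K_ge in auto)
    also have "\<dots> = 32 * (8 * K\<^sup>2 * u) ^ k"
    proof -
      have "(K * u) ^ (2 * k) * (2 / (u / 4)) ^ k = ((K * u)\<^sup>2 * (2 / (u / 4))) ^ k"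
        by (simp only: power_mult power_mult_distrib)
      also have "(K * u)\<^sup>2 * (2 / (u / 4)) = 8 * K\<^sup>2 * u"
        using u(2) by (simp add: power2_eq_square)
      finally show ?thesis by simp
    qed
    also have "\<dots> \<le> 32 * 1"
    proof -
      have "8 * K\<^sup>2 * u \<le> 8 * K\<^sup>2 * t" using u(4) by (intro mult_left_mono) auto
      then show ?thesis using u(2) unfolding K2t by (intro mult_left_mono power_le_one) auto
    qed
    also have "\<dots> \<le> 64 * (128 * K\<^sup>2) ^ k" using c1 by linarith
    finally show ?thesis using gt by (intro key[OF fr]) (auto simp: Suc_le_eq)
  qed
qed

end

section \<open>Roots of formal power series\<close>

lemma fps_mult_eq_upto:
  assumes "\<And>l. l \<le> n \<Longrightarrow> fps_nth A l = fps_nth A' l" "\<And>l. l \<le> n \<Longrightarrow> fps_nth B l = fps_nth B' l" "l \<le> n"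
  shows "fps_nth (A * B) l = fps_nth (A' * B') (l :: nat)"
  using assms by (auto simp: fps_mult_nth intro!: sum.cong)

lemma fps_power_eq_upto:
  fixes A A' :: "'a :: comm_semiring_1 fps"
  assumes "\<And>l. l \<le> n \<Longrightarrow> fps_nth A l = fps_nth A' l" "l \<le> n"
  shows "fps_nth (A ^ m) l = fps_nth (A' ^ m) (l :: nat)"
  using assms(2)
proof (induction m arbitrary: l)
  case (Suc m)
  then show ?case unfolding power_Suc using assms(1) by (intro fps_mult_eq_upto[of n]) auto
qed auto

text \<open>Schwarz's lemma: the maximum principle is applied to p(z) / z^m.\<close>

lemma poly_vanishing_order_bound:
  fixes p :: "complex poly"
  assumes "\<And>l. l < m \<Longrightarrow> coeff p l = 0" and R: "R > 0" "\<And>z. norm z = R \<Longrightarrow> norm (poly p z) \<le> B"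
    and z: "norm z \<le> R"
  shows "norm (poly p z) \<le> B * (norm z / R) ^ m"
proof -
  have "monom 1 m dvd p" using assms(1) by (simp add: monom_1_dvd_iff')
  then obtain q where q: "p = monom 1 m * q" by (elim dvdE)
  have "norm (poly q z) \<le> B / R ^ m"
  proof (rule maximum_modulus_frontier[where S = "cball 0 R" and f = "poly q"])
    fix w :: complex assume "w \<in> frontier (cball 0 R)"
    then have w: "norm w = R" using R by simp
    have "R ^ m * norm (poly q w) \<le> B"
      using R(2)[OF w] by (simp add: q poly_monom norm_mult norm_power w)
    then show "norm (poly q w) \<le> B / R ^ m" using R by (simp add: field_simps)
  qed (use z in \<open>auto intro!: holomorphic_intros continuous_intros\<close>)
  then have "norm z ^ m * norm (poly q z) \<le> norm z ^ m * (B / R ^ m)" by (intro mult_left_mono) auto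
  then show ?thesis by (simp add: q poly_monom norm_mult norm_power power_divide mult_ac)
qed

lemma poly_truncation:
  fixes a :: "nat \<Rightarrow> complex" and n :: nat
  defines "p \<equiv> \<Sum>l\<le>n. monom (a l) l"
  shows "\<And>l. coeff p l = (if l \<le> n then a l else 0)"
    and "degree p \<le> n"
    and "poly p has_fps_expansion fps_of_poly p"
    and "(\<And>l. l \<le> n \<Longrightarrow> norm (a l) \<le> 1) \<Longrightarrow> norm z \<le> 1 / 2 \<Longrightarrow> norm (poly p z) \<le> 2"
proof -
  show c: "coeff p l = (if l \<le> n then a l else 0)" for l
    by (simp add: p_def coeff_sum if_distrib sum.If_cases)
  show "degree p \<le> n" by (rule degree_le) (simp add: c)
  have e: "poly p = (\<lambda>z. \<Sum>l\<le>n. a l * z ^ l)"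
    by (auto simp: p_def poly_sum poly_monom fun_eq_iff)
  have "fps_of_poly p = (\<Sum>l\<le>n. fps_const (a l) * fps_X ^ l)"
    by (rule fps_ext) (simp add: c fps_sum_nth fps_X_power_nth if_distrib sum.If_cases)
  moreover have "(\<lambda>z. \<Sum>l\<le>n. a l * z ^ l) has_fps_expansion (\<Sum>l\<le>n. fps_const (a l) * fps_X ^ l)"
    by (intro fps_expansion_intros)
  ultimately show "poly p has_fps_expansion fps_of_poly p" by (simp add: e)
  assume a: "\<And>l. l \<le> n \<Longrightarrow> norm (a l) \<le> 1" and z: "norm z \<le> 1 / 2"
  have "norm (poly p z) \<le> (\<Sum>l\<le>n. (1 / 2) ^ l)"
    unfolding e
  proof (rule sum_norm_le)
    fix l assume "l \<in> {..n}"
    then have "norm (a l) * norm z ^ l \<le> 1 * (1 / 2) ^ l"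
      using a z by (intro mult_mono power_mono) auto
    then show "norm (a l * z ^ l) \<le> (1 / 2) ^ l" by (simp add: norm_mult norm_power)
  qed
  also have "\<dots> = 2 - (1 / 2) ^ n" by (induction n) auto
  also have "\<dots> \<le> 2" by simp
  finally show "norm (poly p z) \<le> 2" .
qed

text \<open>\<open>G\<close> and \<open>H\<close> truncate F^j and F^(j+1) after order n, so G^(j+1)
  - H^j vanishes through order n and Schwarz's lemma gives assumption \<open>E\<close>. Since F(0)
  is nonzero, \<open>G\<close> is invertible as a power series and H / G agrees with
  \<open>F\<close> through order n; the residue is thus the coefficient of \<open>F\<close> at
  k.\<close>

lemma jet_bound_normalized:
  fixes F :: "complex fps"
  assumes j: "j > 0" and k: "k > 0" and F0: "fps_nth F 0 \<noteq> 0"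
    and 1: "\<And>l. l \<le> 2 * j * (j + 1) * k \<Longrightarrow> norm (fps_nth (F ^ j) l) \<le> 1"
    and 2: "\<And>l. l \<le> 2 * j * (j + 1) * k \<Longrightarrow> norm (fps_nth (F ^ (j + 1)) l) \<le> 1"
  shows "norm (fps_nth F k) \<le> (1024 * j * (j + 1) * 2 + 64) * (128 * (2 ^ (j + 4) * 256 ^ (j + 1))\<^sup>2) ^ k"
proof -
  define n where "n = 2 * j * (j + 1) * k"
  define G H where "G = (\<Sum>l\<le>n. monom (fps_nth (F ^ j) l) l)" and "H = (\<Sum>l\<le>n. monom (fps_nth (F ^ (j + 1)) l) l)"
  note tG = poly_truncation[where a = "fps_nth (F ^ j)" and n = n, folded G_def]
  note tH = poly_truncation[where a = "fps_nth (F ^ (j + 1))" and n = n, folded H_def]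
  have n0: "n > 0" using j k by (simp add: n_def)
  have kn: "k \<le> n" using j by (simp add: n_def)
  have G0: "poly G 0 \<noteq> 0" using F0 tG(1)[of 0] by (simp add: poly_0_coeff_0 fps_nth_power_0)
  interpret jet_pair G H j k
  proof
    fix z :: complex assume z: "norm z \<le> 1 / 2"
    define p where "p = G ^ (j + 1) - H ^ j"
    have "norm (poly p z) \<le> 2 ^ (j + 2) * (norm z / (1 / 2)) ^ Suc n"
    proof (rule poly_vanishing_order_bound)
      fix l assume "l < Suc n"
      then have l: "l \<le> n" by simp
      have "fps_nth (fps_of_poly G ^ (j + 1)) l = fps_nth ((F ^ j) ^ (j + 1)) l"
        by (rule fps_power_eq_upto[OF _ l]) (simp add: tG)
      moreover have "fps_nth (fps_of_poly H ^ j) l = fps_nth ((F ^ (j + 1)) ^ j) l"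
        by (rule fps_power_eq_upto[OF _ l]) (simp add: tH)
      moreover have "(F ^ j) ^ (j + 1) = (F ^ (j + 1)) ^ j"
        by (simp only: power_mult[symmetric] mult.commute)
      moreover have "fps_nth (fps_of_poly p) l = fps_nth (fps_of_poly G ^ (j + 1)) l - fps_nth (fps_of_poly H ^ j) l"
        by (simp only: p_def fps_of_poly_diff fps_of_poly_power fps_sub_nth)
      ultimately have "fps_nth (fps_of_poly p) l = 0" by (simp only: diff_self)
      then show "coeff p l = 0" by simp
    next
      fix w :: complex assume w: "norm w = 1 / 2"
      have "norm (poly p w) \<le> norm (poly G w) ^ (j + 1) + norm (poly H w) ^ j"
        unfolding p_def poly_diff poly_power norm_power[symmetric] by (rule norm_triangle_ineq4)
      also have "\<dots> \<le> 2 ^ (j + 1) + 2 ^ j"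
        using tG(4)[of w] tH(4)[of w] w 1 2 by (intro add_mono power_mono) (auto simp: n_def)
      also have "\<dots> \<le> 2 ^ (j + 2)" by simp
      finally show "norm (poly p w) \<le> 2 ^ (j + 2)" .
    qed (use z in auto)
    \<comment> \<open>The spare factor 2 |z| \<le> 1 is dropped, and 2^(j+2) is absorbed into the
      n-th power, where n > 0 is used.\<close>
    also have "\<dots> \<le> (2 ^ (j + 2)) ^ n * (norm z / (1 / 2)) ^ n"
      using n0 z one_le_power[of "2::real" "j + 2"] by (intro mult_mono power_decreasing self_le_power) auto
    also have "\<dots> = (2 ^ (j + 3) * norm z) ^ n"
    proof -
      have "2 ^ (j + 2) * (norm z / (1 / 2)) = 2 ^ (j + 3) * norm z" by (simp add: power_add)
      then show ?thesis by (metis power_mult_distrib)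
    qed
    finally show "norm (poly G z ^ (j + 1) - poly H z ^ j) \<le> (2 ^ (j + 3) * norm z) ^ (2 * j * (j + 1) * k)"
      by (simp add: p_def n_def)
    show "norm (poly G z) \<le> 2" using tG(4) z 1 by (auto simp: n_def)
  qed (use j k G0 tG(2) in \<open>auto simp: n_def\<close>)
  define Q where "Q = fps_of_poly H / fps_of_poly G"
  have G0': "fps_nth (fps_of_poly G) 0 \<noteq> 0" using G0 by (simp add: poly_0_coeff_0)
  have QG: "Q * fps_of_poly G = fps_of_poly H"
    unfolding Q_def using G0' by (simp add: fps_divide_unit mult.assoc inverse_mult_eq_1)
  have "residue (\<lambda>z. poly H z / poly G z / z ^ Suc k) 0 = fps_nth Q k"
    unfolding Q_def
    by (rule residue_fps_expansion_over_power_at_0)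
       (intro has_fps_expansion_divide' tG(3) tH(3) G0')
  also have "fps_nth Q l = fps_nth F l" if "l \<le> n" for l
    using that
  proof (induction l rule: less_induct)
    case (less l)
    have "fps_nth ((Q - F) * fps_of_poly G) l = fps_nth (fps_of_poly H) l - fps_nth (F * fps_of_poly G) l"
      by (simp add: left_diff_distrib QG)
    also have "fps_nth (F * fps_of_poly G) l = fps_nth (F * F ^ j) l"
      by (rule fps_mult_eq_upto[of n]) (use less.prems in \<open>auto simp: tG\<close>)
    also have "fps_nth (fps_of_poly H) l - \<dots> = 0" using less.prems by (simp add: tH)
    also have "fps_nth ((Q - F) * fps_of_poly G) l = (\<Sum>i\<in>{l}. fps_nth (Q - F) i * fps_nth (fps_of_poly G) (l - i))"
      unfolding fps_mult_nth using less by (intro sum.mono_neutral_right) auto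
    finally show ?case using G0' by simp
  qed
  then have "fps_nth Q k = fps_nth F k" using kn by blast
  finally show ?thesis using residue_bound by (simp add: K_def \<phi>_def[abs_def])
qed

text \<open>Two normalizations lead to \<open>jet_bound_normalized\<close>. Removing X^p with p the
  subdegree of \<open>F\<close> moves the coefficient from k to k - p and shifts the powers by p j
  and p (j + 1); both shifts are at most D p, so the known orders suffice. Replacing F(z) by F(z /
  R) / B removes the constants.\<close>

theorem jet_bound:
  assumes j: "j > 0"
  shows "\<exists>C c. 1 \<le> C \<and> 1 \<le> c \<and> (\<forall>(F :: complex fps) B R k. 0 < B \<longrightarrow> 0 < R \<longrightarrow>
      (\<forall>l\<le>2 * j * (j + 1) * k. norm (fps_nth (F ^ j) l) \<le> B ^ j * R ^ l \<and>
         norm (fps_nth (F ^ (j + 1)) l) \<le> B ^ (j + 1) * R ^ l) \<longrightarrow>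
      norm (fps_nth F k) \<le> C * B * (c * R) ^ k)"
proof -
  define C c :: real where "C = 1024 * j * (j + 1) * 2 + 64" and "c = 128 * (2 ^ (j + 4) * 256 ^ (j + 1))\<^sup>2"
  define D where "D = 2 * j * (j + 1)"
  have C: "1 \<le> C" by (simp add: C_def)
  have c: "1 \<le> c" unfolding c_def by (intro mult_ge1_I one_le_power) auto
  have D: "j \<le> D" "j + 1 \<le> D" using j by (auto simp: D_def)
  have base: "norm (fps_nth F k) \<le> C * c ^ k"
    if F: "\<And>l. l \<le> D * k \<Longrightarrow> norm (fps_nth (F ^ j) l) \<le> 1 \<and> norm (fps_nth (F ^ (j + 1)) l) \<le> 1"
    for F :: "complex fps" and k
  proof (cases "F = 0 \<or> k < subdegree F")
    case True
    then have "fps_nth F k = 0" by auto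
    then show ?thesis using C c by simp
  next
    case False
    define p where "p = subdegree F"
    define F' where "F' = fps_shift p F"
    have FF: "F = F' * fps_X ^ p" unfolding F'_def p_def by (rule subdegree_decompose)
    have kp: "p \<le> k" using False by (simp add: p_def)
    have F'0: "fps_nth F' 0 \<noteq> 0" using False by (simp add: F'_def p_def)
    have "F ^ m = F' ^ m * fps_X ^ (p * m)" for m
      by (subst FF) (simp add: power_mult_distrib power_mult)
    then have pw: "fps_nth (F' ^ m) l = fps_nth (F ^ m) (l + p * m)" for m l
      by (simp add: fps_X_power_mult_right_nth)
    have pD: "p * j \<le> D * p" "p * (j + 1) \<le> D * p" using D by (simp_all only: mult.commute[of p] mult_le_mono1)
    have F'b: "norm (fps_nth (F' ^ j) l) \<le> 1" "norm (fps_nth (F' ^ (j + 1)) l) \<le> 1" if "l \<le> D * (k - p)" for l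
    proof -
      have "D * (k - p) + D * p = D * k" using kp by (simp add: distrib_left[symmetric])
      then have "l + p * j \<le> D * k" "l + p * (j + 1) \<le> D * k" using that pD by linarith+
      then show "norm (fps_nth (F' ^ j) l) \<le> 1" "norm (fps_nth (F' ^ (j + 1)) l) \<le> 1"
        unfolding pw using F by blast+
    qed
    have "norm (fps_nth F' (k - p)) \<le> C * c ^ (k - p)"
    proof (cases "k = p")
      case True
      have "norm (fps_nth F' 0) ^ j \<le> 1 ^ j" using F'b(1)[of 0] by (simp add: fps_nth_power_0 norm_power)
      then have "norm (fps_nth F' 0) \<le> 1" using j by (subst (asm) power_mono_iff) auto
      then show ?thesis using True C by simp
    next
      case False
      then show ?thesis
        using jet_bound_normalized[OF j _ F'0, of "k - p"] F'b kp by (simp add: C_def c_def D_def)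
    qed
    also have "\<dots> \<le> C * c ^ k" using C c by (intro mult_left_mono power_increasing) auto
    finally show ?thesis using kp by (simp add: F'_def)
  qed
  have "norm (fps_nth F k) \<le> C * B * (c * R) ^ k"
    if BR: "0 < B" "0 < R" and F: "\<forall>l\<le>D * k. norm (fps_nth (F ^ j) l) \<le> B ^ j * R ^ l \<and>
         norm (fps_nth (F ^ (j + 1)) l) \<le> B ^ (j + 1) * R ^ l" for F :: "complex fps" and B R k
  proof -
    define F' where "F' = Abs_fps (\<lambda>l. fps_nth F l / of_real (B * R ^ l))"
    have pw: "fps_nth (F' ^ m) l = fps_nth (F ^ m) l / of_real (B ^ m * R ^ l)" for m l
    proof (induction m arbitrary: l)
      case (Suc m)
      have "fps_nth (F' ^ Suc m) l = (\<Sum>i=0..l. fps_nth F i / of_real (B * R ^ i) *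
          (fps_nth (F ^ m) (l - i) / of_real (B ^ m * R ^ (l - i))))"
        by (simp add: fps_mult_nth Suc.IH) (simp add: F'_def)
      also have "\<dots> = (\<Sum>i=0..l. fps_nth F i * fps_nth (F ^ m) (l - i) / of_real (B ^ Suc m * R ^ l))"
      proof (intro sum.cong refl)
        fix i assume "i \<in> {0..l}"
        then have "R ^ l = R ^ i * R ^ (l - i)" by (simp add: power_add[symmetric])
        then show "fps_nth F i / of_real (B * R ^ i) * (fps_nth (F ^ m) (l - i) / of_real (B ^ m * R ^ (l - i)))
            = fps_nth F i * fps_nth (F ^ m) (l - i) / of_real (B ^ Suc m * R ^ l)"
          by (simp add: mult_ac)
      qed
      finally show ?case by (simp add: fps_mult_nth sum_divide_distrib)
    qed (use BR in \<open>auto simp: fps_one_nth\<close>)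
    have "norm (fps_nth F' k) \<le> C * c ^ k"
    proof (rule base)
      fix l assume "l \<le> D * k"
      with F have "norm (fps_nth (F ^ j) l) \<le> B ^ j * R ^ l" "norm (fps_nth (F ^ (j + 1)) l) \<le> B ^ (j + 1) * R ^ l"
        by blast+
      then show "norm (fps_nth (F' ^ j) l) \<le> 1 \<and> norm (fps_nth (F' ^ (j + 1)) l) \<le> 1"
        unfolding pw norm_divide norm_of_real using BR by (simp add: divide_le_eq)
    qed
    then have "norm (fps_nth F k) \<le> C * c ^ k * (B * R ^ k)"
      using BR by (simp add: F'_def norm_divide divide_le_eq norm_mult norm_power)
    then show ?thesis by (simp add: power_mult_distrib mult_ac)
  qed
  then show ?thesis unfolding D_def using C c by blast
qed

section \<open>Uniform asymptotic expansions along lines\<close>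

text \<open>One-sided in s, with the constants as explicit arguments, so that uniformity in base
  points and directions can be expressed.\<close>

definition expands :: "(real \<Rightarrow> complex) \<Rightarrow> nat \<Rightarrow> (nat \<Rightarrow> complex) \<Rightarrow> real \<Rightarrow> real \<Rightarrow> bool" where
  "expands g L b C \<epsilon> \<longleftrightarrow> (\<forall>s\<in>{0..\<epsilon>}. norm (g s - (\<Sum>l<L. b l * of_real s ^ l)) \<le> C * s ^ L)"

definition tcoef :: "(real \<Rightarrow> complex) \<Rightarrow> nat \<Rightarrow> complex" where
  "tcoef g q = (THE c. \<exists>b C \<epsilon>. 0 < \<epsilon> \<and> expands g (Suc q) b C \<epsilon> \<and> b q = c)"

lemma expandsD: "expands g L b C \<epsilon> \<Longrightarrow> 0 \<le> s \<Longrightarrow> s \<le> \<epsilon> \<Longrightarrow> norm (g s - (\<Sum>l<L. b l * of_real s ^ l)) \<le> C * s ^ L"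
  by (simp add: expands_def)

text \<open>Once the lower coefficients vanish, dividing by s^l and letting s tend to 0 from the
  right isolates the coefficient at l.\<close>

lemma small_poly_eq_0:
  fixes d :: "nat \<Rightarrow> complex"
  assumes \<epsilon>: "\<epsilon> > 0" and small: "\<And>s. 0 < s \<Longrightarrow> s \<le> \<epsilon> \<Longrightarrow> norm (\<Sum>l<M. d l * of_real s ^ l) \<le> C * s ^ L"
    and l: "l < L" "l < M"
  shows "d l = 0"
  using l
proof (induction l rule: less_induct)
  case (less l)
  define f where "f s = (\<Sum>i\<in>{l..<M}. d i * of_real s ^ (i - l))" for s :: real
  have ev: "eventually (\<lambda>s. norm (f s) \<le> C * s ^ (L - l)) (at_right 0)"
    unfolding eventually_at_right_field
  proof (intro exI[of _ \<epsilon>] conjI allI impI \<epsilon>)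
    fix s :: real assume s: "0 < s" "s < \<epsilon>"
    have "(\<Sum>i<M. d i * of_real s ^ i) = (\<Sum>i\<in>{l..<M}. d i * of_real s ^ i)"
      using less by (intro sum.mono_neutral_right) auto
    also have "\<dots> = (\<Sum>i\<in>{l..<M}. d i * (of_real s ^ (i - l) * of_real s ^ l))"
      by (intro sum.cong) (auto simp flip: power_add)
    also have "\<dots> = f s * of_real s ^ l" by (simp add: f_def sum_distrib_right mult.assoc)
    finally have "norm (f s) * s ^ l \<le> C * s ^ L" using small[of s] s by (simp add: norm_mult norm_power)
    also have "\<dots> = C * s ^ (L - l) * s ^ l" using less.prems by (simp flip: power_add)
    finally show "norm (f s) \<le> C * s ^ (L - l)" using s by simp
  qed
  have "((\<lambda>s. norm (f s)) \<longlongrightarrow> norm (f 0)) (at_right 0)"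
    unfolding f_def by (intro tendsto_intros)
  moreover have "((\<lambda>s. C * s ^ (L - l)) \<longlongrightarrow> C * 0 ^ (L - l)) (at_right 0)"
    by (intro tendsto_intros)
  ultimately have "norm (f 0) \<le> C * 0 ^ (L - l)" using ev by (intro tendsto_le[OF _ _ _ ev]) auto
  then have "f 0 = 0" using zero_power[of "L - l", where 'a = real] less.prems by simp
  moreover have "f 0 = (\<Sum>i\<in>{l}. d i * of_real 0 ^ (i - l))"
    unfolding f_def using less.prems by (intro sum.mono_neutral_right) auto
  ultimately show ?case by simp
qed

lemma expands_unique:
  assumes "expands g L b C \<epsilon>" "expands g L b' C' \<epsilon>'" "0 < \<epsilon>" "0 < \<epsilon>'" "l < L"
  shows "b l = b' l"
proof -
  have "b l - b' l = 0"
  proof (rule small_poly_eq_0[where \<epsilon> = "min \<epsilon> \<epsilon>'" and M = L and C = "C + C'" and L = L])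
    fix s :: real assume s: "0 < s" "s \<le> min \<epsilon> \<epsilon>'"
    have "norm ((g s - (\<Sum>l<L. b' l * of_real s ^ l)) - (g s - (\<Sum>l<L. b l * of_real s ^ l)))
        \<le> C' * s ^ L + C * s ^ L"
      using s by (intro order_trans[OF norm_triangle_ineq4] add_mono expandsD[OF assms(1)] expandsD[OF assms(2)]) auto
    then show "norm (\<Sum>l<L. (b l - b' l) * of_real s ^ l) \<le> (C + C') * s ^ L"
      by (simp add: algebra_simps sum_subtractf)
  qed (use assms in auto)
  then show ?thesis by simp
qed

lemma expands_nonneg: "expands g L b C \<epsilon> \<Longrightarrow> 0 < \<epsilon> \<Longrightarrow> 0 \<le> C"
proof -
  assume a: "expands g L b C \<epsilon>" "0 < \<epsilon>"
  have "0 \<le> C * \<epsilon> ^ L" using order_trans[OF norm_ge_zero expandsD[OF a(1), of \<epsilon>]] a by auto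
  then show "0 \<le> C" using zero_less_power[OF a(2), of L] by (simp add: zero_le_mult_iff)
qed

lemma expands_mono: "expands g L b C \<epsilon> \<Longrightarrow> C \<le> C' \<Longrightarrow> \<epsilon>' \<le> \<epsilon> \<Longrightarrow> expands g L b C' \<epsilon>'"
  unfolding expands_def
proof (intro ballI)
  fix s assume "\<forall>s\<in>{0..\<epsilon>}. norm (g s - (\<Sum>l<L. b l * of_real s ^ l)) \<le> C * s ^ L" "C \<le> C'" "\<epsilon>' \<le> \<epsilon>" "s \<in> {0..\<epsilon>'}"
  then have "norm (g s - (\<Sum>l<L. b l * of_real s ^ l)) \<le> C * s ^ L" "C * s ^ L \<le> C' * s ^ L"
    by (auto intro: mult_right_mono)
  then show "norm (g s - (\<Sum>l<L. b l * of_real s ^ l)) \<le> C' * s ^ L" by linarith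
qed

lemma expands_truncate:
  assumes e: "expands g L' b C \<epsilon>" and b: "\<And>l. l < L' \<Longrightarrow> norm (b l) \<le> C" and L: "L \<le> L'" and \<epsilon>: "0 < \<epsilon>" "\<epsilon> \<le> 1"
  shows "expands g L b (C * (real L' + 1)) \<epsilon>"
  unfolding expands_def
proof
  fix s assume s: "s \<in> {0..\<epsilon>}"
  have C: "0 \<le> C" using expands_nonneg e \<epsilon> by blast
  have s1: "0 \<le> s" "s \<le> 1" using s \<epsilon> by auto
  have "(\<Sum>l<L'. b l * of_real s ^ l) = (\<Sum>l<L. b l * of_real s ^ l) + (\<Sum>l\<in>{L..<L'}. b l * of_real s ^ l)"
    using L by (metis atLeast0LessThan sum.atLeastLessThan_concat zero_le)
  then have "g s - (\<Sum>l<L. b l * of_real s ^ l) =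
      (g s - (\<Sum>l<L'. b l * of_real s ^ l)) + (\<Sum>l\<in>{L..<L'}. b l * of_real s ^ l)" by simp
  also have "norm \<dots> \<le> C * s ^ L' + (\<Sum>l\<in>{L..<L'}. C * s ^ L)"
  proof (intro norm_triangle_mono sum_norm_le)
    fix l assume l: "l \<in> {L..<L'}"
    have "norm (b l) * s ^ l \<le> C * s ^ L"
      using l b[of l] C s1 by (intro mult_mono power_decreasing) auto
    then show "norm (b l * of_real s ^ l) \<le> C * s ^ L" using s1 by (simp add: norm_mult norm_power)
  qed (use e s in \<open>auto intro: expandsD\<close>)
  also have "\<dots> \<le> C * s ^ L + real L' * (C * s ^ L)"
    using C s1 L by (intro add_mono mult_left_mono power_decreasing) (auto intro!: mult_right_mono mult_nonneg_nonneg)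
  also have "\<dots> = C * (real L' + 1) * s ^ L" by (simp add: algebra_simps)
  finally show "norm (g s - (\<Sum>l<L. b l * of_real s ^ l)) \<le> C * (real L' + 1) * s ^ L" .
qed

lemma tcoef_eq:
  assumes "expands g L b C \<epsilon>" "0 < \<epsilon>" "q < L"
  shows "tcoef g q = b q"
proof -
  define C' where "C' = C + (\<Sum>l<L. norm (b l))"
  have C: "C \<ge> 0" using expands_nonneg assms by blast
  have "expands g (Suc q) b (C' * (real L + 1)) (min \<epsilon> 1)"
  proof (rule expands_truncate)
    show "expands g L b C' (min \<epsilon> 1)"
      using assms(1) by (rule expands_mono) (auto simp: C'_def intro: sum_nonneg)
    show "norm (b l) \<le> C'" if "l < L" for l
      using C that member_le_sum[of l "{..<L}" "\<lambda>l. norm (b l)"] by (simp add: C'_def)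
  qed (use assms in auto)
  then show ?thesis
    unfolding tcoef_def using assms(2)
  proof (intro the_equality)
    show "\<exists>b' C \<epsilon>. 0 < \<epsilon> \<and> expands g (Suc q) b' C \<epsilon> \<and> b' q = b q"
      using \<open>expands g (Suc q) b _ _\<close> assms(2) by (intro exI conjI) auto
  qed (use \<open>expands g (Suc q) b _ _\<close> assms(2) in \<open>auto dest: expands_unique\<close>)
qed

lemma expands_coef:
  assumes "expands g L b C \<epsilon>" "0 < \<epsilon>"
  shows "expands g L (tcoef g) C \<epsilon>"
proof -
  have "(\<Sum>l<L. tcoef g l * of_real s ^ l) = (\<Sum>l<L. b l * of_real s ^ l)" for s
    using tcoef_eq[OF assms] by (intro sum.cong) auto
  then show ?thesis using assms(1) by (simp add: expands_def)
qed

lemma expands_mult: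
  fixes A B :: "complex fps"
  assumes g: "expands g L (fps_nth A) C \<epsilon>" "\<And>l. l < L \<Longrightarrow> norm (fps_nth A l) \<le> C"
    and h: "expands h L (fps_nth B) C' \<epsilon>" "\<And>l. l < L \<Longrightarrow> norm (fps_nth B l) \<le> C'"
    and \<epsilon>: "0 < \<epsilon>" "\<epsilon> \<le> 1"
  shows "expands (\<lambda>s. g s * h s) L (fps_nth (A * B)) (C * C' * (3 * (real L + 1)\<^sup>2)) \<epsilon>"
    and "\<And>l. l < L \<Longrightarrow> norm (fps_nth (A * B) l) \<le> C * C' * (3 * (real L + 1)\<^sup>2)"
proof -
  have C: "0 \<le> C" "0 \<le> C'" using g(1) h(1) \<epsilon> expands_nonneg by blast+
  have L1: "real L + 1 \<le> (real L + 1)\<^sup>2" by (simp add: power2_eq_square)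
  show "norm (fps_nth (A * B) l) \<le> C * C' * (3 * (real L + 1)\<^sup>2)" if "l < L" for l
  proof -
    have "norm (fps_nth (A * B) l) \<le> (\<Sum>i=0..l. C * C')"
      unfolding fps_mult_nth norm_mult using that C
      by (intro sum_norm_le) (auto simp: norm_mult intro!: mult_mono g h)
    also have "\<dots> = C * C' * (real l + 1)" by simp
    also have "\<dots> \<le> C * C' * (3 * (real L + 1)\<^sup>2)" using that L1 C by (intro mult_left_mono) auto
    finally show ?thesis .
  qed
  show "expands (\<lambda>s. g s * h s) L (fps_nth (A * B)) (C * C' * (3 * (real L + 1)\<^sup>2)) \<epsilon>"
    unfolding expands_def
  proof
    fix s assume s: "s \<in> {0..\<epsilon>}"
    have s1: "0 \<le> s" "s \<le> 1" using s \<epsilon> by auto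
    define P where "P = (\<Sum>l<L. fps_nth A l * of_real s ^ l)"
    define Q where "Q = (\<Sum>l<L. fps_nth B l * of_real s ^ l)"
    have gP: "norm (g s - P) \<le> C * s ^ L" and hQ: "norm (h s - Q) \<le> C' * s ^ L"
      unfolding P_def Q_def using s by (auto intro: expandsD[OF g(1)] expandsD[OF h(1)])
    have tm: "norm (c * of_real s ^ l) \<le> K" if "norm c \<le> K" for c :: complex and K l
    proof -
      have "norm c * s ^ l \<le> K * 1" using that s1 by (intro mult_mono power_le_one) (auto intro: order_trans[OF norm_ge_zero])
      then show ?thesis using s1 by (simp add: norm_mult norm_power)
    qed
    have "norm Q \<le> (\<Sum>l<L. C')"
      unfolding Q_def by (intro sum_norm_le tm h(2)) simp
    then have Q: "norm Q \<le> real L * C'" by simp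
    have "norm P \<le> (\<Sum>l<L. C)"
      unfolding P_def by (intro sum_norm_le tm g(2)) simp
    then have P: "norm P \<le> real L * C" by simp
    have gb: "norm (g s) \<le> (real L + 1) * C"
    proof -
      have "norm (g s) \<le> norm (g s - P) + norm P" using norm_triangle_ineq[of "g s - P" P] by simp
      also have "norm (g s - P) \<le> C * 1" using gP s1 C by (intro order_trans[OF gP] mult_left_mono power_le_one) auto
      finally show ?thesis using P by (simp add: algebra_simps)
    qed
    have PQ: "norm (P * Q - (\<Sum>l<L. fps_nth (A * B) l * of_real s ^ l)) \<le> (real L)\<^sup>2 * (C * C') * s ^ L"
    proof -
      define u where "u = (\<lambda>(i, l). fps_nth A i * fps_nth B l * (of_real s :: complex) ^ (i + l))"
      define T where "T = {..<L} \<times> {..<L}"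
      \<comment> \<open>The pairs with i + l < L form the truncated Cauchy product; every remaining
        pair carries at least s^L.\<close>
      define T1 T2 where "T1 = {p \<in> T. fst p + snd p < L}" and "T2 = {p \<in> T. \<not> fst p + snd p < L}"
      have fin: "finite T" "finite T1" "finite T2" by (simp_all add: T_def T1_def T2_def)
      have "P * Q = sum u T"
        unfolding P_def Q_def sum_product sum.cartesian_product T_def u_def
        by (intro sum.cong refl) (simp add: power_add mult_ac split: prod.split)
      also have "T = T1 \<union> T2" by (auto simp: T1_def T2_def)
      also have "sum u (T1 \<union> T2) = sum u T1 + sum u T2"
        using fin by (intro sum.union_disjoint) (auto simp: T1_def T2_def)
      also have "sum u T1 = (\<Sum>(m, i)\<in>(SIGMA m:{..<L}. {0..m}). fps_nth A i * fps_nth B (m - i) * of_real s ^ m)"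
        unfolding u_def
        by (rule sum.reindex_bij_witness[of _ "\<lambda>(m, i). (i, m - i)" "\<lambda>(i, l). (i + l, i)"])
           (auto simp: T1_def T_def)
      also have "\<dots> = (\<Sum>l<L. fps_nth (A * B) l * of_real s ^ l)"
        by (simp add: sum.Sigma[symmetric] fps_mult_nth sum_distrib_right)
      finally have "P * Q - (\<Sum>l<L. fps_nth (A * B) l * of_real s ^ l) = sum u T2" by simp
      also have "norm \<dots> \<le> (\<Sum>p\<in>T2. C * C' * s ^ L)"
      proof (rule sum_norm_le)
        fix p assume p: "p \<in> T2"
        obtain i l where p_eq: "p = (i, l)" by (cases p)
        have il: "i < L" "l < L" "L \<le> i + l" using p by (auto simp: p_eq T2_def T_def)
        have "norm (fps_nth A i) * norm (fps_nth B l) * s ^ (i + l) \<le> C * C' * s ^ L"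
          using il C s1 g(2)[of i] h(2)[of l] by (intro mult_mono power_decreasing) auto
        then show "norm (u p) \<le> C * C' * s ^ L"
          using s1 by (simp add: p_eq u_def norm_mult norm_power)
      qed
      also have "\<dots> \<le> (\<Sum>p\<in>T. C * C' * s ^ L)"
        using C s1 fin by (intro sum_mono2) (auto simp: T2_def)
      also have "\<dots> = real (card T) * (C * C' * s ^ L)" by simp
      also have "card T = L * L" by (simp add: T_def)
      also have "real (L * L) * (C * C' * s ^ L) = (real L)\<^sup>2 * (C * C') * s ^ L" by (simp add: power2_eq_square)
      finally show ?thesis .
    qed
    have "g s * h s - (\<Sum>l<L. fps_nth (A * B) l * of_real s ^ l) =
       g s * (h s - Q) + (g s - P) * Q + (P * Q - (\<Sum>l<L. fps_nth (A * B) l * of_real s ^ l))"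
      by (simp add: algebra_simps)
    also have "norm \<dots> \<le> (real L + 1) * C * (C' * s ^ L) + C * s ^ L * (real L * C') + (real L)\<^sup>2 * (C * C') * s ^ L"
      using PQ gb hQ gP Q C s1 by (intro norm_triangle_mono) (simp_all only: norm_mult, (intro mult_mono; simp)+)
    also have "\<dots> = (real L + 1 + real L + (real L)\<^sup>2) * (C * C' * s ^ L)" by (simp add: algebra_simps)
    also have "\<dots> \<le> (3 * (real L + 1)\<^sup>2) * (C * C' * s ^ L)"
      using C s1 by (intro mult_right_mono) (auto simp: power2_eq_square algebra_simps)
    finally show "norm (g s * h s - (\<Sum>l<L. fps_nth (A * B) l * of_real s ^ l)) \<le> C * C' * (3 * (real L + 1)\<^sup>2) * s ^ L"
      by (simp add: mult_ac)
  qed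
qed

text \<open>The constant is chosen before the function, its series and \<epsilon>, so that uniform
  families of expansions remain uniform under powers.\<close>

lemma expands_power:
  "\<exists>C'\<ge>1. \<forall>g (A :: complex fps) \<epsilon>. expands g L (fps_nth A) C \<epsilon> \<and> (\<forall>l<L. norm (fps_nth A l) \<le> C) \<and> 0 < \<epsilon> \<and> \<epsilon> \<le> 1 \<longrightarrow>
     expands (\<lambda>s. g s ^ m) L (fps_nth (A ^ m)) C' \<epsilon> \<and> (\<forall>l<L. norm (fps_nth (A ^ m) l) \<le> C')"
proof (induction m)
  case 0
  have "(\<Sum>l<L. fps_nth 1 l * (of_real s :: complex) ^ l) = (if L = 0 then 0 else 1)" for s :: real
  proof (cases "L = 0")
    case False
    then have "(\<Sum>l<L. fps_nth 1 l * (of_real s :: complex) ^ l) = (\<Sum>l\<in>{0}. fps_nth 1 l * of_real s ^ l)"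
      by (intro sum.mono_neutral_right) auto
    then show ?thesis using False by simp
  qed auto
  then show ?case by (intro exI[of _ 1]) (auto simp: expands_def fps_one_nth)
next
  case (Suc m)
  then obtain C' where C': "C' \<ge> 1" "\<And>g (A :: complex fps) \<epsilon>. expands g L (fps_nth A) C \<epsilon> \<Longrightarrow> (\<forall>l<L. norm (fps_nth A l) \<le> C) \<Longrightarrow> 0 < \<epsilon> \<Longrightarrow> \<epsilon> \<le> 1 \<Longrightarrow>
     expands (\<lambda>s. g s ^ m) L (fps_nth (A ^ m)) C' \<epsilon> \<and> (\<forall>l<L. norm (fps_nth (A ^ m) l) \<le> C')"
    by blast
  define C'' where "C'' = max 1 (C * C' * (3 * (real L + 1)\<^sup>2))"
  show ?case
  proof (intro exI[of _ C''] conjI allI impI; (elim conjE)?)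
    fix g and A :: "complex fps" and \<epsilon>
    assume a: "expands g L (fps_nth A) C \<epsilon>" "\<forall>l<L. norm (fps_nth A l) \<le> C" "0 < \<epsilon>" "\<epsilon> \<le> 1"
    have b: "expands (\<lambda>s. g s ^ m) L (fps_nth (A ^ m)) C' \<epsilon>" "\<forall>l<L. norm (fps_nth (A ^ m) l) \<le> C'"
      using C'(2)[OF a] by blast+
    note mul = expands_mult[OF a(1) _ b(1) _ a(3,4)]
    show "expands (\<lambda>s. g s ^ Suc m) L (fps_nth (A ^ Suc m)) C'' \<epsilon>"
      unfolding power_Suc by (rule expands_mono[OF mul(1)]) (use a b in \<open>auto simp: C''_def\<close>)
    fix l assume "l < L"
    then show "norm (fps_nth (A ^ Suc m) l) \<le> C''"
      unfolding power_Suc using mul(2)[of l] a(2) b(2) by (force simp: C''_def)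
  qed (simp add: C''_def)
qed

text \<open>Lagrange interpolation at the nodes 0, ..., M - 1: \<kappa> i is the coefficient of
  order q of the i-th Lagrange polynomial.\<close>

lemma coefficient_extraction:
  assumes "q < M"
  shows "\<exists>\<kappa>::nat \<Rightarrow> complex. \<forall>a. (\<Sum>i<M. \<kappa> i * (\<Sum>l<M. a l * of_nat i ^ l)) = a q"
proof -
  define A where "A i = {..<M} - {i}" for i
  define lag where "lag i = smult (inverse (\<Prod>m\<in>A i. of_nat i - of_nat m)) (\<Prod>m\<in>A i. [:- of_nat m, 1 :: complex:])" for i
  have deg: "degree (lag i) < M" if "i < M" for i
  proof -
    have "degree (lag i) \<le> degree (\<Prod>m\<in>A i. [:- of_nat m, 1 :: complex:])" by (simp add: lag_def)
    also have "\<dots> \<le> (\<Sum>m\<in>A i. 1)" by (rule order_trans[OF degree_prod_sum_le]) (auto simp: A_def)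
    also have "\<dots> < M" using that by (simp add: A_def)
    finally show ?thesis .
  qed
  have val: "poly (lag i) (of_nat m) = (if i = m then 1 else 0)" if "i < M" "m < M" for i m
  proof (cases "i = m")
    case True
    have "(\<Prod>n\<in>A m. of_nat m - of_nat n) \<noteq> (0 :: complex)" by (auto simp: A_def)
    then show ?thesis using True by (simp add: lag_def poly_prod)
  next
    case False
    have "poly (\<Prod>n\<in>A i. [:- of_nat n, 1 :: complex:]) (of_nat m) = 0"
      using False that by (auto simp: poly_prod A_def)
    then show ?thesis using False by (simp add: lag_def)
  qed
  have "(\<Sum>i<M. coeff (lag i) q * (\<Sum>l<M. a l * of_nat i ^ l)) = a q" for a :: "nat \<Rightarrow> complex"
  proof -
    define p where "p = (\<Sum>l<M. monom (a l) l)"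
    have pv: "poly p x = (\<Sum>l<M. a l * x ^ l)" for x by (simp add: p_def poly_sum poly_monom)
    have cp: "coeff p l = (if l < M then a l else 0)" for l
      by (simp add: p_def coeff_sum if_distrib sum.If_cases)
    have M: "M > 0" using assms by simp
    have dp: "degree p < M"
      using M by (intro le_less_trans[OF degree_le[of "M - 1"]]) (auto simp: cp)
    have "p = (\<Sum>i<M. smult (poly p (of_nat i)) (lag i))"
    proof (rule poly_eqI_degree[of "of_nat ` {..<M}"])
      fix x :: complex assume "x \<in> of_nat ` {..<M}"
      then obtain m where m: "m < M" "x = of_nat m" by auto
      have "poly (\<Sum>i<M. smult (poly p (of_nat i)) (lag i)) x = (\<Sum>i<M. if i = m then poly p x else 0)"
        unfolding poly_sum using m val by (intro sum.cong) auto
      then show "poly p x = poly (\<Sum>i<M. smult (poly p (of_nat i)) (lag i)) x" using m by simp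
    next
      have card: "card (of_nat ` {..<M} :: complex set) = M" by (simp add: card_image inj_on_def)
      show "card (of_nat ` {..<M} :: complex set) > degree p" using dp card by simp
      have "degree (\<Sum>i<M. smult (poly p (of_nat i)) (lag i)) \<le> M - 1"
      proof (intro degree_sum_le order_trans[OF degree_smult_le])
        show "degree (lag i) \<le> M - 1" if "i \<in> {..<M}" for i using deg[of i] that by simp
      qed simp
      then show "card (of_nat ` {..<M} :: complex set) > degree (\<Sum>i<M. smult (poly p (of_nat i)) (lag i))"
        using card M by simp
    qed
    then have "coeff p q = (\<Sum>i<M. poly p (of_nat i) * coeff (lag i) q)"
      by (subst (asm) poly_eq_iff) (simp add: coeff_sum)
    then show ?thesis using assms by (simp add: cp pv mult.commute)
  qed
  then show ?thesis by (intro exI[of _ "\<lambda>i. coeff (lag i) q"] allI)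
qed

definition dc :: "('a::real_normed_vector \<Rightarrow> complex) \<Rightarrow> 'a \<Rightarrow> 'a \<Rightarrow> nat \<Rightarrow> complex" where
  "dc f x w = tcoef (\<lambda>s. f (x + s *\<^sub>R w))"

text \<open>The coefficients are unique, so \<open>THE\<close> in \<open>tcoef\<close> is meaningful as soon as an expansion of order
  \<open>Suc q\<close> exists; \<open>dc f x w l\<close> stands for the value at \<open>w\<close> of the \<open>l\<close>-th Taylor form of \<open>f\<close> at \<open>x\<close>.\<close>

definition unif_exp :: "('a::real_normed_vector \<Rightarrow> complex) set \<Rightarrow> 'a \<Rightarrow> real \<Rightarrow> bool" where
  "unif_exp \<Phi> x0 r \<longleftrightarrow> r > 0 \<and> (\<forall>L \<rho>. \<exists>C \<epsilon>. 0 < \<epsilon> \<and> \<epsilon> \<le> 1 \<and> (\<forall>f\<in>\<Phi>. \<forall>x\<in>ball x0 r. \<forall>w. norm w \<le> \<rho> \<longrightarrow>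
     (\<forall>l<L. norm (dc f x w l) \<le> C) \<and> expands (\<lambda>s. f (x + s *\<^sub>R w)) L (dc f x w) C \<epsilon>))"

text \<open>Coefficients of any origin and any higher order are enough: uniqueness identifies them
  with \<open>dc\<close>, and the expansion can be truncated.\<close>

lemma unif_expI:
  fixes \<Phi> :: "('a::real_normed_vector \<Rightarrow> complex) set"
  assumes r: "r > 0" and ex: "\<And>L \<rho>. \<exists>L'\<ge>L. \<exists>C \<epsilon>. 0 < \<epsilon> \<and> (\<forall>f\<in>\<Phi>. \<forall>x\<in>ball x0 r. \<forall>w. norm w \<le> \<rho> \<longrightarrow>
     (\<exists>b. (\<forall>l<L'. norm (b l) \<le> C) \<and> expands (\<lambda>s. f (x + s *\<^sub>R w)) L' b C \<epsilon>))"
  shows "unif_exp \<Phi> x0 r"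
  unfolding unif_exp_def
proof (intro conjI allI r)
  fix L :: nat and \<rho> :: real
  obtain L' C \<epsilon> where L': "L' \<ge> L" and \<epsilon>: "0 < \<epsilon>" and b: "\<And>f x w. f \<in> \<Phi> \<Longrightarrow> x \<in> ball x0 r \<Longrightarrow> norm w \<le> \<rho> \<Longrightarrow>
     \<exists>b. (\<forall>l<L'. norm (b l) \<le> C) \<and> expands (\<lambda>s. f (x + s *\<^sub>R w)) L' b C \<epsilon>"
    using ex[of L \<rho>] by blast
  define \<epsilon>' where "\<epsilon>' = min \<epsilon> 1"
  show "\<exists>C \<epsilon>. 0 < \<epsilon> \<and> \<epsilon> \<le> 1 \<and> (\<forall>f\<in>\<Phi>. \<forall>x\<in>ball x0 r. \<forall>w. norm w \<le> \<rho> \<longrightarrow>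
     (\<forall>l<L. norm (dc f x w l) \<le> C) \<and> expands (\<lambda>s. f (x + s *\<^sub>R w)) L (dc f x w) C \<epsilon>)"
  proof (rule exI[of _ "max C 0 * (real L' + 1)"], rule exI[of _ \<epsilon>'], intro conjI ballI allI impI)
    fix f x and w :: 'a assume a: "f \<in> \<Phi>" "x \<in> ball x0 r" "norm w \<le> \<rho>"
    obtain b where b': "\<And>l. l < L' \<Longrightarrow> norm (b l) \<le> C" "expands (\<lambda>s. f (x + s *\<^sub>R w)) L' b C \<epsilon>"
      using b[OF a] by blast
    have e: "expands (\<lambda>s. f (x + s *\<^sub>R w)) L' b (max C 0) \<epsilon>'"
      using b'(2) by (rule expands_mono) (auto simp: \<epsilon>'_def)
    have "norm (b l) \<le> max C 0" if "l < L'" for l using b'(1)[OF that] by simp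
    from expands_truncate[OF e this L'] \<epsilon>
    have e': "expands (\<lambda>s. f (x + s *\<^sub>R w)) L b (max C 0 * (real L' + 1)) \<epsilon>'" by (simp add: \<epsilon>'_def)
    show "expands (\<lambda>s. f (x + s *\<^sub>R w)) L (dc f x w) (max C 0 * (real L' + 1)) \<epsilon>'"
      unfolding dc_def using e' \<epsilon> by (intro expands_coef) (auto simp: \<epsilon>'_def)
    fix l assume "l < L"
    then have "dc f x w l = b l" "norm (b l) \<le> C"
      unfolding dc_def using tcoef_eq[OF e'] \<epsilon> L' b'(1)[of l] by (auto simp: \<epsilon>'_def)
    then have "norm (dc f x w l) \<le> max C 0 * 1" by simp
    also have "\<dots> \<le> max C 0 * (real L' + 1)" by (intro mult_left_mono) auto
    finally show "norm (dc f x w l) \<le> max C 0 * (real L' + 1)" .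
  qed (use \<epsilon> in \<open>auto simp: \<epsilon>'_def\<close>)
qed

lemma unif_expE:
  assumes "unif_exp \<Phi> x0 r"
  obtains C \<epsilon> where "0 < \<epsilon>" "\<epsilon> \<le> 1" "0 \<le> C"
    "\<And>f x w l. f \<in> \<Phi> \<Longrightarrow> x \<in> ball x0 r \<Longrightarrow> norm w \<le> \<rho> \<Longrightarrow> l < L \<Longrightarrow> norm (dc f x w l) \<le> C"
    "\<And>f x w. f \<in> \<Phi> \<Longrightarrow> x \<in> ball x0 r \<Longrightarrow> norm w \<le> \<rho> \<Longrightarrow> expands (\<lambda>s. f (x + s *\<^sub>R w)) L (dc f x w) C \<epsilon>"
proof -
  obtain C \<epsilon> where a: "0 < \<epsilon>" "\<epsilon> \<le> 1" "\<forall>f\<in>\<Phi>. \<forall>x\<in>ball x0 r. \<forall>w. norm w \<le> \<rho> \<longrightarrow>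
     (\<forall>l<L. norm (dc f x w l) \<le> C) \<and> expands (\<lambda>s. f (x + s *\<^sub>R w)) L (dc f x w) C \<epsilon>"
    using assms unfolding unif_exp_def by blast
  show thesis
    by (rule that[of \<epsilon> "max C 0"]) (use a in \<open>force intro: expands_mono[where C = C] simp: le_max_iff_disj\<close>)+
qed

lemma unif_exp_subset: "unif_exp \<Phi> x0 r \<Longrightarrow> \<Psi> \<subseteq> \<Phi> \<Longrightarrow> 0 < r' \<Longrightarrow> r' \<le> r \<Longrightarrow> unif_exp \<Psi> x0 r'"
  unfolding unif_exp_def by (meson subset_ball subset_iff)

lemma dc_0:
  assumes "unif_exp \<Phi> x0 r" "f \<in> \<Phi>" "x \<in> ball x0 r"
  shows "dc f x w 0 = f x"
proof -
  obtain C \<epsilon> where "0 < \<epsilon>" "expands (\<lambda>s. f (x + s *\<^sub>R w)) 1 (dc f x w) C \<epsilon>"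
    using unif_expE[OF assms(1), where L = 1 and \<rho> = "norm w"] assms(2,3) by (metis order_refl)
  from expandsD[OF this(2), of 0] this(1) show ?thesis by simp
qed

lemma dc_line_continuous:
  assumes "unif_exp \<Phi> x0 r" "f \<in> \<Phi>" "x \<in> ball x0 r"
  shows "((\<lambda>s. f (x + s *\<^sub>R w)) \<longlongrightarrow> f x) (at_right 0)"
proof -
  obtain C \<epsilon> where e: "0 < \<epsilon>" "expands (\<lambda>s. f (x + s *\<^sub>R w)) 1 (dc f x w) C \<epsilon>"
    using unif_expE[OF assms(1), where L = 1 and \<rho> = "norm w"] assms(2,3) by (metis order_refl)
  have "((\<lambda>s. f (x + s *\<^sub>R w) - f x) \<longlongrightarrow> 0) (at_right 0)"
  proof (rule Lim_null_comparison)
    show "eventually (\<lambda>s. norm (f (x + s *\<^sub>R w) - f x) \<le> C * s) (at_right 0)"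
      unfolding eventually_at_right_field
      using expandsD[OF e(2)] e(1) dc_0[OF assms] by (intro exI[of _ \<epsilon>]) auto
    have "((\<lambda>s. C * s) \<longlongrightarrow> C * 0) (at_right (0::real))" by (intro tendsto_intros)
    then show "((\<lambda>s. C * s) \<longlongrightarrow> 0) (at_right (0::real))" by simp
  qed
  then show ?thesis by (simp add: LIM_zero_iff)
qed

lemma norm_shift_in_ball:
  assumes "x \<in> ball x0 (r / 2)" "0 \<le> s" "s \<le> r / (2 * (\<rho> + 1))" "norm w \<le> \<rho>" "r > 0"
  shows "x + s *\<^sub>R w \<in> ball x0 r"
proof -
  have \<rho>: "\<rho> \<ge> 0" using assms(4) norm_ge_zero order_trans by blast
  have "s * norm w \<le> r / (2 * (\<rho> + 1)) * (\<rho> + 1)"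
    using assms \<rho> by (intro mult_mono) auto
  also have "\<dots> = r / 2" using \<rho> by (simp add: field_simps)
  finally have "norm (s *\<^sub>R w) \<le> r / 2" using assms(2) by simp
  then have "dist x0 (x + s *\<^sub>R w) < r / 2 + r / 2"
    using assms(1) norm_triangle_ineq4[of "x0 - x" "s *\<^sub>R w"] by (simp add: dist_norm algebra_simps)
  then show ?thesis by simp
qed

text \<open>Coefficients along one direction are recovered from finitely many function values by
  inverting a Vandermonde system; expanding these values along the mixed directions \<open>w + i v\<close>
  shows that the coefficient functions again have uniform expansions.\<close>

lemma unif_exp_dc:
  fixes \<Phi> :: "('a::real_normed_vector \<Rightarrow> complex) set"
  assumes U: "unif_exp \<Phi> x0 r"
  shows "unif_exp {\<lambda>x. dc f x v q | f v. f \<in> \<Phi> \<and> norm v \<le> \<sigma>} x0 (r / 2)"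
proof (rule unif_expI)
  show r2: "r / 2 > 0" using U by (simp add: unif_exp_def)
  then have r: "r > 0" by simp
  fix L :: nat and \<rho>0 :: real
  \<comment> \<open>A positive order forces the remainder to vanish at s = 0, as the limit in
    \<open>zero\<close> requires; \<open>M\<close> below adds the q orders lost on dividing by
    s^q.\<close>
  define L' where "L' = Suc L"
  define \<rho> where "\<rho> = max \<rho>0 0"
  define \<tau> where "\<tau> = max \<sigma> 0"
  define M where "M = q + L'"
  have M: "q < M" "M > 0" by (auto simp: M_def L'_def)
  obtain \<kappa> :: "nat \<Rightarrow> complex" where \<kappa>: "\<And>a. (\<Sum>i<M. \<kappa> i * (\<Sum>l<M. a l * of_nat i ^ l)) = a q"
    using coefficient_extraction[OF M(1)] by blast
  define \<Lambda> where "\<Lambda> = (\<Sum>i<M. norm (\<kappa> i))"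
  have \<Lambda>: "\<Lambda> \<ge> 0" by (simp add: \<Lambda>_def sum_nonneg)
  obtain C1 \<epsilon>1 where e1: "0 < \<epsilon>1" "\<epsilon>1 \<le> 1" "0 \<le> C1"
     "\<And>f x w l. f \<in> \<Phi> \<Longrightarrow> x \<in> ball x0 r \<Longrightarrow> norm w \<le> \<tau> \<Longrightarrow> l < M \<Longrightarrow> norm (dc f x w l) \<le> C1"
     "\<And>f x w. f \<in> \<Phi> \<Longrightarrow> x \<in> ball x0 r \<Longrightarrow> norm w \<le> \<tau> \<Longrightarrow> expands (\<lambda>s. f (x + s *\<^sub>R w)) M (dc f x w) C1 \<epsilon>1"
    by (rule unif_expE[OF U, where L = M and \<rho> = \<tau>]; rule that; blast)
  define \<rho>' where "\<rho>' = \<rho> + real M * \<tau>"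
  obtain C2 \<epsilon>2 where e2: "0 < \<epsilon>2" "\<epsilon>2 \<le> 1" "0 \<le> C2"
     "\<And>f x w l. f \<in> \<Phi> \<Longrightarrow> x \<in> ball x0 r \<Longrightarrow> norm w \<le> \<rho>' \<Longrightarrow> l < M \<Longrightarrow> norm (dc f x w l) \<le> C2"
     "\<And>f x w. f \<in> \<Phi> \<Longrightarrow> x \<in> ball x0 r \<Longrightarrow> norm w \<le> \<rho>' \<Longrightarrow> expands (\<lambda>s. f (x + s *\<^sub>R w)) M (dc f x w) C2 \<epsilon>2"
    by (rule unif_expE[OF U, where L = M and \<rho> = \<rho>']; rule that; blast)
  define \<epsilon> where "\<epsilon> = min (min (\<epsilon>1 / M) \<epsilon>2) (r / (2 * (\<rho> + 1)))"
  have \<rho>0: "\<rho> \<ge> 0" "\<tau> \<ge> 0" by (simp_all add: \<rho>_def \<tau>_def)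
  have \<epsilon>: "\<epsilon> > 0" using e1 e2 M r \<rho>0 by (auto simp: \<epsilon>_def)
  have \<epsilon>1: "\<epsilon> \<le> 1" using e2 by (auto simp: \<epsilon>_def)
  define C3 where "C3 = \<Lambda> * C1 * M ^ M"
  have C3: "C3 \<ge> 0" using \<Lambda> e1 by (simp add: C3_def)
  \<comment> \<open>Sampling f at the M equidistant points y + i t v yields t^q times the
    coefficient of order q along v, up to O(t^M).\<close>
  have sample: "norm ((\<Sum>i<M. \<kappa> i * f (y + (real i * t) *\<^sub>R v)) - dc f y v q * of_real t ^ q) \<le> C3 * t ^ M"
    if f: "f \<in> \<Phi>" "y \<in> ball x0 r" "norm v \<le> \<tau>" and t: "0 \<le> t" "t \<le> \<epsilon>1 / M" for f y v t
  proof -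
    define e where "e i = f (y + (real i * t) *\<^sub>R v) - (\<Sum>l<M. dc f y v l * of_real (real i * t) ^ l)" for i
    have e: "norm (e i) \<le> C1 * M ^ M * t ^ M" if i: "i < M" for i
    proof -
      have it: "0 \<le> real i * t" "real i * t \<le> M * t" using i t by (auto intro: mult_right_mono)
      moreover have "M * t \<le> \<epsilon>1" using t M by (simp add: field_simps)
      ultimately have "norm (e i) \<le> C1 * (real i * t) ^ M"
        unfolding e_def by (intro expandsD[OF e1(5)[OF f]]) auto
      also have "\<dots> \<le> C1 * (M * t) ^ M" using it e1 by (intro mult_left_mono power_mono) auto
      finally show ?thesis by (simp add: power_mult_distrib mult.assoc)
    qed
    have "(\<Sum>i<M. \<kappa> i * (\<Sum>l<M. dc f y v l * of_real (real i * t) ^ l)) = dc f y v q * of_real t ^ q"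
      using \<kappa>[of "\<lambda>l. dc f y v l * of_real t ^ l"] by (simp add: power_mult_distrib mult_ac)
    then have "(\<Sum>i<M. \<kappa> i * f (y + (real i * t) *\<^sub>R v)) - dc f y v q * of_real t ^ q = (\<Sum>i<M. \<kappa> i * e i)"
      by (simp add: e_def right_diff_distrib sum_subtractf)
    also have "norm \<dots> \<le> (\<Sum>i<M. norm (\<kappa> i) * (C1 * M ^ M * t ^ M))"
      using e by (intro sum_norm_le) (auto simp: norm_mult intro!: mult_left_mono)
    also have "\<dots> = C3 * t ^ M" by (simp add: sum_distrib_right[symmetric] \<Lambda>_def C3_def mult.assoc)
    finally show ?thesis .
  qed
  define B where "B f x w v l = (\<Sum>i<M. \<kappa> i * dc f x (w + real i *\<^sub>R v) l)" for f x w and v :: 'a and l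
  define C4 where "C4 = C3 + \<Lambda> * C2"
  have C4: "C4 \<ge> 0" using C3 \<Lambda> e2 by (simp add: C4_def)
  have dir: "norm (w + real i *\<^sub>R v) \<le> \<rho>'" if "norm w \<le> \<rho>" "norm v \<le> \<tau>" "i < M" for w v :: 'a and i
  proof -
    have "norm (w + real i *\<^sub>R v) \<le> norm w + real i * norm v" by (metis norm_triangle_ineq norm_scaleR abs_of_nat)
    also have "real i * norm v \<le> real M * \<tau>" using that by (intro mult_mono) auto
    finally show ?thesis using that by (simp add: \<rho>'_def)
  qed
  have Bb: "norm (B f x w v l) \<le> \<Lambda> * C2" if "f \<in> \<Phi>" "x \<in> ball x0 r" "norm w \<le> \<rho>" "norm v \<le> \<tau>" "l < M" for f x w v l
    unfolding B_def \<Lambda>_def sum_distrib_right using that dir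
    by (intro sum_norm_le) (auto simp: norm_mult intro!: mult_left_mono e2(4))
  \<comment> \<open>With step t = s, the samples around x + s w are the values of f at x + s (w + i
    v), which expand from the fixed point x.\<close>
  have main: "norm (dc f (x + s *\<^sub>R w) v q * of_real s ^ q - (\<Sum>l<M. B f x w v l * of_real s ^ l)) \<le> C4 * s ^ M"
    if f: "f \<in> \<Phi>" and x: "x \<in> ball x0 (r / 2)" and w: "norm w \<le> \<rho>" and v: "norm v \<le> \<tau>" and s: "0 \<le> s" "s \<le> \<epsilon>" for f x w v s
  proof -
    have xs: "x + s *\<^sub>R w \<in> ball x0 r" by (rule norm_shift_in_ball[OF x _ _ w r]) (use s in \<open>auto simp: \<epsilon>_def\<close>)
    have xb: "x \<in> ball x0 r" using x r by simp
    define e where "e i = f (x + s *\<^sub>R (w + real i *\<^sub>R v)) - (\<Sum>l<M. dc f x (w + real i *\<^sub>R v) l * of_real s ^ l)" for i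
    have e: "norm (e i) \<le> C2 * s ^ M" if "i < M" for i
      unfolding e_def using s by (intro expandsD[OF e2(5)[OF f xb dir[OF w v that]]]) (auto simp: \<epsilon>_def)
    have "(\<Sum>i<M. \<kappa> i * f (x + s *\<^sub>R w + (real i * s) *\<^sub>R v)) = (\<Sum>i<M. \<kappa> i * f (x + s *\<^sub>R (w + real i *\<^sub>R v)))"
      by (simp add: algebra_simps)
    also have "\<dots> = (\<Sum>i<M. \<kappa> i * e i) + (\<Sum>i<M. \<kappa> i * (\<Sum>l<M. dc f x (w + real i *\<^sub>R v) l * of_real s ^ l))"
      by (simp add: e_def right_diff_distrib sum_subtractf)
    also have "(\<Sum>i<M. \<kappa> i * (\<Sum>l<M. dc f x (w + real i *\<^sub>R v) l * of_real s ^ l)) = (\<Sum>l<M. B f x w v l * of_real s ^ l)"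
      unfolding B_def sum_distrib_left sum_distrib_right by (subst sum.swap) (simp add: mult.assoc)
    finally have eq: "(\<Sum>i<M. \<kappa> i * f (x + s *\<^sub>R w + (real i * s) *\<^sub>R v)) - (\<Sum>l<M. B f x w v l * of_real s ^ l) = (\<Sum>i<M. \<kappa> i * e i)"
      by simp
    have "norm (\<Sum>i<M. \<kappa> i * e i) \<le> (\<Sum>i<M. norm (\<kappa> i) * (C2 * s ^ M))"
      using e by (intro sum_norm_le) (auto simp: norm_mult intro!: mult_left_mono)
    then have 1: "norm (\<Sum>i<M. \<kappa> i * e i) \<le> \<Lambda> * C2 * s ^ M"
      by (simp add: sum_distrib_right[symmetric] \<Lambda>_def mult.assoc)
    have 2: "norm ((\<Sum>i<M. \<kappa> i * f (x + s *\<^sub>R w + (real i * s) *\<^sub>R v)) - dc f (x + s *\<^sub>R w) v q * of_real s ^ q) \<le> C3 * s ^ M"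
      using s by (intro sample[OF f xs v]) (auto simp: \<epsilon>_def)
    have "dc f (x + s *\<^sub>R w) v q * of_real s ^ q - (\<Sum>l<M. B f x w v l * of_real s ^ l) =
      (\<Sum>i<M. \<kappa> i * e i) - ((\<Sum>i<M. \<kappa> i * f (x + s *\<^sub>R w + (real i * s) *\<^sub>R v)) - dc f (x + s *\<^sub>R w) v q * of_real s ^ q)"
      using eq by (simp add: algebra_simps)
    also have "norm \<dots> \<le> \<Lambda> * C2 * s ^ M + C3 * s ^ M"
      by (intro order_trans[OF norm_triangle_ineq4] add_mono 1 2)
    finally show ?thesis by (simp add: C4_def algebra_simps)
  qed
  \<comment> \<open>The quantity expanded in \<open>main\<close> is itself O(s^q), so the orders
    below q vanish and s^q can be divided out.\<close>
  have low: "B f x w v l = 0"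
    if f: "f \<in> \<Phi>" and x: "x \<in> ball x0 (r / 2)" and w: "norm w \<le> \<rho>" and v: "norm v \<le> \<tau>" and l: "l < q" for f x w v l
  proof (rule small_poly_eq_0[where M = M and L = q and C = "C4 + C1", OF \<epsilon>])
    fix s assume s: "0 < s" "s \<le> \<epsilon>"
    have xs: "x + s *\<^sub>R w \<in> ball x0 r" by (rule norm_shift_in_ball[OF x _ _ w r]) (use s in \<open>auto simp: \<epsilon>_def\<close>)
    have "norm (\<Sum>l<M. B f x w v l * of_real s ^ l) \<le>
       norm (dc f (x + s *\<^sub>R w) v q * of_real s ^ q) + norm (dc f (x + s *\<^sub>R w) v q * of_real s ^ q - (\<Sum>l<M. B f x w v l * of_real s ^ l))"
      using norm_triangle_ineq4[of "dc f (x + s *\<^sub>R w) v q * of_real s ^ q"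
          "dc f (x + s *\<^sub>R w) v q * of_real s ^ q - (\<Sum>l<M. B f x w v l * of_real s ^ l)"] by simp
    also have "\<dots> \<le> C1 * s ^ q + C4 * s ^ M"
    proof (rule add_mono)
      show "norm (dc f (x + s *\<^sub>R w) v q * of_real s ^ q) \<le> C1 * s ^ q"
        using mult_right_mono[OF e1(4)[OF f xs v M(1)], of "s ^ q"] s by (simp add: norm_mult norm_power)
    qed (use main[OF f x w v] s in simp)
    also have "\<dots> \<le> C1 * s ^ q + C4 * s ^ q"
      using s \<epsilon>1 C4 M by (intro add_left_mono mult_left_mono power_decreasing) auto
    finally show "norm (\<Sum>l<M. B f x w v l * of_real s ^ l) \<le> (C4 + C1) * s ^ q" by (simp add: algebra_simps)
  qed (use l M in auto)
  have pos: "norm (dc f (x + s *\<^sub>R w) v q - (\<Sum>l<L'. B f x w v (q + l) * of_real s ^ l)) \<le> C4 * s ^ L'"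
    if f: "f \<in> \<Phi>" and x: "x \<in> ball x0 (r / 2)" and w: "norm w \<le> \<rho>" and v: "norm v \<le> \<tau>" and s: "0 < s" "s \<le> \<epsilon>" for f x w v s
  proof -
    have "(\<Sum>l<M. B f x w v l * of_real s ^ l) = (\<Sum>l\<in>{q..<M}. B f x w v l * of_real s ^ l)"
      using low[OF f x w v] by (intro sum.mono_neutral_right) auto
    also have "\<dots> = (\<Sum>l<L'. B f x w v (q + l) * of_real s ^ (q + l))"
      unfolding M_def by (rule sum.reindex_bij_witness[of _ "\<lambda>l. q + l" "\<lambda>l. l - q"]) auto
    also have "\<dots> = (\<Sum>l<L'. B f x w v (q + l) * of_real s ^ l) * of_real s ^ q"
      unfolding sum_distrib_right by (intro sum.cong refl) (simp add: power_add mult_ac)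
    finally have "dc f (x + s *\<^sub>R w) v q * of_real s ^ q - (\<Sum>l<M. B f x w v l * of_real s ^ l) =
        (dc f (x + s *\<^sub>R w) v q - (\<Sum>l<L'. B f x w v (q + l) * of_real s ^ l)) * of_real s ^ q"
      by (simp only: left_diff_distrib)
    with main[OF f x w v, of s] s
    have "norm (dc f (x + s *\<^sub>R w) v q - (\<Sum>l<L'. B f x w v (q + l) * of_real s ^ l)) * s ^ q \<le> C4 * s ^ M"
      by (simp add: norm_mult norm_power)
    also have "\<dots> = C4 * s ^ L' * s ^ q" by (simp add: M_def power_add mult_ac)
    finally show ?thesis using s by simp
  qed
  \<comment> \<open>\<open>pos\<close> covers s > 0 only. As s tends to 0, dc at x + s w along v has
    a limit b. Passing to this limit in \<open>sample\<close> for fixed t and comparing with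
    \<open>sample\<close> at x itself gives |dc f x v q - b| t^q = O(t^M) with M > q.\<close>
  have zero: "dc f x v q = B f x w v q"
    if f: "f \<in> \<Phi>" and x: "x \<in> ball x0 (r / 2)" and w: "norm w \<le> \<rho>" and v: "norm v \<le> \<tau>" for f x w v
  proof -
    define b where "b = B f x w v q"
    have lim: "((\<lambda>s. dc f (x + s *\<^sub>R w) v q) \<longlongrightarrow> b) (at_right 0)"
    proof -
      have "((\<lambda>s. dc f (x + s *\<^sub>R w) v q - (\<Sum>l<L'. B f x w v (q + l) * of_real s ^ l)) \<longlongrightarrow> 0) (at_right 0)"
      proof (rule Lim_null_comparison)
        show "eventually (\<lambda>s. norm (dc f (x + s *\<^sub>R w) v q - (\<Sum>l<L'. B f x w v (q + l) * of_real s ^ l)) \<le> C4 * s ^ L') (at_right 0)"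
          unfolding eventually_at_right_field using pos[OF f x w v] \<epsilon> by (intro exI[of _ \<epsilon>]) auto
        have "((\<lambda>s. C4 * s ^ L') \<longlongrightarrow> C4 * 0 ^ L') (at_right (0::real))" by (intro tendsto_intros)
        then show "((\<lambda>s. C4 * s ^ L') \<longlongrightarrow> 0) (at_right (0::real))" by (simp add: L'_def)
      qed
      moreover have "((\<lambda>s. \<Sum>l<L'. B f x w v (q + l) * of_real s ^ l) \<longlongrightarrow> (\<Sum>l<L'. B f x w v (q + l) * of_real 0 ^ l)) (at_right 0)"
        by (intro tendsto_intros)
      moreover have "(\<Sum>l<L'. B f x w v (q + l) * of_real 0 ^ l) = (\<Sum>l\<in>{0}. B f x w v (q + l) * of_real 0 ^ l)"
        by (intro sum.mono_neutral_right) (auto simp: L'_def)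
      ultimately show ?thesis using tendsto_add by (fastforce simp: b_def)
    qed
    define \<epsilon>3 where "\<epsilon>3 = min (\<epsilon>1 / M) (r / (2 * (real M * \<tau> + 1)))"
    have \<epsilon>3: "\<epsilon>3 > 0" using e1 M r \<rho>0 by (auto simp: \<epsilon>3_def intro!: divide_pos_pos add_nonneg_pos)
    have xb: "x \<in> ball x0 r" using x r by simp
    define d where "d l = (if l = q then dc f x v q - b else 0)" for l
    have "d q = 0"
    proof (rule small_poly_eq_0[where M = "Suc q" and L = M and C = "2 * C3", OF \<epsilon>3])
      fix t assume t: "0 < t" "t \<le> \<epsilon>3"
      define g where "g s = (\<Sum>i<M. \<kappa> i * f (x + s *\<^sub>R w + (real i * t) *\<^sub>R v))" for s
      have g: "(g \<longlongrightarrow> (\<Sum>i<M. \<kappa> i * f (x + (real i * t) *\<^sub>R v))) (at_right 0)"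
        unfolding g_def
      proof (intro tendsto_intros)
        fix i assume i: "i \<in> {..<M}"
        have iv: "norm (real i *\<^sub>R v) \<le> real M * \<tau>" using i v by (auto intro!: mult_mono)
        have "x + t *\<^sub>R (real i *\<^sub>R v) \<in> ball x0 r"
          by (rule norm_shift_in_ball[OF x _ _ iv r]) (use t in \<open>auto simp: \<epsilon>3_def\<close>)
        from dc_line_continuous[OF U f this, of w]
        show "((\<lambda>s. f (x + s *\<^sub>R w + (real i * t) *\<^sub>R v)) \<longlongrightarrow> f (x + (real i * t) *\<^sub>R v)) (at_right 0)"
          by (simp add: algebra_simps)
      qed
      have "((\<lambda>s. norm (g s - dc f (x + s *\<^sub>R w) v q * of_real t ^ q)) \<longlongrightarrow>
          norm ((\<Sum>i<M. \<kappa> i * f (x + (real i * t) *\<^sub>R v)) - b * of_real t ^ q)) (at_right 0)"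
        by (intro tendsto_intros g lim)
      moreover have "eventually (\<lambda>s. norm (g s - dc f (x + s *\<^sub>R w) v q * of_real t ^ q) \<le> C3 * t ^ M) (at_right 0)"
        unfolding eventually_at_right_field
      proof (intro exI[of _ \<epsilon>] conjI allI impI \<epsilon>)
        fix s assume s: "0 < s" "s < \<epsilon>"
        have "x + s *\<^sub>R w \<in> ball x0 r" by (rule norm_shift_in_ball[OF x _ _ w r]) (use s in \<open>auto simp: \<epsilon>_def\<close>)
        then show "norm (g s - dc f (x + s *\<^sub>R w) v q * of_real t ^ q) \<le> C3 * t ^ M"
          unfolding g_def using t by (intro sample f v) (auto simp: \<epsilon>3_def)
      qed
      ultimately have 1: "norm ((\<Sum>i<M. \<kappa> i * f (x + (real i * t) *\<^sub>R v)) - b * of_real t ^ q) \<le> C3 * t ^ M"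
        by (intro tendsto_upperbound) auto
      have 2: "norm ((\<Sum>i<M. \<kappa> i * f (x + (real i * t) *\<^sub>R v)) - dc f x v q * of_real t ^ q) \<le> C3 * t ^ M"
        using t by (intro sample f xb v) (auto simp: \<epsilon>3_def)
      have "(dc f x v q - b) * of_real t ^ q = ((\<Sum>i<M. \<kappa> i * f (x + (real i * t) *\<^sub>R v)) - b * of_real t ^ q) -
          ((\<Sum>i<M. \<kappa> i * f (x + (real i * t) *\<^sub>R v)) - dc f x v q * of_real t ^ q)" by (simp add: algebra_simps)
      also have "norm \<dots> \<le> C3 * t ^ M + C3 * t ^ M"
        by (intro order_trans[OF norm_triangle_ineq4] add_mono 1 2)
      finally have fin: "norm ((dc f x v q - b) * of_real t ^ q) \<le> 2 * C3 * t ^ M" by simp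
      have "(\<Sum>l<Suc q. d l * of_real t ^ l) = (\<Sum>l\<in>{q}. d l * of_real t ^ l)"
        by (intro sum.mono_neutral_right) (auto simp: d_def)
      then show "norm (\<Sum>l<Suc q. d l * of_real t ^ l) \<le> 2 * C3 * t ^ M"
        using fin by (simp add: d_def)
    qed (use M in auto)
    then show ?thesis by (simp add: b_def d_def)
  qed
  show "\<exists>L'\<ge>L. \<exists>C \<epsilon>. 0 < \<epsilon> \<and> (\<forall>f\<in>{\<lambda>x. dc f x v q | f v. f \<in> \<Phi> \<and> norm v \<le> \<sigma>}. \<forall>x\<in>ball x0 (r / 2). \<forall>w. norm w \<le> \<rho>0 \<longrightarrow>
     (\<exists>b. (\<forall>l<L'. norm (b l) \<le> C) \<and> expands (\<lambda>s. f (x + s *\<^sub>R w)) L' b C \<epsilon>))"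
  proof (rule exI[of _ L'], rule conjI, goal_cases)
    case 1
    show ?case by (simp add: L'_def)
  next
    case 2
    show ?case
    proof (rule exI[of _ C4], rule exI[of _ \<epsilon>], intro conjI ballI allI impI \<epsilon>)
    fix g x and w :: 'a
    assume "g \<in> {\<lambda>x. dc f x v q | f v. f \<in> \<Phi> \<and> norm v \<le> \<sigma>}" and x: "x \<in> ball x0 (r / 2)" and w0: "norm w \<le> \<rho>0"
    then obtain f v where g: "g = (\<lambda>x. dc f x v q)" and f: "f \<in> \<Phi>" and "norm v \<le> \<sigma>" by blast
    then have v: "norm v \<le> \<tau>" by (simp add: \<tau>_def)
    have w: "norm w \<le> \<rho>" using w0 by (simp add: \<rho>_def)
    have xb: "x \<in> ball x0 r" using x r by simp
    show "\<exists>b. (\<forall>l<L'. norm (b l) \<le> C4) \<and> expands (\<lambda>s. g (x + s *\<^sub>R w)) L' b C4 \<epsilon>"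
    proof (intro exI[of _ "\<lambda>l. B f x w v (q + l)"] conjI allI impI)
      fix l assume "l < L'"
      then have "norm (B f x w v (q + l)) \<le> \<Lambda> * C2" by (intro Bb f xb w v) (auto simp: M_def)
      then show "norm (B f x w v (q + l)) \<le> C4" using C3 by (simp add: C4_def)
    next
      show "expands (\<lambda>s. g (x + s *\<^sub>R w)) L' (\<lambda>l. B f x w v (q + l)) C4 \<epsilon>"
        unfolding expands_def
      proof
        fix s assume s: "s \<in> {0..\<epsilon>}"
        show "norm (g (x + s *\<^sub>R w) - (\<Sum>l<L'. B f x w v (q + l) * of_real s ^ l)) \<le> C4 * s ^ L'"
        proof (cases "s = 0")
          case True
          have "(\<Sum>l<L'. B f x w v (q + l) * of_real 0 ^ l) = (\<Sum>l\<in>{0}. B f x w v (q + l) * of_real 0 ^ l)"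
            by (intro sum.mono_neutral_right) (auto simp: L'_def)
          then show ?thesis using True zero[OF f x w v] by (simp add: g L'_def)
        next
          case False
          then show ?thesis using pos[OF f x w v, of s] s by (simp add: g)
        qed
      qed
    qed
    qed
  qed
qed

section \<open>Smoothness from uniform expansions\<close>

primrec dd :: "'a::real_normed_vector list \<Rightarrow> ('a \<Rightarrow> complex) \<Rightarrow> 'a \<Rightarrow> complex" where
  "dd [] f = f"
| "dd (v # vs) f = (\<lambda>x. dc (dd vs f) x v 1)"

lemma sum_list_norm_nonneg: "0 \<le> (\<Sum>v\<leftarrow>vs. norm (v :: 'a::real_normed_vector))"
  by (rule sum_list_nonneg) auto

lemma dd_append: "dd (us @ vs) f = dd us (dd vs f)"
  by (induction us) auto

text \<open>Each differentiation halves the radius. All lists from a bounded set share one radius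
  and one set of constants; Frechet differentiability will rest on this uniformity.\<close>

lemma unif_exp_dd:
  assumes "unif_exp {f} x0 r"
  shows "\<exists>r'. unif_exp {dd vs f | vs. length vs = k \<and> (\<forall>v\<in>set vs. norm v \<le> \<sigma>)} x0 r'"
proof (induction k)
  case 0
  have "{dd vs f | vs. length vs = 0 \<and> (\<forall>v\<in>set vs. norm v \<le> \<sigma>)} = {f}" by auto
  then show ?case using assms by auto
next
  case (Suc k)
  then obtain r' where r': "unif_exp {dd vs f | vs. length vs = k \<and> (\<forall>v\<in>set vs. norm v \<le> \<sigma>)} x0 r'" by blast
  have eq: "{dd vs f | vs. length vs = Suc k \<and> (\<forall>v\<in>set vs. norm v \<le> \<sigma>)} =
     {\<lambda>x. dc g x v 1 | g v. g \<in> {dd vs f | vs. length vs = k \<and> (\<forall>v\<in>set vs. norm v \<le> \<sigma>)} \<and> norm v \<le> \<sigma>}" (is "?A = ?B")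
  proof (intro equalityI subsetI)
    fix h assume "h \<in> ?A"
    then obtain vs where vs: "h = dd vs f" "length vs = Suc k" "\<forall>v\<in>set vs. norm v \<le> \<sigma>" by blast
    then obtain v us where "vs = v # us" by (cases vs) auto
    with vs show "h \<in> ?B" by auto
  next
    fix h assume "h \<in> ?B"
    then obtain v us where "h = dd (v # us) f" "length us = k" "\<forall>v\<in>set us. norm v \<le> \<sigma>" "norm v \<le> \<sigma>" by auto
    then show "h \<in> ?A" by (intro CollectI exI[of _ "v # us"]) auto
  qed
  show ?case unfolding eq using unif_exp_dc[OF r'] by blast
qed

lemma unif_exp_dd_single:
  assumes "unif_exp {f} x0 r"
  shows "\<exists>r'. unif_exp {dd vs f} x0 r'"
proof -
  define \<sigma> where "\<sigma> = (\<Sum>v\<leftarrow>vs. norm v)"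
  have "\<forall>v\<in>set vs. norm v \<le> \<sigma>"
    unfolding \<sigma>_def by (induction vs) (auto intro: add_increasing add_increasing2 sum_list_norm_nonneg)
  obtain r' where "unif_exp {dd us f | us. length us = length vs \<and> (\<forall>v\<in>set us. norm v \<le> \<sigma>)} x0 r'"
    using unif_exp_dd[OF assms] by blast
  then have "unif_exp {dd vs f} x0 r'"
    by (rule unif_exp_subset) (use \<open>\<forall>v\<in>set vs. _\<close> \<open>unif_exp _ x0 r'\<close> in \<open>auto simp: unif_exp_def\<close>)
  then show ?thesis by blast
qed

section \<open>Iterated differences, symmetry and polarization\<close>

primrec dl :: "'a::real_normed_vector list \<Rightarrow> ('a \<Rightarrow> complex) \<Rightarrow> 'a \<Rightarrow> complex" where
  "dl [] f x = f x"
| "dl (v # vs) f x = dl vs f (x + v) - dl vs f x"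

lemma dl_snoc: "dl (us @ [v]) f x = dl us (\<lambda>y. f (y + v) - f y) x"
  by (induction us arbitrary: x) (auto simp: add_ac)

lemma dl_swap: "dl (us @ v # ws) f x = dl (v # us @ ws) f x"
  by (induction us arbitrary: x) (auto simp: add_ac)

lemma dl_add: "dl vs (\<lambda>y. f y + g y) x = dl vs f x + dl vs g x"
  by (induction vs arbitrary: x) auto

lemma dl_sum: "dl vs (\<lambda>y. \<Sum>i\<in>I. c i * g i y) x = (\<Sum>i\<in>I. c i * dl vs (g i) x)"
  by (induction vs arbitrary: x) (auto simp: sum_subtractf right_diff_distrib)

lemma dl_cong:
  assumes "\<And>u. norm u \<le> (\<Sum>v\<leftarrow>vs. norm v) \<Longrightarrow> f (x + u) = g (x + u)"
  shows "dl vs f x = dl vs g x"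
  using assms
proof (induction vs arbitrary: x)
  case Nil
  from Nil[of 0] show ?case by simp
next
  case (Cons v vs)
  have s: "0 \<le> (\<Sum>v\<leftarrow>vs. norm v)" by (rule sum_list_norm_nonneg)
  have "dl vs f (x + v) = dl vs g (x + v)"
  proof (rule Cons.IH)
    fix u :: 'a assume "norm u \<le> (\<Sum>v\<leftarrow>vs. norm v)"
    then have "norm (v + u) \<le> (\<Sum>v\<leftarrow>v # vs. norm v)" using norm_triangle_ineq[of v u] by simp
    from Cons.prems[OF this] show "f (x + v + u) = g (x + v + u)" by (simp add: add_ac)
  qed
  moreover have "dl vs f x = dl vs g x" using Cons.prems by (intro Cons.IH) (simp add: add_increasing)
  ultimately show ?case by simp
qed

lemma dl_bound:
  assumes "\<And>u. norm u \<le> (\<Sum>v\<leftarrow>vs. norm v) \<Longrightarrow> norm (f (x + u)) \<le> B"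
  shows "norm (dl vs f x) \<le> 2 ^ length vs * B"
  using assms
proof (induction vs arbitrary: x)
  case Nil
  from Nil[of 0] show ?case by simp
next
  case (Cons v vs)
  have "norm (dl vs f (x + v)) \<le> 2 ^ length vs * B"
  proof (rule Cons.IH)
    fix u :: 'a assume "norm u \<le> (\<Sum>v\<leftarrow>vs. norm v)"
    then have "norm (v + u) \<le> (\<Sum>v\<leftarrow>v # vs. norm v)" using norm_triangle_ineq[of v u] by simp
    from Cons.prems[OF this] show "norm (f (x + v + u)) \<le> B" by (simp add: add_ac)
  qed
  moreover have "norm (dl vs f x) \<le> 2 ^ length vs * B"
    using Cons.prems by (intro Cons.IH) (simp add: add_increasing)
  ultimately show ?case
    using norm_triangle_ineq4[of "dl vs f (x + v)" "dl vs f x"] by simp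
qed

lemma dl_scale: "dl (map (\<lambda>v. t *\<^sub>R v) vs) f (x + t *\<^sub>R u) = dl vs (\<lambda>u. f (x + t *\<^sub>R u)) u"
proof (induction vs arbitrary: u)
  case (Cons v vs)
  show ?case using Cons.IH[of "u + v"] Cons.IH[of u] by (simp add: scaleR_add_right add.assoc)
qed simp

text \<open>The last vector acts first. Expanding the innermost difference in t, the term of order 1
  yields the limit by induction, every higher term carries an additional power of t, and the
  remainder t^(k+2) beats the denominator t^(k+1).\<close>

lemma dl_limit:
  assumes "unif_exp {f} x0 r"
  shows "((\<lambda>t. dl (map (\<lambda>v. t *\<^sub>R v) vs) f x0 / of_real t ^ length vs) \<longlongrightarrow> dd vs f x0) (at_right 0)"
  using assms
proof (induction vs arbitrary: f r rule: rev_induct)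
  case Nil
  then show ?case by simp
next
  case (snoc v vs)
  define k where "k = length vs"
  define g where "g l = (\<lambda>y. dc f y v l)" for l
  have r: "r > 0" using snoc.prems by (simp add: unif_exp_def)
  have ug: "unif_exp {g l} x0 (r / 2)" for l
    by (rule unif_exp_subset[OF unif_exp_dc[OF snoc.prems, of l "norm v"]]) (use r in \<open>auto simp: g_def\<close>)
  obtain C \<epsilon> where e: "0 < \<epsilon>" "\<epsilon> \<le> 1" "0 \<le> C"
     "\<And>y. y \<in> ball x0 r \<Longrightarrow> expands (\<lambda>s. f (y + s *\<^sub>R v)) (k + 2) (dc f y v) C \<epsilon>"
    using unif_expE[OF snoc.prems, where L = "k + 2" and \<rho> = "norm v"] by (metis insertI1 order_refl)
  define R where "R t y = f (y + t *\<^sub>R v) - (\<Sum>l<k + 2. dc f y v l * of_real t ^ l)" for t y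
  define S where "S = (\<Sum>v\<leftarrow>vs. norm v)"
  have S: "S \<ge> 0" unfolding S_def by (rule sum_list_norm_nonneg)
  define \<delta> where "\<delta> = min \<epsilon> (r / (2 * (S + 1)))"
  have \<delta>: "\<delta> > 0" using e r S by (simp add: \<delta>_def)
  have eq: "dl (map (\<lambda>v. t *\<^sub>R v) (vs @ [v])) f x0 / of_real t ^ length (vs @ [v]) =
     (\<Sum>l\<in>{1..<k + 2}. of_real t ^ (l - 1) * (dl (map (\<lambda>v. t *\<^sub>R v) vs) (g l) x0 / of_real t ^ k)) +
     dl (map (\<lambda>v. t *\<^sub>R v) vs) (R t) x0 / of_real t ^ (k + 1)"
    if t: "0 < t" "t < \<delta>" for t
  proof -
    have map_norm: "(\<Sum>v\<leftarrow>map (\<lambda>v. t *\<^sub>R v) vs. norm v) = t * S"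
      using t by (simp add: S_def sum_list_const_mult o_def)
    have tS: "t * S < r"
    proof -
      have "t * S \<le> r / (2 * (S + 1)) * (S + 1)" using t S r by (intro mult_mono) (auto simp: \<delta>_def)
      also have "\<dots> = r / 2" using S by (simp add: field_simps)
      finally show ?thesis using r by simp
    qed
    have "dl (map (\<lambda>v. t *\<^sub>R v) (vs @ [v])) f x0 = dl (map (\<lambda>v. t *\<^sub>R v) vs) (\<lambda>y. f (y + t *\<^sub>R v) - f y) x0"
      by (simp add: dl_snoc)
    also have "\<dots> = dl (map (\<lambda>v. t *\<^sub>R v) vs) (\<lambda>y. (\<Sum>l\<in>{1..<k + 2}. of_real t ^ l * g l y) + R t y) x0"
    proof (rule dl_cong, unfold map_norm)
      fix u :: 'a assume u: "norm u \<le> t * S"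
      then have y: "x0 + u \<in> ball x0 r" using tS by (simp add: dist_norm)
      have "(\<Sum>l<k + 2. dc f (x0 + u) v l * of_real t ^ l) = dc f (x0 + u) v 0 + (\<Sum>l\<in>{1..<k + 2}. dc f (x0 + u) v l * of_real t ^ l)"
        by (subst lessThan_atLeast0, subst sum.atLeast_Suc_lessThan) auto
      then show "f (x0 + u + t *\<^sub>R v) - f (x0 + u) = (\<Sum>l\<in>{1..<k + 2}. of_real t ^ l * g l (x0 + u)) + R t (x0 + u)"
        using dc_0[OF snoc.prems _ y, of f v] by (simp add: R_def g_def mult.commute)
    qed
    also have "\<dots> = (\<Sum>l\<in>{1..<k + 2}. of_real t ^ l * dl (map (\<lambda>v. t *\<^sub>R v) vs) (g l) x0) + dl (map (\<lambda>v. t *\<^sub>R v) vs) (R t) x0"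
      by (simp only: dl_add dl_sum)
    finally have d: "dl (map (\<lambda>v. t *\<^sub>R v) (vs @ [v])) f x0 / of_real t ^ (k + 1) =
       (\<Sum>l\<in>{1..<k + 2}. of_real t ^ l * dl (map (\<lambda>v. t *\<^sub>R v) vs) (g l) x0 / of_real t ^ (k + 1)) +
       dl (map (\<lambda>v. t *\<^sub>R v) vs) (R t) x0 / of_real t ^ (k + 1)"
      by (simp only: add_divide_distrib sum_divide_distrib)
    have "of_real t ^ l * X / of_real t ^ (k + 1) = of_real t ^ (l - 1) * (X / of_real t ^ k)"
      if "l \<in> {1..<k + 2}" for l and X :: complex
      using that t by (cases l) auto
    then have "(\<Sum>l\<in>{1..<k + 2}. of_real t ^ l * dl (map (\<lambda>v. t *\<^sub>R v) vs) (g l) x0 / of_real t ^ (k + 1)) =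
       (\<Sum>l\<in>{1..<k + 2}. of_real t ^ (l - 1) * (dl (map (\<lambda>v. t *\<^sub>R v) vs) (g l) x0 / of_real t ^ k))"
      by (intro sum.cong) auto
    with d show ?thesis by (simp add: k_def)
  qed
  have "((\<lambda>t. dl (map (\<lambda>v. t *\<^sub>R v) vs) (R t) x0 / of_real t ^ (k + 1)) \<longlongrightarrow> 0) (at_right 0)"
  proof (rule Lim_null_comparison)
    show "eventually (\<lambda>t. norm (dl (map (\<lambda>v. t *\<^sub>R v) vs) (R t) x0 / of_real t ^ (k + 1)) \<le> 2 ^ k * C * t) (at_right 0)"
      unfolding eventually_at_right_field
    proof (intro exI[of _ \<delta>] conjI allI impI \<delta>)
      fix t assume t: "0 < t" "t < \<delta>"
      have map_norm: "(\<Sum>v\<leftarrow>map (\<lambda>v. t *\<^sub>R v) vs. norm v) = t * S"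
        using t by (simp add: S_def sum_list_const_mult o_def)
      have tS: "t * S < r"
      proof -
        have "t * S \<le> r / (2 * (S + 1)) * (S + 1)" using t S r by (intro mult_mono) (auto simp: \<delta>_def)
        also have "\<dots> = r / 2" using S by (simp add: field_simps)
        finally show ?thesis using r by simp
      qed
      have "norm (dl (map (\<lambda>v. t *\<^sub>R v) vs) (R t) x0) \<le> 2 ^ length (map (\<lambda>v. t *\<^sub>R v) vs) * (C * t ^ (k + 2))"
      proof (rule dl_bound, unfold map_norm)
        fix u :: 'a assume u: "norm u \<le> t * S"
        then have y: "x0 + u \<in> ball x0 r" using tS by (simp add: dist_norm)
        show "norm (R t (x0 + u)) \<le> C * t ^ (k + 2)"
          unfolding R_def using t by (intro expandsD[OF e(4)[OF y]]) (auto simp: \<delta>_def)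
      qed
      then show "norm (dl (map (\<lambda>v. t *\<^sub>R v) vs) (R t) x0 / of_real t ^ (k + 1)) \<le> 2 ^ k * C * t"
        using t by (simp add: norm_divide norm_power norm_mult divide_le_eq k_def mult_ac)
    qed
    have "((\<lambda>t. 2 ^ k * C * t) \<longlongrightarrow> 2 ^ k * C * 0) (at_right (0::real))" by (intro tendsto_intros)
    then show "((\<lambda>t. 2 ^ k * C * t) \<longlongrightarrow> 0) (at_right (0::real))" by simp
  qed
  moreover have "((\<lambda>t. \<Sum>l\<in>{1..<k + 2}. of_real t ^ (l - 1) * (dl (map (\<lambda>v. t *\<^sub>R v) vs) (g l) x0 / of_real t ^ k)) \<longlongrightarrow>
     (\<Sum>l\<in>{1..<k + 2}. of_real 0 ^ (l - 1) * dd vs (g l) x0)) (at_right 0)"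
    unfolding k_def by (intro tendsto_intros snoc.IH[OF ug])
  moreover have "(\<Sum>l\<in>{1..<k + 2}. of_real 0 ^ (l - 1) * dd vs (g l) x0) = (\<Sum>l\<in>{1}. of_real 0 ^ (l - 1) * dd vs (g l) x0)"
    by (intro sum.mono_neutral_right) auto
  ultimately have "((\<lambda>t. (\<Sum>l\<in>{1..<k + 2}. of_real t ^ (l - 1) * (dl (map (\<lambda>v. t *\<^sub>R v) vs) (g l) x0 / of_real t ^ k)) +
     dl (map (\<lambda>v. t *\<^sub>R v) vs) (R t) x0 / of_real t ^ (k + 1)) \<longlongrightarrow> dd vs (g 1) x0 + 0) (at_right 0)"
    by (intro tendsto_add) simp_all
  moreover have "dd vs (g 1) = dd (vs @ [v]) f" by (simp add: dd_append g_def)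
  moreover have "eventually (\<lambda>t. dl (map (\<lambda>v. t *\<^sub>R v) (vs @ [v])) f x0 / of_real t ^ length (vs @ [v]) =
     (\<Sum>l\<in>{1..<k + 2}. of_real t ^ (l - 1) * (dl (map (\<lambda>v. t *\<^sub>R v) vs) (g l) x0 / of_real t ^ k)) +
     dl (map (\<lambda>v. t *\<^sub>R v) vs) (R t) x0 / of_real t ^ (k + 1)) (at_right 0)"
    unfolding eventually_at_right_field using eq \<delta> by blast
  ultimately show ?case by (simp add: tendsto_cong)
qed

text \<open>Difference operators commute exactly, and the limit inherits this symmetry.\<close>

lemma dd_swap:
  assumes "unif_exp {f} x0 r"
  shows "dd (us @ v # ws) f x0 = dd (v # us @ ws) f x0"
proof -
  have eq: "dl (map (\<lambda>v. t *\<^sub>R v) (us @ v # ws)) f x0 = dl (map (\<lambda>v. t *\<^sub>R v) (v # us @ ws)) f x0" for t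
    unfolding map_append list.map by (rule dl_swap)
  have len: "length (us @ v # ws) = length (v # us @ ws)" by simp
  show ?thesis
    by (rule tendsto_unique[OF _ dl_limit[OF assms, of "us @ v # ws", unfolded eq len] dl_limit[OF assms, of "v # us @ ws"]]) simp
qed

text \<open>Polarization by differences: f(x0 + t u) is expanded in t inside the k-fold difference
  in u. By \<open>dl_limit\<close> the difference is O(t^k), so the coefficients below order k
  vanish and dd is the k-fold difference at 0 of the k-th Taylor form. That is a signed sum of 2^k
  values at vectors of norm at most the sum of the norms.\<close>

lemma dd_polarization_bound:
  assumes U: "unif_exp {f} x0 r"
    and \<alpha>: "\<And>w. norm w \<le> (\<Sum>v\<leftarrow>vs. norm v) \<Longrightarrow> norm (dc f x0 w (length vs)) \<le> \<alpha>"
  shows "norm (dd vs f x0) \<le> 2 ^ length vs * \<alpha>"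
proof -
  define k where "k = length vs"
  define S where "S = (\<Sum>v\<leftarrow>vs. norm v)"
  define c where "c l = dl vs (\<lambda>u. dc f x0 u l) 0" for l
  have r: "r > 0" using U by (simp add: unif_exp_def)
  obtain C \<epsilon> where e: "0 < \<epsilon>" "\<epsilon> \<le> 1" "0 \<le> C"
     "\<And>u. norm u \<le> S \<Longrightarrow> expands (\<lambda>s. f (x0 + s *\<^sub>R u)) (k + 1) (dc f x0 u) C \<epsilon>"
    using unif_expE[OF U, where L = "k + 1" and \<rho> = S] r by (metis insertI1 centre_in_ball)
  have approx: "norm (dl (map (\<lambda>v. t *\<^sub>R v) vs) f x0 - (\<Sum>l<k + 1. c l * of_real t ^ l)) \<le> 2 ^ k * C * t ^ (k + 1)"
    if t: "0 < t" "t \<le> \<epsilon>" for t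
  proof -
    define R where "R u = f (x0 + t *\<^sub>R u) - (\<Sum>l<k + 1. dc f x0 u l * of_real t ^ l)" for u
    have "dl (map (\<lambda>v. t *\<^sub>R v) vs) f x0 = dl vs (\<lambda>u. (\<Sum>l<k + 1. of_real t ^ l * dc f x0 u l) + R u) 0"
      using dl_scale[of t vs f x0 0] by (simp add: R_def mult.commute del: sum.lessThan_Suc)
    also have "\<dots> = (\<Sum>l<k + 1. of_real t ^ l * c l) + dl vs R 0"
      unfolding c_def by (simp only: dl_add dl_sum)
    finally have "dl (map (\<lambda>v. t *\<^sub>R v) vs) f x0 - (\<Sum>l<k + 1. c l * of_real t ^ l) = dl vs R 0"
      by (simp add: mult.commute del: sum.lessThan_Suc)
    also have "norm \<dots> \<le> 2 ^ length vs * (C * t ^ (k + 1))"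
    proof (rule dl_bound)
      fix u :: 'a assume "norm u \<le> (\<Sum>v\<leftarrow>vs. norm v)"
      then have "expands (\<lambda>s. f (x0 + s *\<^sub>R u)) (k + 1) (dc f x0 u) C \<epsilon>" by (intro e(4)) (simp add: S_def)
      from expandsD[OF this, of t] t show "norm (R (0 + u)) \<le> C * t ^ (k + 1)"
        unfolding R_def by (simp del: sum.lessThan_Suc power_Suc add: algebra_simps)
    qed
    finally show ?thesis by (simp add: k_def mult.assoc)
  qed
  note lim = dl_limit[OF U, of vs, folded k_def]
  have "eventually (\<lambda>t. norm (dl (map (\<lambda>v. t *\<^sub>R v) vs) f x0 / of_real t ^ k) < norm (dd vs f x0) + 1) (at_right 0)"
    by (rule order_tendstoD(2)[OF tendsto_norm[OF lim]]) simp
  then obtain \<delta> where \<delta>: "\<delta> > 0" "\<And>t. 0 < t \<Longrightarrow> t < \<delta> \<Longrightarrow> norm (dl (map (\<lambda>v. t *\<^sub>R v) vs) f x0 / of_real t ^ k) < norm (dd vs f x0) + 1"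
    unfolding eventually_at_right_field by blast
  define K where "K = norm (dd vs f x0) + 1 + 2 ^ k * C"
  have c0: "c l = 0" if "l < k" for l
  proof (rule small_poly_eq_0[where M = "k + 1" and L = k and \<epsilon> = "min (\<delta> / 2) \<epsilon>" and C = K])
    fix t assume t: "0 < t" "t \<le> min (\<delta> / 2) \<epsilon>"
    have 1: "norm (dl (map (\<lambda>v. t *\<^sub>R v) vs) f x0) \<le> (norm (dd vs f x0) + 1) * t ^ k"
      using \<delta>(2)[of t] t \<delta>(1) by (simp add: norm_divide norm_power divide_less_eq)
    have "2 ^ k * C * t ^ (k + 1) \<le> 2 ^ k * C * t ^ k"
      using t e by (intro mult_left_mono power_decreasing) auto
    moreover have "norm (dl (map (\<lambda>v. t *\<^sub>R v) vs) f x0 - (\<Sum>l<k + 1. c l * of_real t ^ l)) \<le> 2 ^ k * C * t ^ (k + 1)"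
      by (rule approx) (use t in auto)
    moreover have "norm (\<Sum>l<k + 1. c l * of_real t ^ l) \<le> norm (dl (map (\<lambda>v. t *\<^sub>R v) vs) f x0) +
        norm (dl (map (\<lambda>v. t *\<^sub>R v) vs) f x0 - (\<Sum>l<k + 1. c l * of_real t ^ l))"
      using norm_triangle_ineq4[of "dl (map (\<lambda>v. t *\<^sub>R v) vs) f x0" "dl (map (\<lambda>v. t *\<^sub>R v) vs) f x0 - (\<Sum>l<k + 1. c l * of_real t ^ l)"]
      by (simp del: sum.lessThan_Suc)
    ultimately have "norm (\<Sum>l<k + 1. c l * of_real t ^ l) \<le> (norm (dd vs f x0) + 1) * t ^ k + 2 ^ k * C * t ^ k"
      using 1 by linarith
    then show "norm (\<Sum>l<k + 1. c l * of_real t ^ l) \<le> K * t ^ k" by (simp add: K_def algebra_simps del: sum.lessThan_Suc)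
  qed (use that \<delta> e in auto)
  have "((\<lambda>t. dl (map (\<lambda>v. t *\<^sub>R v) vs) f x0 / of_real t ^ k - c k) \<longlongrightarrow> 0) (at_right 0)"
  proof (rule Lim_null_comparison)
    show "eventually (\<lambda>t. norm (dl (map (\<lambda>v. t *\<^sub>R v) vs) f x0 / of_real t ^ k - c k) \<le> 2 ^ k * C * t) (at_right 0)"
      unfolding eventually_at_right_field
    proof (intro exI[of _ \<epsilon>] conjI allI impI e(1))
      fix t assume t: "0 < t" "t < \<epsilon>"
      have "(\<Sum>l<k + 1. c l * of_real t ^ l) = c k * of_real t ^ k" using c0 by simp
      then have "norm (dl (map (\<lambda>v. t *\<^sub>R v) vs) f x0 - c k * of_real t ^ k) \<le> 2 ^ k * C * t ^ (k + 1)"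
        using approx[of t] t by simp
      moreover have "dl (map (\<lambda>v. t *\<^sub>R v) vs) f x0 / of_real t ^ k - c k = (dl (map (\<lambda>v. t *\<^sub>R v) vs) f x0 - c k * of_real t ^ k) / of_real t ^ k"
        using t by (simp add: diff_divide_distrib)
      ultimately show "norm (dl (map (\<lambda>v. t *\<^sub>R v) vs) f x0 / of_real t ^ k - c k) \<le> 2 ^ k * C * t"
        using t by (simp add: norm_divide norm_power divide_le_eq mult_ac)
    qed
    have "((\<lambda>t. 2 ^ k * C * t) \<longlongrightarrow> 2 ^ k * C * 0) (at_right (0::real))" by (intro tendsto_intros)
    then show "((\<lambda>t. 2 ^ k * C * t) \<longlongrightarrow> 0) (at_right (0::real))" by simp
  qed
  then have "dd vs f x0 = c k" using tendsto_unique[OF _ lim] by (simp add: LIM_zero_iff)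
  also have "norm \<dots> \<le> 2 ^ length vs * \<alpha>"
    unfolding c_def using \<alpha> by (intro dl_bound) (simp add: k_def)
  finally show ?thesis .
qed

text \<open>Additivity: go from x0 along u and then along v. The derivative along v at x0 + s u
  differs from that at x0 by O(s), because it has a uniform expansion itself. Expansions are
  one-sided, so reparametrizing s gives positive scalars only; negative ones follow from
  additivity.\<close>

lemma dc_linear:
  assumes U: "unif_exp {f} x0 r"
  shows "linear (\<lambda>v. dc f x0 v 1)"
proof -
  have r: "r > 0" using U by (simp add: unif_exp_def)
  have x0: "x0 \<in> ball x0 r" using r by simp
  have level2: "\<exists>C \<epsilon>. 0 < \<epsilon> \<and> 0 \<le> C \<and> (\<forall>x\<in>ball x0 r. \<forall>s. 0 \<le> s \<and> s \<le> \<epsilon> \<longrightarrow>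
      norm (f (x + s *\<^sub>R w) - (f x + of_real s * dc f x w 1)) \<le> C * s\<^sup>2)" for w
  proof -
    obtain C \<epsilon> where e: "0 < \<epsilon>" "0 \<le> C" "\<And>x. x \<in> ball x0 r \<Longrightarrow> expands (\<lambda>s. f (x + s *\<^sub>R w)) 2 (dc f x w) C \<epsilon>"
      using unif_expE[OF U, where L = 2 and \<rho> = "norm w"] by (metis insertI1 order_refl)
    show ?thesis
    proof (intro exI conjI ballI allI impI, rule e(1), rule e(2))
      fix x s assume x: "x \<in> ball x0 r" and s: "0 \<le> s \<and> s \<le> \<epsilon>"
      from expandsD[OF e(3)[OF x], of s] s dc_0[OF U _ x, of f w]
      show "norm (f (x + s *\<^sub>R w) - (f x + of_real s * dc f x w 1)) \<le> C * s\<^sup>2"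
        by (simp add: numeral_2_eq_2 mult.commute)
    qed
  qed
  have coef1: "dc f x0 w 1 = c" if e: "0 < \<epsilon>" "\<And>s. 0 \<le> s \<Longrightarrow> s \<le> \<epsilon> \<Longrightarrow> norm (f (x0 + s *\<^sub>R w) - (f x0 + of_real s * c)) \<le> C * s\<^sup>2" for w c C \<epsilon>
  proof -
    have "expands (\<lambda>s. f (x0 + s *\<^sub>R w)) 2 (\<lambda>l. if l = 0 then f x0 else c) C \<epsilon>"
      unfolding expands_def using e(2) by (auto simp: numeral_2_eq_2 mult.commute)
    from tcoef_eq[OF this e(1), of 1] show ?thesis by (simp add: dc_def)
  qed
  have zero: "dc f x0 0 1 = 0"
    by (rule coef1[of 1 _ _ 0]) auto
  have scale_pos: "dc f x0 (c *\<^sub>R w) 1 = of_real c * dc f x0 w 1" if c: "c > 0" for c w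
  proof -
    obtain C \<epsilon> where e: "0 < \<epsilon>" "0 \<le> C" "\<And>x s. x \<in> ball x0 r \<Longrightarrow> 0 \<le> s \<Longrightarrow> s \<le> \<epsilon> \<Longrightarrow>
      norm (f (x + s *\<^sub>R w) - (f x + of_real s * dc f x w 1)) \<le> C * s\<^sup>2" using level2[of w] by blast
    show ?thesis
    proof (rule coef1)
      show "0 < \<epsilon> / c" using e c by simp
      fix s assume s: "0 \<le> s" "s \<le> \<epsilon> / c"
      then have "norm (f (x0 + (s * c) *\<^sub>R w) - (f x0 + of_real (s * c) * dc f x0 w 1)) \<le> C * (s * c)\<^sup>2"
        using c by (intro e(3) x0) (auto simp: field_simps)
      then show "norm (f (x0 + s *\<^sub>R c *\<^sub>R w) - (f x0 + of_real s * (of_real c * dc f x0 w 1))) \<le> (C * c\<^sup>2) * s\<^sup>2"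
        by (simp add: mult_ac power_mult_distrib)
    qed
  qed
  have add: "dc f x0 (u + v) 1 = dc f x0 u 1 + dc f x0 v 1" for u v
  proof -
    obtain C1 \<epsilon>1 where e1: "0 < \<epsilon>1" "0 \<le> C1" "\<And>x s. x \<in> ball x0 r \<Longrightarrow> 0 \<le> s \<Longrightarrow> s \<le> \<epsilon>1 \<Longrightarrow>
      norm (f (x + s *\<^sub>R u) - (f x + of_real s * dc f x u 1)) \<le> C1 * s\<^sup>2" using level2[of u] by blast
    obtain C2 \<epsilon>2 where e2: "0 < \<epsilon>2" "0 \<le> C2" "\<And>x s. x \<in> ball x0 r \<Longrightarrow> 0 \<le> s \<Longrightarrow> s \<le> \<epsilon>2 \<Longrightarrow>
      norm (f (x + s *\<^sub>R v) - (f x + of_real s * dc f x v 1)) \<le> C2 * s\<^sup>2" using level2[of v] by blast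
    define g where "g = (\<lambda>x. dc f x v 1)"
    have Ug: "unif_exp {g} x0 (r / 2)"
      by (rule unif_exp_subset[OF unif_exp_dc[OF U, of 1 "norm v"]]) (use r in \<open>auto simp: g_def\<close>)
    obtain C3 \<epsilon>3 where e3: "0 < \<epsilon>3" "0 \<le> C3" "expands (\<lambda>s. g (x0 + s *\<^sub>R u)) 1 (dc g x0 u) C3 \<epsilon>3"
      using unif_expE[OF Ug, where L = 1 and \<rho> = "norm u"] r by (metis centre_in_ball half_gt_zero insertI1 order_refl)
    have g3: "norm (g (x0 + s *\<^sub>R u) - g x0) \<le> C3 * s" if "0 \<le> s" "s \<le> \<epsilon>3" for s
      using expandsD[OF e3(3) that] dc_0[OF Ug, of g x0 u] r by simp
    define \<epsilon> where "\<epsilon> = min (min \<epsilon>1 \<epsilon>2) (min \<epsilon>3 (r / (2 * (norm u + 1))))"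
    have \<epsilon>: "\<epsilon> > 0" using e1 e2 e3 r by (auto simp: \<epsilon>_def intro!: divide_pos_pos add_nonneg_pos)
    show ?thesis
    proof (rule coef1[OF \<epsilon>])
      fix s assume s: "0 \<le> s" "s \<le> \<epsilon>"
      have xs: "x0 + s *\<^sub>R u \<in> ball x0 r"
        by (rule norm_shift_in_ball[where \<rho> = "norm u"]) (use s r in \<open>auto simp: \<epsilon>_def\<close>)
      have 1: "norm (f (x0 + s *\<^sub>R u + s *\<^sub>R v) - (f (x0 + s *\<^sub>R u) + of_real s * g (x0 + s *\<^sub>R u))) \<le> C2 * s\<^sup>2"
        unfolding g_def using s by (intro e2(3) xs) (auto simp: \<epsilon>_def)
      have 2: "norm (f (x0 + s *\<^sub>R u) - (f x0 + of_real s * dc f x0 u 1)) \<le> C1 * s\<^sup>2"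
        using s by (intro e1(3) x0) (auto simp: \<epsilon>_def)
      have 3: "norm (of_real s * (g (x0 + s *\<^sub>R u) - g x0)) \<le> C3 * s\<^sup>2"
        using mult_left_mono[OF g3[of s], of s] s by (simp add: norm_mult \<epsilon>_def power2_eq_square mult_ac)
      have "f (x0 + s *\<^sub>R (u + v)) - (f x0 + of_real s * (dc f x0 u 1 + dc f x0 v 1)) =
         (f (x0 + s *\<^sub>R u + s *\<^sub>R v) - (f (x0 + s *\<^sub>R u) + of_real s * g (x0 + s *\<^sub>R u))) +
         (f (x0 + s *\<^sub>R u) - (f x0 + of_real s * dc f x0 u 1)) + of_real s * (g (x0 + s *\<^sub>R u) - g x0)"
        by (simp add: g_def algebra_simps)
      also have "norm \<dots> \<le> C2 * s\<^sup>2 + C1 * s\<^sup>2 + C3 * s\<^sup>2"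
        by (intro norm_triangle_mono 1 2 3)
      finally show "norm (f (x0 + s *\<^sub>R (u + v)) - (f x0 + of_real s * (dc f x0 u 1 + dc f x0 v 1))) \<le> (C1 + C2 + C3) * s\<^sup>2"
        by (simp add: algebra_simps)
    qed
  qed
  have neg: "dc f x0 (- w) 1 = - dc f x0 w 1" for w
    using add[of w "- w"] zero by (simp add: add_eq_0_iff)
  show ?thesis
  proof (rule linearI)
    fix c :: real and w
    consider "c > 0" | "c = 0" | "c < 0" by linarith
    then show "dc f x0 (c *\<^sub>R w) 1 = c *\<^sub>R dc f x0 w 1"
    proof cases
      case 3
      then show ?thesis using scale_pos[of "- c" w] neg[of "(- c) *\<^sub>R w"] by (simp add: scaleR_conv_of_real)
    qed (use scale_pos zero in \<open>auto simp: scaleR_conv_of_real\<close>)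
  qed (rule add)
qed

section \<open>Multilinear forms and Frechet differentiability\<close>

lemma prod_list_norm_nonneg: "0 \<le> (\<Prod>v\<leftarrow>vs. norm (v :: 'a::real_normed_vector))"
  by (induction vs) auto

text \<open>Homogeneity allows the entries to be normalized one after another; if some entry is 0,
  both sides vanish.\<close>

lemma multilinear_bound:
  fixes T :: "'a::real_normed_vector list \<Rightarrow> complex"
  assumes lin: "\<And>vs i. length vs = k \<Longrightarrow> i < k \<Longrightarrow> linear (\<lambda>v. T (vs[i := v]))"
    and B: "\<And>vs. length vs = k \<Longrightarrow> (\<And>v. v \<in> set vs \<Longrightarrow> norm v \<le> 1) \<Longrightarrow> norm (T vs) \<le> B"
    and vs: "length vs = k"
  shows "norm (T vs) \<le> B * (\<Prod>v\<leftarrow>vs. norm v)"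
proof (cases "0 \<in> set vs")
  case True
  then obtain i where i: "i < k" "vs ! i = 0" using vs by (auto simp: in_set_conv_nth)
  have "T vs = T (vs[i := 0])" using i by (metis list_update_id)
  also have "\<dots> = 0" using linear_0[OF lin[OF vs i(1)]] by simp
  finally have "T vs = 0" .
  moreover have "(\<Prod>v\<leftarrow>vs. norm v) = 0" using True by (auto simp: prod_list_zero_iff image_iff)
  ultimately show ?thesis by simp
next
  case False
  define N where "N v = v /\<^sub>R norm v" for v :: 'a
  have main: "T vs = of_real (\<Prod>v\<leftarrow>take n vs. norm v) * T (map N (take n vs) @ drop n vs)" if "n \<le> k" for n
    using that
  proof (induction n)
    case (Suc n)
    then have n: "n < length vs" using vs by simp
    note dr = Cons_nth_drop_Suc[OF n, symmetric]
    define us where "us = map N (take n vs) @ drop n vs"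
    have us: "length us = k" using vs n by (simp add: us_def)
    have usn: "us[n := N (vs ! n)] = map N (take (Suc n) vs) @ drop (Suc n) vs"
      using n by (simp add: us_def list_update_append take_Suc_conv_app_nth dr)
    have nz: "vs ! n \<noteq> 0" using False n by (metis nth_mem)
    have "us[n := norm (vs ! n) *\<^sub>R N (vs ! n)] = us"
      using nz n by (simp add: N_def us_def list_update_append dr)
    then have "T us = T (us[n := norm (vs ! n) *\<^sub>R N (vs ! n)])" by simp
    also have "\<dots> = norm (vs ! n) *\<^sub>R T (us[n := N (vs ! n)])"
      using linear_cmul[OF lin[OF us, of n]] n vs by simp
    also have "us[n := N (vs ! n)] = map N (take (Suc n) vs) @ drop (Suc n) vs" by (rule usn)
    finally have Tus: "T us = norm (vs ! n) *\<^sub>R T (map N (take (Suc n) vs) @ drop (Suc n) vs)" .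
    have "T vs = of_real (\<Prod>v\<leftarrow>take n vs. norm v) * T us" using Suc by (simp add: us_def)
    also have "\<dots> = of_real ((\<Prod>v\<leftarrow>take n vs. norm v) * norm (vs ! n)) * T (map N (take (Suc n) vs) @ drop (Suc n) vs)"
      unfolding Tus by (simp add: scaleR_conv_of_real)
    also have "(\<Prod>v\<leftarrow>take n vs. norm v) * norm (vs ! n) = (\<Prod>v\<leftarrow>take (Suc n) vs. norm v)"
      using n by (simp add: take_Suc_conv_app_nth)
    finally show ?case .
  qed simp
  have "norm (T (map N vs)) \<le> B"
  proof (rule B)
    have "norm (N v) \<le> 1" for v by (cases "v = 0") (auto simp: N_def)
    then show "norm v \<le> 1" if "v \<in> set (map N vs)" for v using that by auto
  qed (simp add: vs)
  then have "norm (T vs) \<le> (\<Prod>v\<leftarrow>vs. norm v) * B"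
    using main[of k] vs prod_list_norm_nonneg[of vs] by (simp add: norm_mult mult_left_mono)
  then show ?thesis by (simp add: mult.commute)
qed

lemma mnorm_le:
  assumes "0 \<le> B" "\<And>vs. length vs = k \<Longrightarrow> norm (T vs) \<le> B * (\<Prod>v\<leftarrow>vs. norm v)"
  shows "mnorm k T \<le> B"
  unfolding mnorm_def
proof (rule cSUP_least)
  show "{vs :: 'a list. length vs = k} \<noteq> {}" using Ex_list_of_length[of k] by blast
  fix vs :: "'a list" assume "vs \<in> {vs. length vs = k}"
  then show "norm (T vs) / (\<Prod>v\<leftarrow>vs. norm v) \<le> B"
    using assms prod_list_norm_nonneg[of vs] by (cases "(\<Prod>v\<leftarrow>vs. norm v) = 0") (auto simp: divide_le_eq)
qed

lemma mnorm_nonneg: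
  assumes "\<And>vs. length vs = k \<Longrightarrow> norm (T vs) \<le> B * (\<Prod>v\<leftarrow>vs. norm v)"
  shows "0 \<le> mnorm k T"
proof -
  define B' where "B' = max B 0"
  have le: "norm (T vs) / (\<Prod>v\<leftarrow>vs. norm v) \<le> B'" if "length vs = k" for vs
  proof (cases "(\<Prod>v\<leftarrow>vs. norm v) = 0")
    case False
    then have p: "(\<Prod>v\<leftarrow>vs. norm v) > 0" using prod_list_norm_nonneg[of vs] by simp
    have "norm (T vs) \<le> B' * (\<Prod>v\<leftarrow>vs. norm v)"
      using assms[OF that] p by (intro order_trans[OF assms[OF that]] mult_right_mono) (auto simp: B'_def)
    then show ?thesis using p by (simp add: divide_le_eq)
  qed (simp add: B'_def)
  have bdd: "bdd_above ((\<lambda>vs. norm (T vs) / (\<Prod>v\<leftarrow>vs. norm v)) ` {vs. length vs = k})"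
    by (intro bdd_aboveI2[of _ _ B']) (use le in auto)
  obtain vs :: "'a list" where vs: "length vs = k" using Ex_list_of_length by blast
  have "0 \<le> norm (T vs) / (\<Prod>v\<leftarrow>vs. norm v)" using prod_list_norm_nonneg[of vs] by simp
  also have "\<dots> \<le> mnorm k T" unfolding mnorm_def using bdd vs by (intro cSUP_upper) auto
  finally show ?thesis .
qed

definition deriv_form :: "nat \<Rightarrow> ('a::real_normed_vector \<Rightarrow> complex) \<Rightarrow> 'a \<Rightarrow> 'a list \<Rightarrow> complex" where
  "deriv_form k f x = (\<lambda>vs. if length vs = k then dd vs f x else 0)"

lemma deriv_form_linear:
  assumes U: "unif_exp {f} x0 r" and vs: "length vs = k" "i < k"
  shows "linear (\<lambda>v. deriv_form k f x0 (vs[i := v]))"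
proof -
  define us where "us = take i vs @ drop (Suc i) vs"
  have "deriv_form k f x0 (vs[i := v]) = dc (dd us f) x0 v 1" for v
  proof -
    have "deriv_form k f x0 (vs[i := v]) = dd (take i vs @ v # drop (Suc i) vs) f x0"
      using vs by (simp add: deriv_form_def upd_conv_take_nth_drop)
    also have "\<dots> = dd (v # us) f x0" unfolding us_def by (rule dd_swap[OF U])
    finally show ?thesis by simp
  qed
  moreover obtain r' where "unif_exp {dd us f} x0 r'" using unif_exp_dd_single[OF U] by blast
  then have "linear (\<lambda>v. dc (dd us f) x0 v 1)" by (rule dc_linear)
  ultimately show ?thesis by simp
qed

lemma deriv_form_bound_unit:
  assumes U: "unif_exp {f} x0 r"
  shows "\<exists>B. \<forall>vs. length vs = k \<longrightarrow> (\<forall>v\<in>set vs. norm v \<le> 1) \<longrightarrow> norm (dd vs f x0) \<le> B"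
proof -
  obtain r' where U': "unif_exp {dd vs f | vs. length vs = k \<and> (\<forall>v\<in>set vs. norm v \<le> 1)} x0 r'"
    using unif_exp_dd[OF U] by blast
  then have r': "x0 \<in> ball x0 r'" by (simp add: unif_exp_def)
  obtain C \<epsilon> where C: "\<And>g x w l. g \<in> {dd vs f | vs. length vs = k \<and> (\<forall>v\<in>set vs. norm v \<le> 1)} \<Longrightarrow> x \<in> ball x0 r' \<Longrightarrow> norm w \<le> 1 \<Longrightarrow> l < 1 \<Longrightarrow> norm (dc g x w l) \<le> C"
    by (rule unif_expE[OF U', where L = 1 and \<rho> = 1]; rule that; blast)
  show ?thesis
  proof (intro exI allI impI)
    fix vs :: "'a list" assume vs: "length vs = k" "\<forall>v\<in>set vs. norm v \<le> 1"
    then have mem: "dd vs f \<in> {dd vs f | vs. length vs = k \<and> (\<forall>v\<in>set vs. norm v \<le> 1)}" by blast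
    show "norm (dd vs f x0) \<le> C"
      using C[OF mem r', of 0 0] dc_0[OF U' mem r', of 0] by simp
  qed
qed

lemma deriv_form_mlin:
  assumes U: "unif_exp {f} x0 r"
  shows "deriv_form k f x0 \<in> mlin k"
proof -
  obtain B where B: "\<forall>vs. length vs = k \<longrightarrow> (\<forall>v\<in>set vs. norm v \<le> 1) \<longrightarrow> norm (dd vs f x0) \<le> B"
    using deriv_form_bound_unit[OF U, of k] by (elim exE)
  show ?thesis
    unfolding mlin_def mem_Collect_eq
  proof (intro conjI allI impI exI)
    fix vs :: "'a list" assume "length vs \<noteq> k"
    then show "deriv_form k f x0 vs = 0" by (simp add: deriv_form_def)
  next
    fix vs :: "'a list" and i assume "length vs = k \<and> i < k"
    then show "linear (\<lambda>v. deriv_form k f x0 (vs[i := v]))" using deriv_form_linear[OF U] by simp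
  next
    fix vs :: "'a list" assume vs: "length vs = k"
    show "norm (deriv_form k f x0 vs) \<le> B * (\<Prod>v\<leftarrow>vs. norm v)"
    proof (rule multilinear_bound[OF deriv_form_linear[OF U] _ vs])
      fix us :: "'a list" assume "length us = k" "\<And>v. v \<in> set us \<Longrightarrow> norm v \<le> 1"
      then show "norm (deriv_form k f x0 us) \<le> B" using B[rule_format, of us] by (simp add: deriv_form_def)
    qed
  qed
qed

text \<open>For unit vectors us, the function dd us f has an expansion of order 2 along the segment
  from x to y, with one constant for all us. This bounds the remainder form on the unit ball by C |y
  - x|^2, and multilinearity turns that into a bound of its operator norm.\<close>

lemma has_mderiv_deriv_form:
  assumes U: "open U" "\<And>x. x \<in> U \<Longrightarrow> \<exists>r. unif_exp {f} x r" and x: "x \<in> U"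
  shows "has_mderiv k (deriv_form k f) (deriv_form (Suc k) f x) x"
proof -
  obtain r where Ux: "unif_exp {f} x r" using U(2)[OF x] by blast
  have mem: "\<forall>\<^sub>F y in nhds x. deriv_form k f y \<in> mlin k"
    by (rule eventually_mono[OF eventually_nhds_in_open[OF U(1) x]]) (use U(2) deriv_form_mlin in blast)
  obtain r' where U': "unif_exp {dd vs f | vs. length vs = k \<and> (\<forall>v\<in>set vs. norm v \<le> 1)} x r'"
    using unif_exp_dd[OF Ux] by blast
  then have r': "r' > 0" "x \<in> ball x r'" by (simp_all add: unif_exp_def)
  obtain C \<epsilon> where e: "0 < \<epsilon>" "0 \<le> C" "\<And>g y w. g \<in> {dd vs f | vs. length vs = k \<and> (\<forall>v\<in>set vs. norm v \<le> 1)} \<Longrightarrow> y \<in> ball x r' \<Longrightarrow> norm w \<le> 1 \<Longrightarrow>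
     expands (\<lambda>s. g (y + s *\<^sub>R w)) 2 (dc g y w) C \<epsilon>"
    by (rule unif_expE[OF U', where L = 2 and \<rho> = 1]; rule that; blast)
  define T where "T y vs = deriv_form k f y vs - deriv_form k f x vs - deriv_form (Suc k) f x ((y - x) # vs)" for y vs
  have bound: "norm (T y vs) \<le> C * (norm (y - x))\<^sup>2 * (\<Prod>v\<leftarrow>vs. norm v)"
    if y: "y \<in> U" "y \<noteq> x" "norm (y - x) \<le> \<epsilon>" and vs: "length vs = k" for y vs
  proof (rule multilinear_bound[OF _ _ vs])
    fix us :: "'a list" and i assume us: "length us = k" "i < k"
    obtain ry where "unif_exp {f} y ry" using U(2)[OF y(1)] by blast
    then have "linear (\<lambda>v. deriv_form k f y (us[i := v]))" by (rule deriv_form_linear[OF _ us])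
    moreover have "linear (\<lambda>v. deriv_form k f x (us[i := v]))" by (rule deriv_form_linear[OF Ux us])
    moreover have "linear (\<lambda>v. deriv_form (Suc k) f x (((y - x) # us)[Suc i := v]))"
      using us by (intro deriv_form_linear[OF Ux]) auto
    ultimately show "linear (\<lambda>v. T y (us[i := v]))"
      unfolding T_def by (simp add: linear_compose_sub)
  next
    fix us :: "'a list" assume us: "length us = k" "\<And>v. v \<in> set us \<Longrightarrow> norm v \<le> 1"
    define g where "g = dd us f"
    have g: "g \<in> {dd vs f | vs. length vs = k \<and> (\<forall>v\<in>set vs. norm v \<le> 1)}" using us by (auto simp: g_def)
    define s w where "s = norm (y - x)" and "w = (y - x) /\<^sub>R s"
    have s: "s > 0" using y by (simp add: s_def)
    have w: "norm w \<le> 1" "s *\<^sub>R w = y - x" using s by (auto simp: w_def s_def)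
    obtain r'' where Ug: "unif_exp {g} x r''" using unif_exp_dd_single[OF Ux] unfolding g_def by blast
    have "T y us = g y - g x - dc g x (y - x) 1"
      using us by (simp add: T_def deriv_form_def g_def)
    also have "dc g x (y - x) 1 = s *\<^sub>R dc g x w 1"
      unfolding w(2)[symmetric] by (rule linear_cmul[OF dc_linear[OF Ug]])
    also have "g y - g x - \<dots> = g (x + s *\<^sub>R w) - (\<Sum>l<2. dc g x w l * of_real s ^ l)"
      using dc_0[OF U' g r'(2), of w] by (simp add: w(2) numeral_2_eq_2 scaleR_conv_of_real mult.commute)
    also have "norm \<dots> \<le> C * s ^ 2"
      using s y by (intro expandsD[OF e(3)[OF g r'(2) w(1)]]) (auto simp: s_def)
    finally show "norm (T y us) \<le> C * (norm (y - x))\<^sup>2" by (simp add: s_def)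
  qed
  have "((\<lambda>y. mnorm k (T y) / norm (y - x)) \<longlongrightarrow> 0) (at x)"
  proof (rule Lim_null_comparison)
    have "eventually (\<lambda>y. y \<in> U \<and> dist y x < \<epsilon>) (nhds x)"
      using U(1) x e(1) by (intro eventually_conj eventually_nhds_in_open) (auto simp: eventually_nhds_metric)
    then show "\<forall>\<^sub>F y in at x. norm (mnorm k (T y) / norm (y - x)) \<le> C * norm (y - x)"
      unfolding eventually_at_filter
    proof (rule eventually_mono, intro impI)
      fix y assume y: "y \<in> U \<and> dist y x < \<epsilon>" "y \<noteq> x"
      then have b: "norm (T y vs) \<le> C * (norm (y - x))\<^sup>2 * (\<Prod>v\<leftarrow>vs. norm v)" if "length vs = k" for vs
        using that by (intro bound) (auto simp: dist_norm)
      have "mnorm k (T y) \<le> C * (norm (y - x))\<^sup>2" using e(2) b by (intro mnorm_le) auto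
      moreover have "0 \<le> mnorm k (T y)" using b by (rule mnorm_nonneg)
      ultimately show "norm (mnorm k (T y) / norm (y - x)) \<le> C * norm (y - x)"
        using y by (simp add: divide_le_eq power2_eq_square mult.assoc)
    qed
    have "((\<lambda>y. C * norm (y - x)) \<longlongrightarrow> C * norm (x - x)) (at x)" by (intro tendsto_intros)
    then show "((\<lambda>y. C * norm (y - x)) \<longlongrightarrow> 0) (at x)" by simp
  qed
  then show ?thesis
    unfolding has_mderiv_def T_def using mem deriv_form_mlin[OF Ux, of "Suc k"] by simp
qed

lemma has_mderiv_cong:
  assumes "open U" "x \<in> U" "\<And>y. y \<in> U \<Longrightarrow> F y = G y" "has_mderiv k G T x"
  shows "has_mderiv k F T x"
proof -
  have ev: "eventually (\<lambda>y. y \<in> U) (nhds x)" using assms(1,2) by (rule eventually_nhds_in_open)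
  have "\<forall>\<^sub>F y in nhds x. F y \<in> mlin k"
    using assms(4) ev unfolding has_mderiv_def by (auto elim: eventually_elim2 simp: assms(3))
  moreover have "((\<lambda>y. mnorm k (\<lambda>vs. F y vs - F x vs - T ((y - x) # vs)) / norm (y - x)) \<longlongrightarrow> 0) (at x) \<longleftrightarrow>
     ((\<lambda>y. mnorm k (\<lambda>vs. G y vs - G x vs - T ((y - x) # vs)) / norm (y - x)) \<longlongrightarrow> 0) (at x)"
    using ev assms(2,3) by (intro tendsto_cong) (auto simp: eventually_at_filter elim!: eventually_mono)
  ultimately show ?thesis using assms(4) by (simp add: has_mderiv_def)
qed

theorem smooth_on_unif_exp:
  assumes U: "open U" "\<And>x. x \<in> U \<Longrightarrow> \<exists>r. unif_exp {f} x r"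
  shows "smooth_on U f" and "x \<in> U \<Longrightarrow> fderiv k f x = deriv_form k f x"
proof -
  have eq: "\<forall>x\<in>U. fderiv k f x = deriv_form k f x" for k
  proof (induction k)
    case 0
    then show ?case by (auto simp: deriv_form_def fun_eq_iff)
  next
    case (Suc k)
    show ?case
    proof
      fix x assume x: "x \<in> U"
      have "has_mderiv k (fderiv k f) (deriv_form (Suc k) f x) x"
        using Suc by (intro has_mderiv_cong[OF U(1) x _ has_mderiv_deriv_form[OF U x]]) auto
      then show "fderiv (Suc k) f x = deriv_form (Suc k) f x" by (rule fderiv_Suc_eq)
    qed
  qed
  then show "x \<in> U \<Longrightarrow> fderiv k f x = deriv_form k f x" by blast
  show "smooth_on U f"
    unfolding smooth_on_def
    using eq has_mderiv_cong[OF U(1) _ _ has_mderiv_deriv_form[OF U]] by blast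
qed

section \<open>Common roots of two smooth powers\<close>

text \<open>\<phi> l stands for the l-th derivative. The remainder is integrated crudely, without
  the factor 1 / L!, as only its order in s matters.\<close>

lemma taylor_bound:
  fixes \<phi> :: "nat \<Rightarrow> real \<Rightarrow> complex"
  assumes "\<And>l \<tau>. 0 \<le> \<tau> \<Longrightarrow> \<tau> \<le> s \<Longrightarrow> (\<phi> l has_vector_derivative \<phi> (Suc l) \<tau>) (at \<tau>)"
    and "\<And>\<tau>. 0 \<le> \<tau> \<Longrightarrow> \<tau> \<le> s \<Longrightarrow> norm (\<phi> L \<tau>) \<le> B" and "0 \<le> s"
  shows "norm (\<phi> 0 s - (\<Sum>l<L. \<phi> l 0 / fact l * of_real s ^ l)) \<le> B * s ^ L"
  using assms
proof (induction L arbitrary: \<phi> s)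
  case 0
  then show ?case by simp
next
  case (Suc L)
  define \<psi> where "\<psi> \<tau> = \<phi> 0 \<tau> - (\<Sum>l<Suc L. \<phi> l 0 / fact l * of_real \<tau> ^ l)" for \<tau>
  define \<psi>' where "\<psi>' \<tau> = \<phi> 1 \<tau> - (\<Sum>l<L. \<phi> (Suc l) 0 / fact l * of_real \<tau> ^ l)" for \<tau>
  have B: "B \<ge> 0" using Suc.prems(2)[of 0] Suc.prems(3) norm_ge_zero order_trans by blast
  have der: "(\<psi> has_derivative (\<lambda>h. h *\<^sub>R \<psi>' \<tau>)) (at \<tau> within {0..s})" if \<tau>: "\<tau> \<in> {0..s}" for \<tau>
  proof -
    have pw: "((\<lambda>\<tau>. \<phi> l 0 / fact l * of_real \<tau> ^ l) has_vector_derivative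
       \<phi> l 0 / fact l * (of_nat l * of_real \<tau> ^ (l - 1))) (at \<tau>)" for l
    proof -
      have "((\<lambda>\<tau>. of_real (\<tau> ^ l) :: complex) has_vector_derivative of_real (of_nat l * \<tau> ^ (l - 1))) (at \<tau>)"
        by (intro has_vector_derivative_of_real has_real_derivative_iff_has_vector_derivative[THEN iffD1])
           (auto intro!: derivative_eq_intros)
      from has_vector_derivative_mult_right[OF this, of "\<phi> l 0 / fact l"] show ?thesis by simp
    qed
    have "(\<Sum>l<Suc L. \<phi> l 0 / fact l * (of_nat l * of_real \<tau> ^ (l - 1))) = (\<Sum>l<L. \<phi> (Suc l) 0 / fact l * of_real \<tau> ^ l)"
    proof -
      have "\<phi> (Suc l) 0 / fact (Suc l) * (of_nat (Suc l) * of_real \<tau> ^ l) = \<phi> (Suc l) 0 / fact l * of_real \<tau> ^ l" for l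
        unfolding fact_Suc by (simp del: of_nat_Suc)
      then show ?thesis by (subst sum.lessThan_Suc_shift) (simp del: of_nat_Suc fact_Suc)
    qed
    moreover have "(\<psi> has_vector_derivative (\<phi> (Suc 0) \<tau> - (\<Sum>l<Suc L. \<phi> l 0 / fact l * (of_nat l * of_real \<tau> ^ (l - 1))))) (at \<tau>)"
      unfolding \<psi>_def using \<tau> by (intro has_vector_derivative_diff has_vector_derivative_sum pw Suc.prems(1)) auto
    ultimately show ?thesis
      unfolding \<psi>'_def has_vector_derivative_def by (auto intro: has_derivative_at_withinI)
  qed
  have bd: "onorm (\<lambda>h. h *\<^sub>R \<psi>' \<tau>) \<le> B * s ^ L" if \<tau>: "\<tau> \<in> {0..s}" for \<tau>
  proof (rule onorm_le)
    have "norm (\<psi>' \<tau>) \<le> B * \<tau> ^ L"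
      unfolding \<psi>'_def using Suc.IH[of \<tau> "\<lambda>l. \<phi> (Suc l)"] Suc.prems \<tau> by simp
    also have "\<dots> \<le> B * s ^ L" using B \<tau> by (intro mult_left_mono power_mono) auto
    finally have "norm (\<psi>' \<tau>) \<le> B * s ^ L" .
    then show "norm (h *\<^sub>R \<psi>' \<tau>) \<le> B * s ^ L * norm h" for h
      using mult_right_mono[of "norm (\<psi>' \<tau>)" "B * s ^ L" "\<bar>h\<bar>"] by (simp add: mult.commute)
  qed
  have "norm (\<psi> s - \<psi> 0) \<le> B * s ^ L * norm (s - 0)"
    by (rule differentiable_bound[OF _ der bd]) (use Suc.prems(3) in auto)
  moreover have "\<psi> 0 = 0"
    unfolding \<psi>_def by (subst sum.lessThan_Suc_shift) simp
  ultimately show ?case using Suc.prems(3) by (simp add: \<psi>_def mult_ac)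
qed

section \<open>Taylor series of the two powers along lines and their common root\<close>

definition jet :: "('a::real_normed_vector \<Rightarrow> complex) \<Rightarrow> 'a \<Rightarrow> 'a \<Rightarrow> complex fps" where
  "jet g x w = Abs_fps (\<lambda>l. fderiv l g x (replicate l w) / fact l)"

lemma fderiv_mlin:
  assumes "smooth_on U g" "x \<in> U"
  shows "fderiv l g x \<in> mlin l" and "has_mderiv l (fderiv l g) (fderiv (Suc l) g x) x"
proof -
  show *: "has_mderiv l (fderiv l g) (fderiv (Suc l) g x) x" for l
    using assms fderiv_Suc_eq unfolding smooth_on_def by metis
  show "fderiv l g x \<in> mlin l"
    using *[of l] eventually_nhds_x_imp_x unfolding has_mderiv_def by blast
qed

lemma fderiv_le_mnorm:
  assumes "smooth_on U g" "x \<in> U" "length vs = l"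
  shows "norm (fderiv l g x vs) \<le> mnorm l (fderiv l g x) * (\<Prod>v\<leftarrow>vs. norm v)"
proof -
  obtain B where "\<And>vs. length vs = l \<Longrightarrow> norm (fderiv l g x vs) \<le> B * (\<Prod>v\<leftarrow>vs. norm v)"
    using fderiv_mlin(1)[OF assms(1,2), of l] unfolding mlin_def by blast
  from mlin_le_mnorm[of l _ B, OF this assms(3)] show ?thesis .
qed

lemma fderiv_replicate_le:
  assumes "smooth_on U g" "x \<in> U"
  shows "norm (fderiv l g x (replicate l w)) \<le> mnorm l (fderiv l g x) * norm w ^ l"
  using fderiv_le_mnorm[OF assms, of "replicate l w" l] by (simp add: prod_list_replicate)

lemma fderiv_line_derivative:
  assumes "smooth_on U g" "x + \<tau> *\<^sub>R w \<in> U"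
  shows "((\<lambda>\<tau>. fderiv l g (x + \<tau> *\<^sub>R w) (replicate l w)) has_vector_derivative
     fderiv (Suc l) g (x + \<tau> *\<^sub>R w) (replicate (Suc l) w)) (at \<tau>)"
proof -
  let ?T = "fderiv (Suc l) g (x + \<tau> *\<^sub>R w)"
  have 1: "((\<lambda>\<tau>. x + \<tau> *\<^sub>R w) has_derivative (\<lambda>h. h *\<^sub>R w)) (at \<tau>)"
    by (auto intro!: derivative_eq_intros)
  have 2: "((\<lambda>y. fderiv l g y (replicate l w)) has_derivative (\<lambda>h. ?T (h # replicate l w))) (at (x + \<tau> *\<^sub>R w))"
    by (rule mderiv_directional[OF fderiv_mlin(2)[OF assms]]) simp
  have "?T \<in> mlin (Suc l)" by (rule fderiv_mlin(1)[OF assms])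
  then have "\<forall>vs i. length vs = Suc l \<and> i < Suc l \<longrightarrow> linear (\<lambda>v. ?T (vs[i := v]))"
    unfolding mlin_def by blast
  from this[rule_format, of "w # replicate l w" 0] have "linear (\<lambda>h. ?T (h # replicate l w))" by simp
  from linear_cmul[OF this] have "?T (h *\<^sub>R w # replicate l w) = h *\<^sub>R ?T (w # replicate l w)" for h by simp
  with has_derivative_compose[OF 1 2] show ?thesis
    unfolding has_vector_derivative_def by (simp add: replicate_Suc)
qed

lemma jet_expands:
  fixes g :: "'a::real_normed_vector \<Rightarrow> complex"
  assumes g: "smooth_on U g" and r: "r > 0" "ball x0 r \<subseteq> U"
    and A: "\<And>l y. y \<in> ball x0 r \<Longrightarrow> mnorm l (fderiv l g y) \<le> A l"
  shows "\<exists>C\<ge>1. \<forall>x\<in>ball x0 (r / 2). \<forall>w. norm w \<le> \<rho> \<longrightarrow>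
     (\<forall>l<L. norm (fps_nth (jet g x w) l) \<le> C) \<and>
     expands (\<lambda>s. g (x + s *\<^sub>R w)) L (fps_nth (jet g x w)) C (min 1 (r / (2 * (max \<rho> 0 + 1))))"
proof -
  define \<rho>' where "\<rho>' = max \<rho> 0"
  define C where "C = 1 + (\<Sum>l\<le>L. max (A l) 0 * \<rho>' ^ l)"
  have Cl: "max (A l) 0 * \<rho>' ^ l \<le> C" if "l \<le> L" for l
  proof -
    have "max (A l) 0 * \<rho>' ^ l \<le> (\<Sum>l\<le>L. max (A l) 0 * \<rho>' ^ l)"
      using that by (intro member_le_sum) (auto simp: \<rho>'_def)
    then show ?thesis by (simp add: C_def)
  qed
  have val: "norm (fderiv l g y (replicate l w)) \<le> C" if "y \<in> ball x0 r" "norm w \<le> \<rho>" "l \<le> L" for l y w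
  proof -
    have "norm (fderiv l g y (replicate l w)) \<le> mnorm l (fderiv l g y) * norm w ^ l"
      using that r by (intro fderiv_replicate_le[OF g]) auto
    also have "\<dots> \<le> max (A l) 0 * \<rho>' ^ l"
      using A[OF that(1), of l] that(2) by (intro mult_mono power_mono) (auto simp: \<rho>'_def)
    finally show ?thesis using Cl[OF that(3)] by simp
  qed
  have C1: "C \<ge> 1" by (simp add: C_def \<rho>'_def sum_nonneg)
  show ?thesis
  proof (rule exI[of _ C], intro conjI ballI allI impI C1)
    fix x w l assume x: "x \<in> ball x0 (r / 2)" and w: "norm (w :: 'a) \<le> \<rho>" and l: "l < L"
    have "norm (fderiv l g x (replicate l w)) / fact l \<le> C / 1"
      using val[of x w l] x w l r C1 by (intro frac_le) auto
    then show "norm (fps_nth (jet g x w) l) \<le> C" by (simp add: jet_def norm_divide)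
  next
    fix x w assume x: "x \<in> ball x0 (r / 2)" and w: "norm (w :: 'a) \<le> \<rho>"
    have w': "norm w \<le> \<rho>'" using w by (simp add: \<rho>'_def)
    show "expands (\<lambda>s. g (x + s *\<^sub>R w)) L (fps_nth (jet g x w)) C (min 1 (r / (2 * (max \<rho> 0 + 1))))"
      unfolding expands_def \<rho>'_def[symmetric]
    proof
      fix s assume s: "s \<in> {0..min 1 (r / (2 * (\<rho>' + 1)))}"
      have xb: "x + \<tau> *\<^sub>R w \<in> ball x0 r" if "0 \<le> \<tau>" "\<tau> \<le> s" for \<tau>
        by (rule norm_shift_in_ball[OF x _ _ w' r(1)]) (use s that in auto)
      have "norm (fderiv 0 g (x + s *\<^sub>R w) (replicate 0 w) - (\<Sum>l<L. fderiv l g (x + 0 *\<^sub>R w) (replicate l w) / fact l * of_real s ^ l)) \<le> C * s ^ L"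
        by (rule taylor_bound[where \<phi> = "\<lambda>l \<tau>. fderiv l g (x + \<tau> *\<^sub>R w) (replicate l w)"])
           (use s xb r w val in \<open>auto intro!: fderiv_line_derivative[OF g] simp del: fderiv.simps replicate_Suc\<close>)
      then show "norm (g (x + s *\<^sub>R w) - (\<Sum>l<L. fps_nth (jet g x w) l * of_real s ^ l)) \<le> C * s ^ L"
        by (simp add: jet_def)
    qed
  qed
qed

text \<open>Since j and j + 1 are coprime, j divides the subdegree of \<open>G\<close>. After the
  powers of X have been split off, \<open>G'\<close> is invertible and H' / G' is the root: its j-th
  power is G'^(j+1) / G'^j.\<close>

lemma fps_common_root:
  fixes G H :: "'a::field fps"
  assumes j: "j > 0" and GH: "G ^ (j + 1) = H ^ j"
  shows "\<exists>F. F ^ j = G \<and> F ^ (j + 1) = H"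
proof (cases "G = 0")
  case True
  then have "H = 0" using GH j by (simp add: power_0_left)
  then show ?thesis using True j by (intro exI[of _ 0]) (simp add: power_0_left)
next
  case False
  then have H: "H \<noteq> 0" using GH j by (metis power_not_zero zero_power)
  have sd: "(j + 1) * subdegree G = j * subdegree H"
    using arg_cong[OF GH, of subdegree] by (simp only: subdegree_power)
  then have "j dvd (j + 1) * subdegree G" by simp
  moreover have "coprime j (j + 1)" by simp
  ultimately have "j dvd subdegree G" using coprime_dvd_mult_right_iff by blast
  then obtain p where p: "subdegree G = j * p" by blast
  then have p': "subdegree H = (j + 1) * p"
    using sd j by (metis mult.left_commute nat_mult_eq_cancel1)
  define G' H' where "G' = fps_shift (j * p) G" and "H' = fps_shift ((j + 1) * p) H"
  have G: "G = G' * fps_X ^ (j * p)" unfolding G'_def p[symmetric] by (rule subdegree_decompose)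
  have H': "H = H' * fps_X ^ ((j + 1) * p)" unfolding H'_def p'[symmetric] by (rule subdegree_decompose)
  have G'0: "fps_nth G' 0 \<noteq> 0" using nth_subdegree_nonzero[OF False] p by (simp add: G'_def)
  have inv: "G' * inverse G' = 1" using G'0 by (simp add: inverse_mult_eq_1')
  have "(G' ^ (j + 1)) * fps_X ^ (j * p * (j + 1)) = (H' ^ j) * fps_X ^ ((j + 1) * p * j)"
    using GH unfolding G H' power_mult_distrib power_mult[symmetric] .
  moreover have "j * p * (j + 1) = (j + 1) * p * j" by (simp add: algebra_simps)
  ultimately have GH': "G' ^ (j + 1) = H' ^ j" by (metis fps_X_neq_zero mult_right_cancel power_not_zero)
  define F where "F = H' * inverse G' * fps_X ^ p"
  have Fj: "(H' * inverse G') ^ j = G'"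
  proof -
    have "(H' * inverse G') ^ j = G' ^ (j + 1) * inverse G' ^ j" unfolding power_mult_distrib GH' by (rule refl)
    also have "\<dots> = G' * (G' * inverse G') ^ j" by (simp add: power_mult_distrib mult_ac)
    finally show ?thesis by (simp only: inv power_one mult_1_right)
  qed
  have "(H' * inverse G') ^ (j + 1) = H' * inverse G' * (H' * inverse G') ^ j" by simp
  also have "\<dots> = H' * (G' * inverse G')" unfolding Fj by (simp only: mult_ac)
  finally have "(H' * inverse G') ^ (j + 1) = H' * (G' * inverse G')" .
  then have Fj1: "(H' * inverse G') ^ (j + 1) = H'" by (simp only: inv mult_1_right)
  have pw: "F ^ m = (H' * inverse G') ^ m * fps_X ^ (m * p)" for m
    unfolding F_def by (subst power_mult_distrib) (simp only: power_mult[symmetric] mult.commute)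
  have "F ^ j = G" unfolding pw Fj using G by simp
  moreover have "F ^ (j + 1) = H" unfolding pw Fj1 using H' by simp
  ultimately show ?thesis by blast
qed

text \<open>From b^j (a - b) = (a^(j+1) - b^(j+1)) - a (a^j - b^j) and its mirror image, the larger
  of |a|, |b|, raised to the power j, times |a - b| is small; and |a - b| is at most twice that
  larger modulus. The inverse of a \<mapsto> (a^j, a^(j+1)) is thus Hoelder continuous with exponent
  1 / (j + 1).\<close>

lemma common_root_close:
  fixes a b :: complex
  assumes "norm (a ^ j - b ^ j) \<le> \<eta>" "norm (a ^ (j + 1) - b ^ (j + 1)) \<le> \<eta>" "norm a \<le> m" "norm b \<le> m"
  shows "norm (a - b) ^ (j + 1) \<le> 2 ^ j * (1 + m) * \<eta>"
proof -
  have \<eta>: "\<eta> \<ge> 0" using assms(1) norm_ge_zero order_trans by blast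
  have m: "m \<ge> 0" using assms(3) norm_ge_zero order_trans by blast
  have key: "norm b ^ j * norm (a - b) \<le> (1 + m) * \<eta>"
    if "norm (a ^ j - b ^ j) \<le> \<eta>" "norm (a ^ (j + 1) - b ^ (j + 1)) \<le> \<eta>" "norm a \<le> m" for a b :: complex
  proof -
    have "b ^ j * (a - b) = (a ^ (j + 1) - b ^ (j + 1)) - a * (a ^ j - b ^ j)" by (simp add: algebra_simps)
    then have "norm b ^ j * norm (a - b) = norm ((a ^ (j + 1) - b ^ (j + 1)) - a * (a ^ j - b ^ j))"
      by (metis norm_mult norm_power)
    also have "\<dots> \<le> \<eta> + m * \<eta>"
    proof (rule order_trans[OF norm_triangle_ineq4 add_mono])
      show "norm (a * (a ^ j - b ^ j)) \<le> m * \<eta>"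
        unfolding norm_mult using that \<eta> m by (intro mult_mono) auto
    qed (rule that(2))
    finally show ?thesis by (simp add: algebra_simps)
  qed
  define M where "M = max (norm a) (norm b)"
  have "M ^ j * norm (a - b) \<le> (1 + m) * \<eta>"
  proof (cases "norm a \<le> norm b")
    case True
    then show ?thesis using key[OF assms(1-3)] by (simp add: M_def)
  next
    case False
    then show ?thesis using key[of b a] assms by (simp add: M_def norm_minus_commute)
  qed
  moreover have "norm (a - b) \<le> 2 * M" using norm_triangle_ineq4[of a b] by (simp add: M_def)
  then have "norm (a - b) ^ j \<le> 2 ^ j * M ^ j" unfolding power_mult_distrib[symmetric] by (intro power_mono) auto
  then have "norm (a - b) ^ j * norm (a - b) \<le> 2 ^ j * M ^ j * norm (a - b)" by (rule mult_right_mono) simp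
  then have "norm (a - b) ^ (j + 1) \<le> 2 ^ j * M ^ j * norm (a - b)" by (simp add: mult.commute)
  moreover have "2 ^ j * (M ^ j * norm (a - b)) \<le> 2 ^ j * ((1 + m) * \<eta>)"
    by (rule mult_left_mono) (use calculation(1) in auto)
  ultimately show ?thesis unfolding mult.assoc by linarith
qed

text \<open>The second part identifies the Taylor coefficients of f along a line with those of the
  formal root, which makes \<open>jet_bound\<close> applicable to f itself.\<close>

lemma root_expansion:
  fixes f :: "'a::real_normed_vector \<Rightarrow> complex"
  defines "g \<equiv> \<lambda>j x. f x ^ j"
  assumes j: "j > 0" and smooth: "smooth_on U (g j)" "smooth_on U (g (j + 1))"
    and r: "r > 0" "ball x0 r \<subseteq> U"
    and A: "\<And>l y. y \<in> ball x0 r \<Longrightarrow> mnorm l (fderiv l (g j) y) \<le> A l"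
      "\<And>l y. y \<in> ball x0 r \<Longrightarrow> mnorm l (fderiv l (g (j + 1)) y) \<le> A l"
  shows "unif_exp {f} x0 (r / 2)"
    and "\<And>x w. x \<in> ball x0 (r / 2) \<Longrightarrow>
      \<exists>F. F ^ j = jet (g j) x w \<and> F ^ (j + 1) = jet (g (j + 1)) x w \<and> dc f x w = fps_nth F"
proof -
  obtain c0 c where c: "1 \<le> c0" "1 \<le> c" "\<And>(F :: complex fps) B R k. 0 < B \<Longrightarrow> 0 < R \<Longrightarrow>
      (\<And>l. l \<le> 2 * j * (j + 1) * k \<Longrightarrow> norm (fps_nth (F ^ j) l) \<le> B ^ j * R ^ l \<and>
         norm (fps_nth (F ^ (j + 1)) l) \<le> B ^ (j + 1) * R ^ l) \<Longrightarrow>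
      norm (fps_nth F k) \<le> c0 * B * (c * R) ^ k"
    using jet_bound[OF j] by metis
  define ep where "ep \<rho> = min 1 (r / (2 * (max \<rho> 0 + 1)))" for \<rho>
  have ep: "ep \<rho> > 0" "ep \<rho> \<le> 1" for \<rho> using r(1) by (auto simp: ep_def intro!: divide_pos_pos add_nonneg_pos)
  have jets: "\<exists>C\<ge>1. \<forall>x\<in>ball x0 (r / 2). \<forall>w. norm w \<le> \<rho> \<longrightarrow> (\<forall>i\<in>{j, j + 1}.
     (\<forall>l<L. norm (fps_nth (jet (g i) x w) l) \<le> C) \<and>
     expands (\<lambda>s. g i (x + s *\<^sub>R w)) L (fps_nth (jet (g i) x w)) C (ep \<rho>))" for L \<rho>
  proof -
    obtain C1 where C1: "C1 \<ge> 1" "\<forall>x\<in>ball x0 (r / 2). \<forall>w. norm w \<le> \<rho> \<longrightarrow>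
     (\<forall>l<L. norm (fps_nth (jet (g j) x w) l) \<le> C1) \<and>
     expands (\<lambda>s. g j (x + s *\<^sub>R w)) L (fps_nth (jet (g j) x w)) C1 (ep \<rho>)"
      using jet_expands[OF smooth(1) r A(1)] unfolding ep_def by metis
    obtain C2 where C2: "C2 \<ge> 1" "\<forall>x\<in>ball x0 (r / 2). \<forall>w. norm w \<le> \<rho> \<longrightarrow>
     (\<forall>l<L. norm (fps_nth (jet (g (j + 1)) x w) l) \<le> C2) \<and>
     expands (\<lambda>s. g (j + 1) (x + s *\<^sub>R w)) L (fps_nth (jet (g (j + 1)) x w)) C2 (ep \<rho>)"
      using jet_expands[OF smooth(2) r A(2)] unfolding ep_def by metis
    have "norm a \<le> max C1 C2" if "norm a \<le> C1 \<or> norm a \<le> C2" for a :: complex using that by auto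
    moreover have "expands \<phi> L b (max C1 C2) \<epsilon>" if "expands \<phi> L b C1 \<epsilon> \<or> expands \<phi> L b C2 \<epsilon>" for \<phi> b \<epsilon>
      using that expands_mono[of \<phi> L b C1 \<epsilon> "max C1 C2"] expands_mono[of \<phi> L b C2 \<epsilon> "max C1 C2"] by auto
    ultimately show ?thesis
      using C1 C2 by (intro exI[of _ "max C1 C2"] conjI ballI allI impI) (auto simp del: power_Suc)
  qed
  \<comment> \<open>Both jets, raised to the complementary powers, expand the same function f^(j (j
    + 1)) along the line; uniqueness equates them.\<close>
  have pow: "\<exists>F. F ^ j = jet (g j) x w \<and> F ^ (j + 1) = jet (g (j + 1)) x w" if x: "x \<in> ball x0 (r / 2)" for x w
  proof (rule fps_common_root[OF j], rule fps_ext)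
    fix l
    obtain C where C: "C \<ge> 1" "\<And>i. i \<in> {j, j + 1} \<Longrightarrow>
     (\<forall>l'<Suc l. norm (fps_nth (jet (g i) x w) l') \<le> C) \<and>
     expands (\<lambda>s. g i (x + s *\<^sub>R w)) (Suc l) (fps_nth (jet (g i) x w)) C (ep (norm w))"
      using jets[where L = "Suc l" and \<rho> = "norm w"] x by blast
    obtain C1 where C1: "expands (\<lambda>s. g j (x + s *\<^sub>R w) ^ (j + 1)) (Suc l) (fps_nth (jet (g j) x w ^ (j + 1))) C1 (ep (norm w))"
      using expands_power[of "Suc l" C "j + 1"] C(2)[of j] ep[of "norm w"] by blast
    obtain C2 where C2: "expands (\<lambda>s. g (j + 1) (x + s *\<^sub>R w) ^ j) (Suc l) (fps_nth (jet (g (j + 1)) x w ^ j)) C2 (ep (norm w))"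
      using expands_power[of "Suc l" C j] C(2)[of "j + 1"] ep[of "norm w"] by blast
    have "g j y ^ (j + 1) = g (j + 1) y ^ j" for y
      unfolding g_def power_mult[symmetric] by (simp only: mult.commute)
    then show "fps_nth (jet (g j) x w ^ (j + 1)) l = fps_nth (jet (g (j + 1)) x w ^ j) l"
      using expands_unique[OF C1, of _ C2 "ep (norm w)" l] C2 ep by simp
  qed
  have exps: "\<exists>C. \<forall>x\<in>ball x0 (r / 2). \<forall>w. norm w \<le> \<rho> \<longrightarrow> (\<forall>F. F ^ j = jet (g j) x w \<and> F ^ (j + 1) = jet (g (j + 1)) x w \<longrightarrow>
     (\<forall>l<L. norm (fps_nth F l) \<le> C) \<and> expands (\<lambda>s. f (x + s *\<^sub>R w)) L (fps_nth F) C (ep \<rho>))" for L \<rho>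
  proof -
    \<comment> \<open>Extracting the root by \<open>common_root_close\<close> divides the order by j
      + 1. Bounding the coefficients of \<open>F\<close> up to order M by \<open>jet_bound\<close>
      takes jets up to order D M.\<close>
    define M where "M = (j + 1) * L"
    define D where "D = 2 * j * (j + 1)"
    obtain C1 where C1: "C1 \<ge> 1" "\<And>x w i. x \<in> ball x0 (r / 2) \<Longrightarrow> norm w \<le> \<rho> \<Longrightarrow> i \<in> {j, j + 1} \<Longrightarrow>
     (\<forall>l<Suc (D * M). norm (fps_nth (jet (g i) x w) l) \<le> C1) \<and>
     expands (\<lambda>s. g i (x + s *\<^sub>R w)) (Suc (D * M)) (fps_nth (jet (g i) x w)) C1 (ep \<rho>)"
      using jets[where L = "Suc (D * M)" and \<rho> = \<rho>] by blast
    define CF where "CF = c0 * C1 * c ^ M"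
    have CF: "CF \<ge> 1" unfolding CF_def using c(1,2) C1(1) by (intro mult_ge1_I one_le_power) auto
    have "1 \<le> D" using j by (simp add: D_def)
    then have MD: "M \<le> Suc (D * M)" by (metis mult_le_mono1 nat_mult_1 le_SucI)
    define C2 where "C2 = C1 * (real (Suc (D * M)) + 1)"
    have C2: "C2 \<ge> 1" unfolding C2_def using C1(1) by (intro mult_ge1_I) auto
    obtain C3 where C3: "C3 \<ge> 1" "\<And>\<phi> (A :: complex fps) \<epsilon>. expands \<phi> M (fps_nth A) CF \<epsilon> \<Longrightarrow> (\<forall>l<M. norm (fps_nth A l) \<le> CF) \<Longrightarrow> 0 < \<epsilon> \<Longrightarrow> \<epsilon> \<le> 1 \<Longrightarrow>
       expands (\<lambda>s. \<phi> s ^ j) M (fps_nth (A ^ j)) C3 \<epsilon>"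
      using expands_power[of M CF j] by blast
    obtain C4 where C4: "C4 \<ge> 1" "\<And>\<phi> (A :: complex fps) \<epsilon>. expands \<phi> M (fps_nth A) CF \<epsilon> \<Longrightarrow> (\<forall>l<M. norm (fps_nth A l) \<le> CF) \<Longrightarrow> 0 < \<epsilon> \<Longrightarrow> \<epsilon> \<le> 1 \<Longrightarrow>
       expands (\<lambda>s. \<phi> s ^ (j + 1)) M (fps_nth (A ^ (j + 1))) C4 \<epsilon>"
      using expands_power[of M CF "j + 1"] by blast
    define C5 where "C5 = C2 + max C3 C4"
    define m where "m = max (max 1 (A 0)) (real M * CF)"
    define K where "K = max 1 (2 ^ j * (1 + m) * C5)"
    have F_bound: "norm (fps_nth F l) \<le> CF"
      if x: "x \<in> ball x0 (r / 2)" and w: "norm w \<le> \<rho>" and F: "F ^ j = jet (g j) x w" "F ^ (j + 1) = jet (g (j + 1)) x w" and l: "l \<le> M"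
      for x w F l
    proof -
      have "norm (fps_nth F l) \<le> c0 * C1 * (c * 1) ^ l"
      proof (rule c(3))
        fix i assume "i \<le> 2 * j * (j + 1) * l"
        also have "\<dots> \<le> D * M" unfolding D_def using l by (intro mult_left_mono) auto
        finally have "norm (fps_nth (F ^ j) i) \<le> C1" "norm (fps_nth (F ^ (j + 1)) i) \<le> C1"
          unfolding F using C1(2)[OF x w] by auto
        moreover have "C1 \<le> C1 ^ j" "C1 \<le> C1 ^ (j + 1)" using C1(1) j by (auto intro!: self_le_power simp del: power_Suc)
        ultimately show "norm (fps_nth (F ^ j) i) \<le> C1 ^ j * 1 ^ i \<and> norm (fps_nth (F ^ (j + 1)) i) \<le> C1 ^ (j + 1) * 1 ^ i"
          by (simp del: power_Suc)
      qed (use C1(1) in auto)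
      also have "\<dots> \<le> CF" unfolding CF_def using c C1(1) l by (simp add: mult_left_mono power_increasing)
      finally show ?thesis .
    qed
    show ?thesis
    proof (intro exI[of _ "K + real M * CF"] ballI allI impI, elim conjE, intro conjI)
      fix x w F assume x: "x \<in> ball x0 (r / 2)" and w: "norm w \<le> \<rho>" and F: "F ^ j = jet (g j) x w" "F ^ (j + 1) = jet (g (j + 1)) x w"
      have LM: "L \<le> M" by (simp add: M_def)
      have K: "K \<ge> 0" by (simp add: K_def)
      show "\<forall>l<L. norm (fps_nth F l) \<le> K + real M * CF"
      proof (intro allI impI)
        fix l assume "l < L"
        then have "norm (fps_nth F l) \<le> CF" "1 \<le> real M" using F_bound[OF x w F, of l] LM by auto
        then show "norm (fps_nth F l) \<le> K + real M * CF"
          using K CF mult_right_mono[of 1 "real M" CF] by linarith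
      qed
      define P where "P s = (\<Sum>l<M. fps_nth F l * of_real s ^ l)" for s :: real
      have P: "expands P M (fps_nth F) CF (ep \<rho>)" unfolding expands_def P_def using CF by auto
      have Fl: "\<forall>l<M. norm (fps_nth F l) \<le> CF" using F_bound[OF x w F] by simp
      have e: "expands (\<lambda>s. g i (x + s *\<^sub>R w)) M (fps_nth (F ^ i)) C2 (ep \<rho>)" if "i \<in> {j, j + 1}" for i
      proof -
        have "expands (\<lambda>s. g i (x + s *\<^sub>R w)) M (fps_nth (jet (g i) x w)) C2 (ep \<rho>)"
          unfolding C2_def using C1(2)[OF x w that] ep MD by (intro expands_truncate) auto
        then show ?thesis using that F by auto
      qed
      have eP: "expands (\<lambda>s. P s ^ i) M (fps_nth (F ^ i)) (max C3 C4) (ep \<rho>)" if "i \<in> {j, j + 1}" for i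
        using that C3(2)[OF P Fl ep] C4(2)[OF P Fl ep] by (auto intro: expands_mono simp del: power_Suc)
      show "expands (\<lambda>s. f (x + s *\<^sub>R w)) L (fps_nth F) (K + real M * CF) (ep \<rho>)"
        unfolding expands_def
      proof
        fix s assume s: "s \<in> {0..ep \<rho>}"
        then have s1: "0 \<le> s" "s \<le> 1" using ep(2)[of \<rho>] by auto
        define a where "a = f (x + s *\<^sub>R w)"
        have close: "norm (a ^ i - P s ^ i) \<le> C5 * s ^ M" if i: "i \<in> {j, j + 1}" for i
        proof -
          have "norm (a ^ i - P s ^ i) \<le> norm (a ^ i - (\<Sum>l<M. fps_nth (F ^ i) l * of_real s ^ l)) +
             norm (P s ^ i - (\<Sum>l<M. fps_nth (F ^ i) l * of_real s ^ l))"
            using norm_triangle_ineq4[of "a ^ i - (\<Sum>l<M. fps_nth (F ^ i) l * of_real s ^ l)" "P s ^ i - (\<Sum>l<M. fps_nth (F ^ i) l * of_real s ^ l)"] by simp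
          also have "\<dots> \<le> C2 * s ^ M + max C3 C4 * s ^ M"
            using s expandsD[OF e[OF i], of s] expandsD[OF eP[OF i], of s] by (intro add_mono) (auto simp: a_def g_def)
          finally show ?thesis by (simp add: C5_def algebra_simps)
        qed
        have xs: "x + s *\<^sub>R w \<in> ball x0 r"
          by (rule norm_shift_in_ball[where \<rho> = "max \<rho> 0", OF x]) (use s w r in \<open>auto simp: ep_def\<close>)
        have "norm a \<le> max 1 (A 0)"
        proof (rule ccontr)
          assume n: "\<not> ?thesis"
          have "norm (fderiv 0 (g j) (x + s *\<^sub>R w) []) \<le> mnorm 0 (fderiv 0 (g j) (x + s *\<^sub>R w)) * 1"
            using fderiv_le_mnorm[OF smooth(1), of "x + s *\<^sub>R w" "[]" 0] xs r(2) by auto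
          also have "\<dots> \<le> A 0" using A(1)[OF xs, of 0] by simp
          finally have "norm a ^ j \<le> A 0" by (simp add: g_def a_def norm_power)
          moreover have "norm a \<le> norm a ^ j" using n j by (intro self_le_power) auto
          ultimately show False using n by simp
        qed
        then have am: "norm a \<le> m" by (simp add: m_def)
        have "norm (P s) \<le> (\<Sum>l<M. CF)"
          unfolding P_def
        proof (rule sum_norm_le)
          fix l assume "l \<in> {..<M}"
          then have "norm (fps_nth F l) * s ^ l \<le> CF * 1"
            using Fl s1 CF by (intro mult_mono power_le_one) auto
          then show "norm (fps_nth F l * of_real s ^ l) \<le> CF" using s1 by (simp add: norm_mult norm_power)
        qed
        then have Pm: "norm (P s) \<le> m" by (simp add: m_def)
        have "norm (a - P s) ^ (j + 1) \<le> 2 ^ j * (1 + m) * (C5 * s ^ M)"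
          by (rule common_root_close[OF close close am Pm]) auto
        also have "\<dots> \<le> K * s ^ M" using s1 by (simp add: K_def mult.assoc[symmetric] mult_right_mono)
        also have "\<dots> \<le> K ^ (j + 1) * s ^ M" using s1 by (intro mult_right_mono self_le_power) (auto simp: K_def)
        also have "\<dots> = (K * s ^ L) ^ (j + 1)" by (simp only: M_def power_mult_distrib power_mult[symmetric] mult.commute)
        finally have aP: "norm (a - P s) \<le> K * s ^ L"
          using K s1 by (subst (asm) power_mono_iff) auto
        have "(\<Sum>l<M. fps_nth F l * of_real s ^ l) = (\<Sum>l<L. fps_nth F l * of_real s ^ l) + (\<Sum>l\<in>{L..<M}. fps_nth F l * of_real s ^ l)"
          using LM by (metis atLeast0LessThan sum.atLeastLessThan_concat zero_le)
        then have "a - (\<Sum>l<L. fps_nth F l * of_real s ^ l) = (a - P s) + (\<Sum>l\<in>{L..<M}. fps_nth F l * of_real s ^ l)"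
          by (simp add: P_def)
        also have "norm \<dots> \<le> K * s ^ L + (\<Sum>l\<in>{L..<M}. CF * s ^ L)"
        proof (intro norm_triangle_mono aP sum_norm_le)
          fix l assume l: "l \<in> {L..<M}"
          then have "norm (fps_nth F l) * s ^ l \<le> CF * s ^ L"
            using Fl s1 CF by (intro mult_mono power_decreasing) auto
          then show "norm (fps_nth F l * of_real s ^ l) \<le> CF * s ^ L" using s1 by (simp add: norm_mult norm_power)
        qed
        also have "\<dots> \<le> K * s ^ L + real M * (CF * s ^ L)"
          using CF s1 by (intro add_left_mono) (auto intro!: mult_right_mono mult_nonneg_nonneg)
        finally show "norm (f (x + s *\<^sub>R w) - (\<Sum>l<L. fps_nth F l * of_real s ^ l)) \<le> (K + real M * CF) * s ^ L"
          by (simp add: a_def algebra_simps)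
      qed
    qed
  qed
  show "unif_exp {f} x0 (r / 2)"
  proof (rule unif_expI)
    fix L \<rho>
    obtain C where C: "\<And>x w F. x \<in> ball x0 (r / 2) \<Longrightarrow> norm w \<le> \<rho> \<Longrightarrow> F ^ j = jet (g j) x w \<Longrightarrow> F ^ (j + 1) = jet (g (j + 1)) x w \<Longrightarrow>
     (\<forall>l<L. norm (fps_nth F l) \<le> C) \<and> expands (\<lambda>s. f (x + s *\<^sub>R w)) L (fps_nth F) C (ep \<rho>)"
      using exps[where L = L and \<rho> = \<rho>] by blast
    show "\<exists>L'\<ge>L. \<exists>C \<epsilon>. 0 < \<epsilon> \<and> (\<forall>f\<in>{f}. \<forall>x\<in>ball x0 (r / 2). \<forall>w. norm w \<le> \<rho> \<longrightarrow>
     (\<exists>b. (\<forall>l<L'. norm (b l) \<le> C) \<and> expands (\<lambda>s. f (x + s *\<^sub>R w)) L' b C \<epsilon>))"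
    proof (rule exI[of _ L], rule conjI[OF order_refl], rule exI[of _ C], rule exI[of _ "ep \<rho>"], intro conjI ep ballI allI impI)
      fix f' x w assume "f' \<in> {f}" and x: "x \<in> ball x0 (r / 2)" and w: "norm (w :: 'a) \<le> \<rho>"
      then show "\<exists>b. (\<forall>l<L. norm (b l) \<le> C) \<and> expands (\<lambda>s. f' (x + s *\<^sub>R w)) L b C (ep \<rho>)"
        using pow[OF x, of w] C[OF x w] by blast
    qed
  qed (use r in simp)
  fix x and w :: 'a assume x: "x \<in> ball x0 (r / 2)"
  obtain F where F: "F ^ j = jet (g j) x w" "F ^ (j + 1) = jet (g (j + 1)) x w" using pow[OF x] by blast
  have "dc f x w q = fps_nth F q" for q
  proof -
    obtain C where "expands (\<lambda>s. f (x + s *\<^sub>R w)) (Suc q) (fps_nth F) C (ep (norm w))"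
      using exps[where L = "Suc q" and \<rho> = "norm w"] x F by blast
    from tcoef_eq[OF this ep(1), of q] show ?thesis by (simp add: dc_def)
  qed
  then show "\<exists>F. F ^ j = jet (g j) x w \<and> F ^ (j + 1) = jet (g (j + 1)) x w \<and> dc f x w = fps_nth F"
    using F by blast
qed

lemma unif_exp_center:
  assumes "unif_exp \<Phi> x0 r" "0 < r'" "ball x r' \<subseteq> ball x0 r"
  shows "unif_exp \<Phi> x r'"
  unfolding unif_exp_def
proof (intro conjI allI assms(2))
  fix L \<rho>
  obtain C \<epsilon> where "0 < \<epsilon>" "\<epsilon> \<le> 1" "\<forall>f\<in>\<Phi>. \<forall>x\<in>ball x0 r. \<forall>w. norm w \<le> \<rho> \<longrightarrow>
     (\<forall>l<L. norm (dc f x w l) \<le> C) \<and> expands (\<lambda>s. f (x + s *\<^sub>R w)) L (dc f x w) C \<epsilon>"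
    using assms(1) unfolding unif_exp_def by blast
  then show "\<exists>C \<epsilon>. 0 < \<epsilon> \<and> \<epsilon> \<le> 1 \<and> (\<forall>f\<in>\<Phi>. \<forall>x\<in>ball x r'. \<forall>w. norm w \<le> \<rho> \<longrightarrow>
     (\<forall>l<L. norm (dc f x w l) \<le> C) \<and> expands (\<lambda>s. f (x + s *\<^sub>R w)) L (dc f x w) C \<epsilon>)"
    using assms(3) by blast
qed

lemma power_le_exp_fact: "real k ^ k \<le> exp 1 ^ k * fact k"
proof -
  have "real k ^ k /\<^sub>R fact k \<le> (\<Sum>n. real k ^ n /\<^sub>R fact n)"
    using sum_le_suminf[OF summable_exp_generic, of "{k}" "real k"] by simp
  also have "\<dots> = exp (real k)" by (simp add: exp_def)
  also have "\<dots> = exp 1 ^ k" by (simp add: exp_of_nat_mult[symmetric])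
  finally show ?thesis by (simp add: field_simps)
qed

text \<open>Polarizing k unit vectors involves sums of norm up to k, so the Taylor forms are
  estimated for |w| \<le> k. The resulting k^k costs e^k against k!, and polarization costs 2^k;
  hence the constant 2 e c, with c from \<open>jet_bound\<close>.\<close>

theorem joris_local:
  fixes f :: "'a::real_normed_vector \<Rightarrow> complex"
  assumes j: "j > 0"
  shows "\<exists>D C c. 0 < D \<and> 1 \<le> C \<and> 1 \<le> c \<and> (\<forall>U A x0 r. open U \<longrightarrow>
    smooth_on U (\<lambda>x. f x ^ j) \<longrightarrow> smooth_on U (\<lambda>x. f x ^ (j + 1)) \<longrightarrow> 0 < r \<longrightarrow> ball x0 r \<subseteq> U \<longrightarrow>
    (\<forall>l. \<forall>y\<in>ball x0 r. mnorm l (fderiv l (\<lambda>x. f x ^ j) y) \<le> A l \<and>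
       mnorm l (fderiv l (\<lambda>x. f x ^ (j + 1)) y) \<le> A l) \<longrightarrow>
    smooth_on (ball x0 (r / 2)) f \<and>
    (\<forall>x\<in>ball x0 (r / 2). \<forall>k>0. \<forall>B\<ge>1. \<forall>R>0. (\<forall>l\<le>D * k. A l \<le> B * fact l * R ^ l) \<longrightarrow>
       mnorm k (fderiv k f x) \<le> C * B * fact k * (c * R) ^ k))"
proof -
  obtain c0 c where c: "1 \<le> c0" "1 \<le> c" "\<And>(F :: complex fps) B R k. 0 < B \<Longrightarrow> 0 < R \<Longrightarrow>
      (\<And>l. l \<le> 2 * j * (j + 1) * k \<Longrightarrow> norm (fps_nth (F ^ j) l) \<le> B ^ j * R ^ l \<and>
         norm (fps_nth (F ^ (j + 1)) l) \<le> B ^ (j + 1) * R ^ l) \<Longrightarrow>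
      norm (fps_nth F k) \<le> c0 * B * (c * R) ^ k"
    using jet_bound[OF j] by metis
  define D where "D = 2 * j * (j + 1)"
  have main: "smooth_on (ball x0 (r / 2)) f \<and>
    (\<forall>x\<in>ball x0 (r / 2). \<forall>k>0. \<forall>B\<ge>1. \<forall>R>0. (\<forall>l\<le>D * k. A l \<le> B * fact l * R ^ l) \<longrightarrow>
       mnorm k (fderiv k f x) \<le> c0 * B * fact k * (2 * exp 1 * c * R) ^ k)"
    if U: "open U" and sm: "smooth_on U (\<lambda>x. f x ^ j)" "smooth_on U (\<lambda>x. f x ^ (j + 1))"
      and r: "0 < r" "ball x0 r \<subseteq> U"
      and A: "\<forall>l. \<forall>y\<in>ball x0 r. mnorm l (fderiv l (\<lambda>x. f x ^ j) y) \<le> A l \<and>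
         mnorm l (fderiv l (\<lambda>x. f x ^ (j + 1)) y) \<le> A l" for U A x0 r
  proof -
    note re = root_expansion[OF j sm r, of A]
    have ux: "\<exists>r'. unif_exp {f} x r'" if x: "x \<in> ball x0 (r / 2)" for x
    proof -
      have U0: "unif_exp {f} x0 (r / 2)" using re(1) A by blast
      define r' where "r' = r / 2 - dist x0 x"
      have r': "r' > 0" using x by (simp add: r'_def)
      have "ball x r' \<subseteq> ball x0 (r / 2)"
      proof
        fix y assume "y \<in> ball x r'"
        then show "y \<in> ball x0 (r / 2)" using dist_triangle[of x0 y x] by (simp add: r'_def)
      qed
      then have "unif_exp {f} x r'" by (rule unif_exp_center[OF U0 r'])
      then show ?thesis by blast
    qed
    note sm' = smooth_on_unif_exp[OF open_ball ux]
    have "mnorm k (fderiv k f x) \<le> c0 * B * fact k * (2 * exp 1 * c * R) ^ k"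
      if x: "x \<in> ball x0 (r / 2)" and k: "k > 0" and B: "B \<ge> 1" and R: "R > 0" and AB: "\<forall>l\<le>D * k. A l \<le> B * fact l * R ^ l" for x k B R
    proof -
      obtain r' where Ux: "unif_exp {f} x r'" using ux[OF x] by blast
      have xb: "x \<in> ball x0 r" using x r by simp
      have xU: "x \<in> U" using xb r(2) by blast
      have dcb: "norm (dc f x w k) \<le> c0 * B * (c * (real k * R)) ^ k" if w: "norm w \<le> real k" for w
      proof -
        obtain F where F: "F ^ j = jet (\<lambda>x. f x ^ j) x w" "F ^ (j + 1) = jet (\<lambda>x. f x ^ (j + 1)) x w" "dc f x w = fps_nth F"
          using re(2)[OF _ _ x, of w] A by blast
        have "norm (fps_nth F k) \<le> c0 * B * (c * (real k * R)) ^ k"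
        proof (rule c(3))
          fix l assume "l \<le> 2 * j * (j + 1) * k"
          then have Al: "A l \<le> B * fact l * R ^ l" using AB by (simp add: D_def)
          have jb: "norm (fps_nth (jet g x w) l) \<le> B * (real k * R) ^ l"
            if g: "smooth_on U g" "mnorm l (fderiv l g x) \<le> A l" for g
          proof -
            have "norm (fderiv l g x (replicate l w)) \<le> mnorm l (fderiv l g x) * norm w ^ l"
              by (rule fderiv_replicate_le[OF g(1) xU])
            also have "\<dots> \<le> (B * fact l * R ^ l) * real k ^ l"
              using g(2) Al w B R by (intro mult_mono power_mono) auto
            finally show ?thesis by (simp add: jet_def norm_divide divide_le_eq power_mult_distrib mult_ac)
          qed
          \<comment> \<open>\<open>jet_bound\<close> expects B^j and B^(j+1), while both jets are
            bounded with the same factor B; here B \<ge> 1 enters.\<close>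
          have Bp: "B \<le> B ^ j" "B \<le> B ^ (j + 1)" using B j by (auto intro!: self_le_power simp del: power_Suc)
          have kR: "0 \<le> (real k * R) ^ l" using R by simp
          have "norm (fps_nth (F ^ j) l) \<le> B * (real k * R) ^ l" unfolding F using A xb by (intro jb sm) auto
          moreover have "norm (fps_nth (F ^ (j + 1)) l) \<le> B * (real k * R) ^ l" unfolding F using A xb by (intro jb sm) auto
          ultimately show "norm (fps_nth (F ^ j) l) \<le> B ^ j * (real k * R) ^ l \<and> norm (fps_nth (F ^ (j + 1)) l) \<le> B ^ (j + 1) * (real k * R) ^ l"
            using mult_right_mono[OF Bp(1) kR] mult_right_mono[OF Bp(2) kR] by linarith
        qed (use B R k in auto)
        then show ?thesis by (simp add: F(3))
      qed
      have unit: "norm (dd vs f x) \<le> 2 ^ k * (c0 * B * (c * (real k * R)) ^ k)"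
        if vs: "length vs = k" "\<And>v. v \<in> set vs \<Longrightarrow> norm v \<le> 1" for vs
      proof -
        have "(\<Sum>v\<leftarrow>vs. norm v) \<le> real (length vs)" using vs(2) by (induction vs) (auto intro!: add_mono)
        then show ?thesis using dd_polarization_bound[OF Ux, of vs] dcb vs(1) by auto
      qed
      have fd: "fderiv k f x = deriv_form k f x" by (rule sm'(2)[OF _ x])
      have "mnorm k (fderiv k f x) \<le> 2 ^ k * (c0 * B * (c * (real k * R)) ^ k)"
      proof (rule mnorm_le)
        show "0 \<le> 2 ^ k * (c0 * B * (c * (real k * R)) ^ k)" using c B R by simp
        fix vs :: "'a list" assume vs: "length vs = k"
        show "norm (fderiv k f x vs) \<le> 2 ^ k * (c0 * B * (c * (real k * R)) ^ k) * (\<Prod>v\<leftarrow>vs. norm v)"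
          unfolding fd
        proof (rule multilinear_bound[OF deriv_form_linear[OF Ux] _ vs])
          fix us :: "'a list" assume "length us = k" "\<And>v. v \<in> set us \<Longrightarrow> norm v \<le> 1"
          then show "norm (deriv_form k f x us) \<le> 2 ^ k * (c0 * B * (c * (real k * R)) ^ k)"
            using unit[of us] by (simp add: deriv_form_def)
        qed
      qed
      also have "\<dots> = c0 * B * (2 * c * R) ^ k * real k ^ k" by (simp add: power_mult_distrib mult_ac)
      also have "\<dots> \<le> c0 * B * (2 * c * R) ^ k * (exp 1 ^ k * fact k)"
        using c B R by (intro mult_left_mono power_le_exp_fact) auto
      also have "\<dots> = c0 * B * fact k * (2 * exp 1 * c * R) ^ k" by (simp add: power_mult_distrib mult_ac)
      finally show ?thesis .
    qed
    then show ?thesis using sm'(1) by blast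
  qed
  have 1: "0 < D" using j by (simp add: D_def)
  have 2: "1 \<le> 2 * exp 1 * c" using c(2) exp_ge_add_one_self[of 1] by (intro mult_ge1_I) auto
  show ?thesis
    by (rule exI[of _ D], rule exI[of _ c0], rule exI[of _ "2 * exp 1 * c"],
        intro conjI[OF 1] conjI[OF c(1)] conjI[OF 2] allI impI, rule main)
qed

section \<open>Classes of smooth functions defined by weights\<close>

lemma compact_insert_limit_range:
  fixes y :: "nat \<Rightarrow> 'a::topological_space"
  assumes "y \<longlonglongrightarrow> l"
  shows "compact (insert l (range y))"
proof (rule compactI)
  fix C assume C: "\<forall>t\<in>C. open t" "insert l (range y) \<subseteq> \<Union>C"
  then obtain T where T: "T \<in> C" "l \<in> T" by blast
  then have "\<forall>\<^sub>F n in sequentially. y n \<in> T" using assms C(1) by (auto dest: topological_tendstoD)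
  then obtain n0 where n0: "\<And>n. n \<ge> n0 \<Longrightarrow> y n \<in> T" unfolding eventually_sequentially by blast
  have "\<forall>n. \<exists>c. c \<in> C \<and> y n \<in> c" using C(2) by blast
  then obtain c where c: "\<And>n. c n \<in> C" "\<And>n. y n \<in> c n" by metis
  have "insert l (range y) \<subseteq> \<Union>(insert T (c ` {..<n0}))"
  proof -
    have "y n \<in> \<Union>(insert T (c ` {..<n0}))" for n 
      by (cases "n < n0") (use n0[of n] c(2)[of n] in auto)
    then show ?thesis using T(2) by blast
  qed
  then show "\<exists>C'\<subseteq>C. finite C' \<and> insert l (range y) \<subseteq> \<Union>C'"
    using T(1) c(1) by (intro exI[of _ "insert T (c ` {..<n0})"]) auto
qed

text \<open>Diagonal argument: otherwise each ball of radius r / (n + 1) around x0 contains a point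
  y n violating the bound with factor n and weight v n. These points together with their limit x0
  form a compact set, on which the assumption gives some bound, a contradiction for large n.\<close>

lemma local_bound_of_compact_bound:
  fixes N :: "nat \<Rightarrow> 'a::metric_space \<Rightarrow> real" and v :: "nat \<Rightarrow> nat \<Rightarrow> real"
  assumes U: "open U" "x0 \<in> U"
    and v: "\<And>n k. 0 < v n k" "\<And>n m k. n \<le> m \<Longrightarrow> v n k \<le> v m k"
    and K: "\<And>K. compact K \<Longrightarrow> K \<subseteq> U \<Longrightarrow> \<exists>n A. \<forall>x\<in>K. \<forall>k. N k x \<le> A * v n k"
  shows "\<exists>r>0. \<exists>n A. ball x0 r \<subseteq> U \<and> 0 \<le> A \<and> (\<forall>x\<in>ball x0 r. \<forall>k. N k x \<le> A * v n k)"
proof (rule ccontr)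
  assume neg: "\<not> ?thesis"
  obtain r where r: "r > 0" "ball x0 r \<subseteq> U" using U open_contains_ball by blast
  have "\<exists>y\<in>ball x0 (r / real (Suc n)). \<exists>k. N k y > real n * v n k" for n
  proof (rule ccontr)
    assume n: "\<not> ?thesis"
    have "r / real (Suc n) > 0" using r(1) by simp
    moreover have "ball x0 (r / real (Suc n)) \<subseteq> U"
      using r by (intro order_trans[OF subset_ball r(2)]) (simp add: divide_le_eq mult_le_cancel_left1)
    ultimately show False using neg n by (metis not_less of_nat_0_le_iff)
  qed
  then obtain y where y: "\<And>n. y n \<in> ball x0 (r / real (Suc n))" "\<And>n. \<exists>k. N k (y n) > real n * v n k" by metis
  have "y \<longlonglongrightarrow> x0"
  proof (rule metric_LIMSEQ_I)
    fix e :: real assume e: "e > 0"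
    obtain n0 where n0: "r / e < real n0" using reals_Archimedean2 by blast
    show "\<exists>n0. \<forall>n\<ge>n0. dist (y n) x0 < e"
    proof (intro exI allI impI)
      fix n assume n: "n0 \<le> n"
      have "dist (y n) x0 < r / real (Suc n)" using y(1)[of n] by (simp add: dist_commute)
      also have "\<dots> < e"
      proof -
        have "r < real n0 * e" using n0 e by (simp add: divide_less_eq)
        also have "\<dots> \<le> real (Suc n) * e" using n e by (intro mult_right_mono) auto
        finally show ?thesis by (simp add: divide_less_eq mult.commute)
      qed
      finally show "dist (y n) x0 < e" .
    qed
  qed
  then have "compact (insert x0 (range y))" by (rule compact_insert_limit_range)
  moreover have "insert x0 (range y) \<subseteq> U"
  proof -
    have "y n \<in> ball x0 r" for n
    proof -
      have "r / real (Suc n) \<le> r / 1" using r(1) by (intro divide_left_mono) auto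
      then show ?thesis using y(1)[of n] by simp
    qed
    then show ?thesis using r(2) U(2) by blast
  qed
  ultimately have "\<exists>n A. \<forall>x\<in>insert x0 (range y). \<forall>k. N k x \<le> A * v n k" by (rule K)
  then obtain n A where "\<forall>x\<in>insert x0 (range y). \<forall>k. N k x \<le> A * v n k" by (elim exE)
  then have A: "N k x \<le> A * v n k" if "x \<in> insert x0 (range y)" for x k using that by blast
  obtain m0 where m0: "real m0 \<ge> A" using real_arch_simple by blast
  define m where "m = max m0 n"
  have m: "real m \<ge> A" "m \<ge> n" using m0 by (auto simp: m_def)
  obtain k where k: "N k (y m) > real m * v m k" using y(2) by blast
  have "N k (y m) \<le> A * v n k" by (rule A) simp
  also have "\<dots> \<le> real m * v n k" using m v(1)[of n k] by (intro mult_right_mono) auto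
  also have "\<dots> \<le> real m * v m k" using v(2)[OF m(2)] by (intro mult_left_mono) auto
  finally show False using k by simp
qed

lemma compact_bound_of_local_bound:
  fixes N :: "nat \<Rightarrow> 'a::metric_space \<Rightarrow> real" and v :: "nat \<Rightarrow> nat \<Rightarrow> real"
  assumes v: "\<And>n k. 0 < v n k" "\<And>n m k. n \<le> m \<Longrightarrow> v n k \<le> v m k"
    and loc: "\<And>x. x \<in> K \<Longrightarrow> \<exists>r>0. \<exists>n A. \<forall>y\<in>ball x r. \<forall>k. N k y \<le> A * v n k"
    and K: "compact K"
  shows "\<exists>n A. \<forall>x\<in>K. \<forall>k. N k x \<le> A * v n k"
proof -
  obtain r n A where r: "\<And>x. x \<in> K \<Longrightarrow> r x > 0" "\<And>x y k. x \<in> K \<Longrightarrow> y \<in> ball x (r x) \<Longrightarrow> N k y \<le> A x * v (n x) k"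
    using loc by metis
  have "K \<subseteq> (\<Union>x\<in>K. ball x (r x))" using r(1) by fastforce
  then obtain F where F: "F \<subseteq> K" "finite F" "K \<subseteq> (\<Union>x\<in>F. ball x (r x))"
    using compactE_image[OF K, of K "\<lambda>x. ball x (r x)"] by blast
  define m where "m = Max (insert 0 (n ` F))"
  define B where "B = Max (insert 0 (A ` F))"
  show ?thesis
  proof (intro exI ballI allI)
    fix x k assume "x \<in> K"
    then obtain p where p: "p \<in> F" "x \<in> ball p (r p)" using F(3) by blast
    have "N k x \<le> A p * v (n p) k" using r(2) p F(1) by blast
    also have "\<dots> \<le> B * v (n p) k" using F(2) p v(1)[of "n p" k] by (intro mult_right_mono) (auto simp: B_def)
    also have "\<dots> \<le> B * v m k" using F(2) p by (intro mult_left_mono v(2)) (auto simp: B_def m_def)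
    finally show "N k x \<le> B * v m k" .
  qed
qed

definition deriv_bounded :: "(nat \<Rightarrow> real) \<Rightarrow> 'a::real_normed_vector set \<Rightarrow> ('a \<Rightarrow> complex) \<Rightarrow> bool" where
  "deriv_bounded w S f \<longleftrightarrow> (\<exists>A. \<forall>x\<in>S. \<forall>k. mnorm k (fderiv k f x) \<le> A * w k)"

text \<open>The constant \<open>C\<close> is uniform, while the radius \<open>R\<close> may depend on the order \<open>k\<close> of the derivative:
  this is what makes the condition satisfiable for nonanalytic weights.\<close>

definition dominates :: "nat \<Rightarrow> real \<Rightarrow> (nat \<Rightarrow> real) \<Rightarrow> (nat \<Rightarrow> real) \<Rightarrow> bool" where
  "dominates D c w w' \<longleftrightarrow> (\<exists>C>0. \<forall>k>0. \<exists>R>0. (\<forall>l\<le>D * k. w l \<le> C * fact l * R ^ l) \<and> fact k * (c * R) ^ k \<le> C * w' k)"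

lemma joris_deriv_bounded:
  fixes f :: "'a::real_normed_vector \<Rightarrow> complex"
  assumes j: "j > 0"
  shows "\<exists>D c. 1 \<le> c \<and> (\<forall>U x0 r w. open U \<longrightarrow>
    smooth_on U (\<lambda>x. f x ^ j) \<longrightarrow> smooth_on U (\<lambda>x. f x ^ (j + 1)) \<longrightarrow> 0 < r \<longrightarrow> ball x0 r \<subseteq> U \<longrightarrow> (\<forall>k. 0 < w k) \<longrightarrow>
    deriv_bounded w (ball x0 r) (\<lambda>x. f x ^ j) \<longrightarrow> deriv_bounded w (ball x0 r) (\<lambda>x. f x ^ (j + 1)) \<longrightarrow>
    smooth_on (ball x0 (r / 2)) f \<and>
    (\<forall>w'. (\<forall>k. 0 < w' k) \<longrightarrow> dominates D c w w' \<longrightarrow> deriv_bounded w' (ball x0 (r / 2)) f))"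
proof -
  obtain D C0 c where J: "0 < D" "1 \<le> C0" "1 \<le> c" "\<forall>U A x0 r. open U \<longrightarrow>
    smooth_on U (\<lambda>x. f x ^ j) \<longrightarrow> smooth_on U (\<lambda>x. f x ^ (j + 1)) \<longrightarrow> 0 < r \<longrightarrow> ball x0 r \<subseteq> U \<longrightarrow>
    (\<forall>l. \<forall>y\<in>ball x0 r. mnorm l (fderiv l (\<lambda>x. f x ^ j) y) \<le> A l \<and>
       mnorm l (fderiv l (\<lambda>x. f x ^ (j + 1)) y) \<le> A l) \<longrightarrow>
    smooth_on (ball x0 (r / 2)) f \<and>
    (\<forall>x\<in>ball x0 (r / 2). \<forall>k>0. \<forall>B\<ge>1. \<forall>R>0. (\<forall>l\<le>D * k. A l \<le> B * fact l * R ^ l) \<longrightarrow>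
       mnorm k (fderiv k f x) \<le> C0 * B * fact k * (c * R) ^ k)"
    using joris_local[OF j, of f] by (elim exE conjE)
  have "smooth_on (ball x0 (r / 2)) f \<and>
      (\<forall>w'. (\<forall>k. 0 < w' k) \<longrightarrow> dominates D c w w' \<longrightarrow> deriv_bounded w' (ball x0 (r / 2)) f)"
    if U: "open U" and sm: "smooth_on U (\<lambda>x. f x ^ j)" "smooth_on U (\<lambda>x. f x ^ (j + 1))"
      and r: "0 < r" "ball x0 r \<subseteq> U" and w: "\<forall>k. 0 < w k"
      and b: "deriv_bounded w (ball x0 r) (\<lambda>x. f x ^ j)" "deriv_bounded w (ball x0 r) (\<lambda>x. f x ^ (j + 1))"
    for U x0 r w
  proof -
    obtain A1 A2 where A12: "\<And>x k. x \<in> ball x0 r \<Longrightarrow> mnorm k (fderiv k (\<lambda>x. f x ^ j) x) \<le> A1 * w k"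
      "\<And>x k. x \<in> ball x0 r \<Longrightarrow> mnorm k (fderiv k (\<lambda>x. f x ^ (j + 1)) x) \<le> A2 * w k"
      using b unfolding deriv_bounded_def by blast
    define A where "A = max 0 (max A1 A2)"
    have A: "A \<ge> 0" by (simp add: A_def)
    have w0: "0 \<le> w k" for k using w less_imp_le by blast
    have "A1 * w k \<le> A * w k" "A2 * w k \<le> A * w k" for k
      using w0[of k] by (auto intro!: mult_right_mono simp: A_def)
    then have bound: "\<forall>l. \<forall>y\<in>ball x0 r. mnorm l (fderiv l (\<lambda>x. f x ^ j) y) \<le> A * w l \<and>
       mnorm l (fderiv l (\<lambda>x. f x ^ (j + 1)) y) \<le> A * w l"
      using A12 order_trans by blast
    note res = J(4)[THEN spec[of _ U], THEN spec[of _ "\<lambda>l. A * w l"], THEN spec[of _ x0], THEN spec[of _ r],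
        THEN mp, OF U, THEN mp, OF sm(1), THEN mp, OF sm(2), THEN mp, OF r(1), THEN mp, OF r(2), THEN mp, OF bound]
    have "deriv_bounded w' (ball x0 (r / 2)) f" if w': "\<forall>k. 0 < w' k" and dom: "dominates D c w w'" for w'
    proof -
      obtain C where C: "C > 0" "\<And>k. k > 0 \<Longrightarrow> \<exists>R>0. (\<forall>l\<le>D * k. w l \<le> C * fact l * R ^ l) \<and> fact k * (c * R) ^ k \<le> C * w' k"
        using dom unfolding dominates_def by blast
      define B where "B = max 1 (A * C)"
      \<comment> \<open>The second entry serves order 0, which the estimate of
        \<open>joris_local\<close> leaves out: there |f| \<le> max 1 (|f|^j).\<close>
      define A' where "A' = max (C0 * B * C) (max 1 (A * w 0) / w' 0)"
      show ?thesis
        unfolding deriv_bounded_def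
      proof (intro exI[of _ A'] ballI allI)
        fix x k assume x: "x \<in> ball x0 (r / 2)"
        then have xb: "x \<in> ball x0 r" using r by simp
        show "mnorm k (fderiv k f x) \<le> A' * w' k"
        proof (cases "k = 0")
          case True
          have "norm (fderiv 0 (\<lambda>x. f x ^ j) x []) \<le> mnorm 0 (fderiv 0 (\<lambda>x. f x ^ j) x) * 1"
            using fderiv_le_mnorm[OF sm(1), of x "[]" 0] xb r(2) by auto
          also have "\<dots> \<le> A * w 0"
            unfolding mult_1_right using bound xb by blast
          finally have fj: "norm (f x) ^ j \<le> A * w 0" by (simp add: norm_power)
          have fx: "norm (f x) \<le> max 1 (A * w 0)"
          proof (rule ccontr)
            assume n: "\<not> ?thesis"
            then have "norm (f x) \<le> norm (f x) ^ j" using j by (intro self_le_power) auto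
            then show False using n fj by simp
          qed
          have "mnorm 0 (fderiv 0 f x) \<le> norm (f x)"
            by (rule mnorm_le) auto
          also have "\<dots> \<le> max 1 (A * w 0)" by (rule fx)
          also have "\<dots> = max 1 (A * w 0) / w' 0 * w' 0" using w'[rule_format, of 0] by simp
          also have "\<dots> \<le> A' * w' 0" using w'[rule_format, of 0] by (intro mult_right_mono) (auto simp: A'_def)
          finally show ?thesis using True by simp
        next
          case False
          then obtain R where R: "R > 0" "\<And>l. l \<le> D * k \<Longrightarrow> w l \<le> C * fact l * R ^ l" "fact k * (c * R) ^ k \<le> C * w' k"
            using C(2)[of k] by blast
          have "A * w l \<le> B * fact l * R ^ l" if "l \<le> D * k" for l
          proof -
            have "A * w l \<le> A * (C * fact l * R ^ l)" using R(2)[OF that] A by (rule mult_left_mono)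
            also have "\<dots> = A * C * (fact l * R ^ l)" by (simp add: mult_ac)
            also have "\<dots> \<le> B * (fact l * R ^ l)" using R(1) by (intro mult_right_mono) (auto simp: B_def)
            finally show ?thesis by (simp add: mult_ac)
          qed
          then have "mnorm k (fderiv k f x) \<le> C0 * B * fact k * (c * R) ^ k"
            using res[THEN conjunct2, rule_format, OF x, of k B R] False R(1) by (simp add: B_def)
          also have "\<dots> = C0 * B * (fact k * (c * R) ^ k)" by (simp add: mult_ac)
          also have "\<dots> \<le> C0 * B * (C * w' k)" using R(3) J(2) by (intro mult_left_mono) (auto simp: B_def)
          also have "\<dots> = C0 * B * C * w' k" by (simp add: mult_ac)
          also have "\<dots> \<le> A' * w' k" using w'[rule_format, of k] by (intro mult_right_mono) (auto simp: A'_def)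
          finally show ?thesis .
        qed
      qed
    qed
    then show ?thesis using res by blast
  qed
  note main = this
  show ?thesis
    by (rule exI[of _ D], rule exI[of _ c], rule conjI[OF J(3)], intro allI impI, rule main; assumption)
qed

lemma smooth_on_local:
  assumes "\<And>x. x \<in> U \<Longrightarrow> \<exists>r>0. smooth_on (ball x r) f"
  shows "smooth_on U f"
  unfolding smooth_on_def
proof (intro allI ballI)
  fix k x assume "x \<in> U"
  then obtain r where "r > 0" "smooth_on (ball x r) f" using assms by blast
  then show "\<exists>T. has_mderiv k (fderiv k f) T x" unfolding smooth_on_def by (meson centre_in_ball)
qed

text \<open>The increasing sequence \<open>v\<close>, cofinal in \<open>W\<close>, is what the
  diagonal argument needs to obtain one weight on a ball. It is used again to combine the finitely
  many local weights on a compact set.\<close>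

theorem joris_Roumieu:
  fixes f :: "'a::real_normed_vector \<Rightarrow> complex" and v :: "nat \<Rightarrow> nat \<Rightarrow> real"
  assumes j: "j > 0" and U: "open U"
    and W: "\<And>w. w \<in> W \<Longrightarrow> \<forall>k. 0 < w k"
    and v: "\<And>n. v n \<in> W" "\<And>n m k. n \<le> m \<Longrightarrow> v n k \<le> v m k"
    and cofinal: "\<And>w. w \<in> W \<Longrightarrow> \<exists>n. \<exists>C\<ge>0. \<forall>k. w k \<le> C * v n k"
    and dom: "\<And>D c w. 1 \<le> c \<Longrightarrow> w \<in> W \<Longrightarrow> \<exists>w'\<in>W. dominates D c w w'"
    and sm: "smooth_on U (\<lambda>x. f x ^ j)" "smooth_on U (\<lambda>x. f x ^ (j + 1))"
    and b: "\<And>K. compact K \<Longrightarrow> K \<subseteq> U \<Longrightarrow> \<exists>w\<in>W. deriv_bounded w K (\<lambda>x. f x ^ j)"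
      "\<And>K. compact K \<Longrightarrow> K \<subseteq> U \<Longrightarrow> \<exists>w\<in>W. deriv_bounded w K (\<lambda>x. f x ^ (j + 1))"
  shows "smooth_on U f" and "\<And>K. compact K \<Longrightarrow> K \<subseteq> U \<Longrightarrow> \<exists>w\<in>W. deriv_bounded w K f"
proof -
  obtain D c where J: "1 \<le> c" "\<And>U x0 r w. open U \<Longrightarrow>
    smooth_on U (\<lambda>x. f x ^ j) \<Longrightarrow> smooth_on U (\<lambda>x. f x ^ (j + 1)) \<Longrightarrow> 0 < r \<Longrightarrow> ball x0 r \<subseteq> U \<Longrightarrow> \<forall>k. 0 < w k \<Longrightarrow>
    deriv_bounded w (ball x0 r) (\<lambda>x. f x ^ j) \<Longrightarrow> deriv_bounded w (ball x0 r) (\<lambda>x. f x ^ (j + 1)) \<Longrightarrow>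
    smooth_on (ball x0 (r / 2)) f \<and>
    (\<forall>w'. (\<forall>k. 0 < w' k) \<longrightarrow> dominates D c w w' \<longrightarrow> deriv_bounded w' (ball x0 (r / 2)) f)"
    using joris_deriv_bounded[OF j, of f] by (elim exE conjE) blast
  have vp: "0 < v n k" for n k using W v(1) by blast
  have cof: "\<exists>n A. \<forall>x\<in>K. \<forall>k. mnorm k (fderiv k g x) \<le> A * v n k"
    if w: "w \<in> W" "deriv_bounded w K g" for w K and g :: "'a \<Rightarrow> complex"
  proof -
    obtain A where A: "\<And>x k. x \<in> K \<Longrightarrow> mnorm k (fderiv k g x) \<le> A * w k" using w(2) unfolding deriv_bounded_def by blast
    obtain n C where C: "C \<ge> 0" "\<And>k. w k \<le> C * v n k" using cofinal[OF w(1)] by blast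
    show ?thesis
    proof (intro exI ballI allI)
      fix x k assume x: "x \<in> K"
      have "mnorm k (fderiv k g x) \<le> A * w k" using A[OF x] .
      also have "\<dots> \<le> max A 0 * w k" using W[OF w(1), rule_format, of k] by (intro mult_right_mono) auto
      also have "\<dots> \<le> max A 0 * (C * v n k)" using C(2)[of k] by (intro mult_left_mono) auto
      finally show "mnorm k (fderiv k g x) \<le> max A 0 * C * v n k" by (simp add: mult.assoc)
    qed
  qed
  have local: "\<exists>r>0. smooth_on (ball x r) f \<and> (\<exists>n A. \<forall>y\<in>ball x r. \<forall>k. mnorm k (fderiv k f y) \<le> A * v n k)" if x: "x \<in> U" for x
  proof -
    obtain r1 n1 A1 where 1: "r1 > 0" "ball x r1 \<subseteq> U" "0 \<le> A1" "\<And>y k. y \<in> ball x r1 \<Longrightarrow> mnorm k (fderiv k (\<lambda>x. f x ^ j) y) \<le> A1 * v n1 k"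
      using local_bound_of_compact_bound[OF U x, of v "\<lambda>k y. mnorm k (fderiv k (\<lambda>x. f x ^ j) y)"] vp v(2) b(1) cof by metis
    obtain r2 n2 A2 where 2: "r2 > 0" "ball x r2 \<subseteq> U" "0 \<le> A2" "\<And>y k. y \<in> ball x r2 \<Longrightarrow> mnorm k (fderiv k (\<lambda>x. f x ^ (j + 1)) y) \<le> A2 * v n2 k"
      using local_bound_of_compact_bound[OF U x, of v "\<lambda>k y. mnorm k (fderiv k (\<lambda>x. f x ^ (j + 1)) y)"] vp v(2) b(2) cof by metis
    define r n where "r = min r1 r2" and "n = max n1 n2"
    have r: "r > 0" "ball x r \<subseteq> U" using 1 2 by (auto simp: r_def)
    have "deriv_bounded (v n) (ball x r) (\<lambda>x. f x ^ j)"
      unfolding deriv_bounded_def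
    proof (intro exI[of _ A1] ballI allI)
      fix y k assume y: "y \<in> ball x r"
      then have "mnorm k (fderiv k (\<lambda>x. f x ^ j) y) \<le> A1 * v n1 k" by (intro 1) (simp add: r_def)
      also have "\<dots> \<le> A1 * v n k" using 1(3) by (intro mult_left_mono v(2)) (auto simp: n_def)
      finally show "mnorm k (fderiv k (\<lambda>x. f x ^ j) y) \<le> A1 * v n k" .
    qed
    moreover have "deriv_bounded (v n) (ball x r) (\<lambda>x. f x ^ (j + 1))"
      unfolding deriv_bounded_def
    proof (intro exI[of _ A2] ballI allI)
      fix y k assume y: "y \<in> ball x r"
      then have "mnorm k (fderiv k (\<lambda>x. f x ^ (j + 1)) y) \<le> A2 * v n2 k" by (intro 2) (simp add: r_def)
      also have "\<dots> \<le> A2 * v n k" using 2(3) by (intro mult_left_mono v(2)) (auto simp: n_def)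
      finally show "mnorm k (fderiv k (\<lambda>x. f x ^ (j + 1)) y) \<le> A2 * v n k" .
    qed
    ultimately have db: "deriv_bounded (v n) (ball x r) (\<lambda>x. f x ^ j)" "deriv_bounded (v n) (ball x r) (\<lambda>x. f x ^ (j + 1))" .
    note res = J(2)[OF U sm r _ db]
    obtain w' where w': "w' \<in> W" "dominates D c (v n) w'" using dom[OF J(1) v(1)] by blast
    have "deriv_bounded w' (ball x (r / 2)) f" using res w' W vp by blast
    then show ?thesis using cof[OF w'(1)] res vp r(1) by (intro exI[of _ "r / 2"]) auto
  qed
  show "smooth_on U f" by (rule smooth_on_local) (use local in blast)
  fix K assume K: "compact K" "K \<subseteq> U"
  have "\<exists>n A. \<forall>x\<in>K. \<forall>k. mnorm k (fderiv k f x) \<le> A * v n k"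
    by (rule compact_bound_of_local_bound[OF _ _ _ K(1)]) (use vp v(2) local K(2) in blast)+
  then show "\<exists>w\<in>W. deriv_bounded w K f" unfolding deriv_bounded_def using v(1) by blast
qed

text \<open>The target weight w' is prescribed and the starting weight w is chosen for it. A single
  weight is used at a time, so the constant sequence takes the place of a cofinal one.\<close>

theorem joris_Beurling:
  fixes f :: "'a::real_normed_vector \<Rightarrow> complex"
  assumes j: "j > 0" and U: "open U"
    and W: "\<And>w. w \<in> W \<Longrightarrow> \<forall>k. 0 < w k" "W \<noteq> {}"
    and dom: "\<And>D c w'. 1 \<le> c \<Longrightarrow> w' \<in> W \<Longrightarrow> \<exists>w\<in>W. dominates D c w w'"
    and sm: "smooth_on U (\<lambda>x. f x ^ j)" "smooth_on U (\<lambda>x. f x ^ (j + 1))"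
    and b: "\<And>K w. compact K \<Longrightarrow> K \<subseteq> U \<Longrightarrow> w \<in> W \<Longrightarrow> deriv_bounded w K (\<lambda>x. f x ^ j)"
      "\<And>K w. compact K \<Longrightarrow> K \<subseteq> U \<Longrightarrow> w \<in> W \<Longrightarrow> deriv_bounded w K (\<lambda>x. f x ^ (j + 1))"
  shows "smooth_on U f" and "\<And>K w. compact K \<Longrightarrow> K \<subseteq> U \<Longrightarrow> w \<in> W \<Longrightarrow> deriv_bounded w K f"
proof -
  obtain D c where J: "1 \<le> c" "\<And>U x0 r w. open U \<Longrightarrow>
    smooth_on U (\<lambda>x. f x ^ j) \<Longrightarrow> smooth_on U (\<lambda>x. f x ^ (j + 1)) \<Longrightarrow> 0 < r \<Longrightarrow> ball x0 r \<subseteq> U \<Longrightarrow> \<forall>k. 0 < w k \<Longrightarrow>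
    deriv_bounded w (ball x0 r) (\<lambda>x. f x ^ j) \<Longrightarrow> deriv_bounded w (ball x0 r) (\<lambda>x. f x ^ (j + 1)) \<Longrightarrow>
    smooth_on (ball x0 (r / 2)) f \<and>
    (\<forall>w'. (\<forall>k. 0 < w' k) \<longrightarrow> dominates D c w w' \<longrightarrow> deriv_bounded w' (ball x0 (r / 2)) f)"
    using joris_deriv_bounded[OF j, of f] by (elim exE conjE) blast
  have local: "\<exists>r>0. smooth_on (ball x r) f \<and> deriv_bounded w' (ball x r) f" if x: "x \<in> U" and w': "w' \<in> W" for x w'
  proof -
    obtain w where w: "w \<in> W" "dominates D c w w'" using dom[OF J(1) w'] by blast
    have lb: "\<exists>r>0. ball x r \<subseteq> U \<and> deriv_bounded w (ball x r) g" if g: "\<And>K. compact K \<Longrightarrow> K \<subseteq> U \<Longrightarrow> deriv_bounded w K g" for g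
      using local_bound_of_compact_bound[OF U x, of "\<lambda>_. w" "\<lambda>k y. mnorm k (fderiv k g y)"] W(1)[OF w(1), rule_format] g
      unfolding deriv_bounded_def by blast
    obtain r1 where 1: "r1 > 0" "ball x r1 \<subseteq> U" "deriv_bounded w (ball x r1) (\<lambda>x. f x ^ j)" using lb[OF b(1)[OF _ _ w(1)]] by blast
    obtain r2 where 2: "r2 > 0" "ball x r2 \<subseteq> U" "deriv_bounded w (ball x r2) (\<lambda>x. f x ^ (j + 1))" using lb[OF b(2)[OF _ _ w(1)]] by blast
    define r where "r = min r1 r2"
    have r: "r > 0" "ball x r \<subseteq> U" using 1 2 by (auto simp: r_def)
    have "deriv_bounded w (ball x r) (\<lambda>x. f x ^ j)" "deriv_bounded w (ball x r) (\<lambda>x. f x ^ (j + 1))"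
      using 1(3) 2(3) unfolding deriv_bounded_def r_def by (fastforce simp del: power_Suc)+
    from J(2)[OF U sm r _ this] W(1)[OF w(1), rule_format] W(1)[OF w', rule_format] w(2) r(1) show ?thesis
      by (intro exI[of _ "r / 2"]) auto
  qed
  show "smooth_on U f" by (rule smooth_on_local) (use local W(2) in blast)
  fix K w assume K: "compact K" "K \<subseteq> U" and w: "w \<in> W"
  have "\<exists>(n::nat) A. \<forall>x\<in>K. \<forall>k. mnorm k (fderiv k f x) \<le> A * w k"
    by (rule compact_bound_of_local_bound[where v = "\<lambda>_. w", OF _ _ _ K(1)])
       (use W(1)[OF w, rule_format] local[OF _ w] K(2) in \<open>auto simp: deriv_bounded_def, blast\<close>)
  then show "deriv_bounded w K f" unfolding deriv_bounded_def by blast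
qed

section \<open>Weight matrices\<close>

lemma SUP_ennreal_finite_iff:
  "(SUP x\<in>K. SUP k. ennreal (a x k)) < \<infinity> \<longleftrightarrow> (\<exists>A. \<forall>x\<in>K. \<forall>k. a x k \<le> A)"
proof
  assume "(SUP x\<in>K. SUP k. ennreal (a x k)) < \<infinity>"
  then obtain A where A: "A \<ge> 0" "(SUP x\<in>K. SUP k. ennreal (a x k)) = ennreal A"
    by (cases "SUP x\<in>K. SUP k. ennreal (a x k)") auto
  have "a x k \<le> A" if x: "x \<in> K" for x k
  proof -
    have "ennreal (a x k) \<le> (SUP k. ennreal (a x k))" by (rule SUP_upper) simp
    also have "\<dots> \<le> ennreal A" unfolding A(2)[symmetric] by (rule SUP_upper[OF x])
    finally show ?thesis using A(1) by (simp add: ennreal_le_iff)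
  qed
  then show "\<exists>A. \<forall>x\<in>K. \<forall>k. a x k \<le> A" by blast
next
  assume "\<exists>A. \<forall>x\<in>K. \<forall>k. a x k \<le> A"
  then obtain A where "\<And>x k. x \<in> K \<Longrightarrow> a x k \<le> A" by blast
  then have "(SUP x\<in>K. SUP k. ennreal (a x k)) \<le> ennreal A" by (intro SUP_least ennreal_leI)
  also have "\<dots> < \<infinity>" by simp
  finally show "(SUP x\<in>K. SUP k. ennreal (a x k)) < \<infinity>" .
qed

lemma seminorm_M_finite_iff:
  assumes "\<And>k. 0 < M k" "0 < \<rho>"
  shows "seminorm_M M K \<rho> f < \<infinity> \<longleftrightarrow> deriv_bounded (\<lambda>k. \<rho> ^ k * M k) K f"
  using assms unfolding seminorm_M_def SUP_ennreal_finite_iff deriv_bounded_def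
  by (simp add: divide_le_eq)

lemma seminorm_w_finite_iff:
  "seminorm_w \<omega> K \<rho> f < \<infinity> \<longleftrightarrow> deriv_bounded (\<lambda>k. exp (phi_conj \<omega> (\<rho> * real k) / \<rho>)) K f"
  unfolding seminorm_w_def SUP_ennreal_finite_iff deriv_bounded_def
  by (simp add: exp_minus field_simps)

section \<open>Log-convexity and the Gamma condition\<close>

text \<open>The logarithm of \<open>a\<close> is convex and at most 0 at index 0, so (log a k) / k
  increases. Powers in place of roots include index 0.\<close>

lemma log_convex_power_le:
  fixes a :: "nat \<Rightarrow> real"
  assumes pos: "\<And>k. 0 < a k" and "a 0 \<le> 1" and lc: "\<And>k. (a (Suc k))\<^sup>2 \<le> a k * a (Suc (Suc k))"
    and lk: "l \<le> k"
  shows "a l ^ k \<le> a k ^ l"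
proof -
  have step: "a k ^ Suc k \<le> a (Suc k) ^ k" for k
  proof (induction k)
    case 0 then show ?case using assms(2) by simp
  next
    case (Suc k)
    \<comment> \<open>Both sides of the claim are multiplied by \<open>a (Suc k) ^ k\<close>, which
      the induction hypothesis produces on the right and which cancels at the end.\<close>
    have "a (Suc k) ^ k * a (Suc k) ^ Suc (Suc k) = ((a (Suc k))\<^sup>2) ^ Suc k"
      unfolding power_add[symmetric] power_mult[symmetric] by (simp add: mult_2)
    also have "\<dots> \<le> (a k * a (Suc (Suc k))) ^ Suc k" using lc by (intro power_mono) auto
    also have "\<dots> = a k ^ Suc k * a (Suc (Suc k)) ^ Suc k" by (rule power_mult_distrib)
    also have "\<dots> \<le> a (Suc k) ^ k * a (Suc (Suc k)) ^ Suc k"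
      using Suc.IH less_imp_le[OF pos] by (intro mult_right_mono zero_le_power) auto
    finally show ?case using pos[of "Suc k"] by (simp del: power_Suc)
  qed
  show ?thesis
    using lk
  proof (induction k rule: dec_induct)
    case base show ?case by simp
  next
    case (step k)
    show ?case
    proof (cases "k = 0")
      case True then show ?thesis using step assms(2) by simp
    next
      case False
      have "(a l ^ Suc k) ^ k = (a l ^ k) ^ Suc k" unfolding power_mult[symmetric] by (simp only: mult.commute)
      also have "\<dots> \<le> (a k ^ l) ^ Suc k" using step.IH less_imp_le[OF pos] by (intro power_mono zero_le_power) auto
      also have "\<dots> = (a k ^ Suc k) ^ l" unfolding power_mult[symmetric] by (simp only: mult.commute)
      also have "\<dots> \<le> (a (Suc k) ^ k) ^ l" using \<open>\<And>k. a k ^ Suc k \<le> a (Suc k) ^ k\<close> less_imp_le[OF pos]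
        by (intro power_mono zero_le_power) auto
      also have "\<dots> = (a (Suc k) ^ l) ^ k" unfolding power_mult[symmetric] by (simp only: mult.commute)
      finally show ?thesis using False pos[of "Suc k"] by (intro power_le_imp_le_base[of "a l ^ Suc k" "k - 1"]) (simp_all del: power_Suc)
    qed
  qed
qed

lemma log_convex_le_root_power:
  fixes a :: "nat \<Rightarrow> real"
  assumes "\<And>k. 0 < a k" "a 0 \<le> 1" "\<And>k. (a (Suc k))\<^sup>2 \<le> a k * a (Suc (Suc k))" "l \<le> k" "0 < k"
  shows "a l \<le> root k (a k) ^ l"
proof -
  have "a l ^ Suc (k - 1) \<le> (root k (a k) ^ l) ^ Suc (k - 1)"
  proof -
    have "(root k (a k) ^ l) ^ k = (root k (a k) ^ k) ^ l" unfolding power_mult[symmetric] by (simp only: mult.commute)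
    also have "\<dots> = a k ^ l" using assms(1)[of k] assms(5) by (simp add: less_imp_le)
    finally show ?thesis using log_convex_power_le[OF assms(1-4)] assms(5) by (simp del: power_Suc)
  qed
  then show ?thesis 
    by (rule power_le_imp_le_base) (use assms(1)[of k] assms(5) in \<open>simp add: less_imp_le real_root_ge_zero\<close>)
qed

lemma weight_sequence_pos: "weight_sequence M \<Longrightarrow> 0 < M k"
  by (simp add: weight_sequence_def)

lemma weight_sequence_0: "weight_sequence M \<Longrightarrow> M 0 = 1"
  by (simp add: weight_sequence_def)

lemma weight_sequence_le_root_power:
  "weight_sequence M \<Longrightarrow> l \<le> k \<Longrightarrow> 0 < k \<Longrightarrow> M l \<le> root k (M k) ^ l"
  unfolding weight_sequence_def by (intro log_convex_le_root_power) auto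

text \<open>Once \<open>root k (n k)\<close> exceeds 1/t, the terms are at least 1, which is the
  value at k = 0. The infimum is therefore a minimum over finitely many indices, and
  \<open>LEAST\<close> in \<open>Gamma_upper\<close> is attained.\<close>

lemma Gamma_upper_minimizes:
  assumes pos: "\<And>k. 0 < n k" and n0: "n 0 = 1" and lim: "filterlim (\<lambda>k. root k (n k)) at_top sequentially" and t: "0 < t"
  shows "n (Gamma_upper n t) * t ^ Gamma_upper n t \<le> n l * t ^ l"
proof -
  have "eventually (\<lambda>k. root k (n k) \<ge> 1 / t) sequentially" using lim by (simp add: filterlim_at_top)
  then obtain K where K: "\<And>k. k \<ge> K \<Longrightarrow> root k (n k) \<ge> 1 / t" unfolding eventually_sequentially by blast
  define a where "a k = n k * t ^ k" for k
  have big: "1 \<le> a k" if k: "k \<ge> Suc K" for k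
  proof -
    have "1 = (1 / t) ^ k * t ^ k" using t by (simp add: power_one_over)
    also have "\<dots> \<le> root k (n k) ^ k * t ^ k" using K[of k] k t by (intro mult_right_mono power_mono) auto
    also have "root k (n k) ^ k = n k" using pos[of k] k by (intro real_root_pow_pos2) auto
    finally show ?thesis by (simp add: a_def)
  qed
  define k0 where "k0 = (ARG_MIN a k. k \<in> {..K})"
  have k0: "k0 \<in> {..K}" "\<And>k. k \<in> {..K} \<Longrightarrow> a k0 \<le> a k"
    using arg_min_if_finite(1)[of "{..K}" a] arg_min_least[of "{..K}" _ a] unfolding k0_def arg_min_on_def by auto
  have min: "a k0 \<le> a k" for k
  proof (cases "k \<le> K")
    case False
    have "a k0 \<le> a 0" by (rule k0(2)) simp
    also have "\<dots> = 1" by (simp add: a_def n0)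
    also have "1 \<le> a k" using False by (intro big) auto
    finally show ?thesis .
  qed (use k0 in auto)
  have bdd: "bdd_below (range a)" by (rule bdd_belowI2[of _ "a k0"]) (rule min)
  have "hfun n t = a k0" unfolding hfun_def a_def[symmetric]
    by (intro antisym cINF_lower cINF_greatest bdd min) auto
  then have "\<exists>k. hfun n t = n k * t ^ k" unfolding a_def by blast
  then have "hfun n t = n (Gamma_upper n t) * t ^ Gamma_upper n t" unfolding Gamma_upper_def by (rule LeastI_ex)
  moreover have "hfun n t \<le> a l" unfolding hfun_def a_def[symmetric] by (rule cINF_lower[OF bdd]) simp
  ultimately show ?thesis by (simp add: a_def)
qed

text \<open>Moving from \<open>\<theta> i\<close> to \<open>\<theta> (Suc i)\<close> lowers the minimum over \<open>l\<close> of \<open>n l * \<theta> ^ l\<close> by a factor of at most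
  \<open>(\<theta> (Suc i) / \<theta> i) ^ Suc i\<close>, since it is attained at an index at most \<open>Suc i\<close>.\<close>

lemma prod_ge_1_of_low_minimizers:
  fixes n \<theta> :: "nat \<Rightarrow> real"
  assumes pos: "\<And>i. 0 < \<theta> i" "\<And>i. \<theta> (Suc i) \<le> \<theta> i" and n: "\<And>i. 0 < n i" "n 0 = 1"
    and min: "\<And>i. \<exists>k\<le>i. \<forall>l. n k * \<theta> i ^ k \<le> n l * \<theta> i ^ l"
  shows "1 \<le> n k * (\<Prod>i<k. \<theta> i)"
proof -
  \<comment> \<open>At the end l = i is used and \<theta> i ^ i cancels. The induction needs all l,
    because the index of the minimizer varies with i.\<close>
  have "\<forall>l. \<theta> i ^ i \<le> n l * \<theta> i ^ l * (\<Prod>a<i. \<theta> a)" for i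
  proof (induction i)
    case 0
    then show ?case using min[of 0] n(2) by simp
  next
    case (Suc i)
    obtain k where k: "k \<le> Suc i" "\<And>l. n k * \<theta> (Suc i) ^ k \<le> n l * \<theta> (Suc i) ^ l" using min[of "Suc i"] by blast
    have P: "0 < (\<Prod>a<i. \<theta> a)" using pos by (intro prod_pos) auto
    define q where "q = \<theta> (Suc i) / \<theta> i"
    have q: "0 \<le> q" "q \<le> 1" "\<theta> (Suc i) = q * \<theta> i"
      using pos(1)[of i] pos(1)[of "Suc i"] pos(2)[of i] by (auto simp: q_def)
    have "\<theta> (Suc i) ^ Suc i = \<theta> i ^ i * (q ^ Suc i * \<theta> i)" unfolding q(3) by (simp add: power_mult_distrib)
    also have "\<dots> \<le> n k * \<theta> i ^ k * (\<Prod>a<i. \<theta> a) * (q ^ Suc i * \<theta> i)"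
      using Suc.IH q(1) pos(1)[of i] by (intro mult_right_mono) auto
    also have "\<dots> = n k * (\<theta> i ^ k * q ^ Suc i) * (\<Prod>a<Suc i. \<theta> a)" by (simp add: mult_ac)
    also have "\<dots> \<le> n k * (\<theta> i ^ k * q ^ k) * (\<Prod>a<Suc i. \<theta> a)"
      using q k(1) pos(1) n(1)[of k] less_imp_le[OF pos(1)]
      by (intro mult_right_mono mult_left_mono power_decreasing prod_nonneg zero_le_power) (auto simp: less_imp_le)
    also have "\<theta> i ^ k * q ^ k = \<theta> (Suc i) ^ k" unfolding q(3) by (simp add: power_mult_distrib mult.commute)
    finally have e: "\<theta> (Suc i) ^ Suc i \<le> n k * \<theta> (Suc i) ^ k * (\<Prod>a<Suc i. \<theta> a)" .
    have "n k * \<theta> (Suc i) ^ k * (\<Prod>a<Suc i. \<theta> a) \<le> n l * \<theta> (Suc i) ^ l * (\<Prod>a<Suc i. \<theta> a)" for l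
      using k(2)[of l] pos(1) by (intro mult_right_mono prod_nonneg) (auto simp: less_imp_le)
    then show ?case using e order_trans by blast
  qed
  then have "\<theta> k ^ k * 1 \<le> \<theta> k ^ k * (n k * (\<Prod>i<k. \<theta> i))" by (simp add: mult_ac)
  then show ?thesis using pos(1)[of k] by (simp only: mult_le_cancel_left_pos zero_less_power)
qed

text \<open>The quotients of \<open>m\<close> need not increase, so they are replaced by their
  running maxima \<mu>, whose products form a log-convex majorant of \<open>m\<close>. The Gamma
  condition bounds the product up to k by C^k n k, and log-convexity passes this on to every l \<le>
  k.\<close>

lemma Gamma_le_root_power:
  assumes m: "\<And>k. 0 < m k" "m 0 = 1" and n: "\<And>k. 0 < n k" "n 0 = 1"
    and lim: "filterlim (\<lambda>k. root k (n k)) at_top sequentially" and C: "1 \<le> C"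
    and G: "\<And>t. 0 < t \<Longrightarrow> Gamma_upper n (C * t) \<le> Gamma_lower m t"
    and lk: "l \<le> k" "0 < k"
  shows "m l \<le> (C * root k (n k)) ^ l"
proof -
  define \<mu> where "\<mu> i = Max ((\<lambda>i. m (Suc i) / m i) ` {..i})" for i
  have \<mu>: "m (Suc i') / m i' \<le> \<mu> i" if "i' \<le> i" for i i' unfolding \<mu>_def using that by (intro Max_ge) auto
  have \<mu>_pos: "0 < \<mu> i" for i using \<mu>[of i i] m(1)[of i] m(1)[of "Suc i"] by (smt (verit) divide_pos_pos order_refl)
  have \<mu>_mono: "\<mu> i \<le> \<mu> (Suc i)" for i unfolding \<mu>_def by (intro Max_mono) auto
  have \<mu>_attained: "\<exists>i'\<le>i. \<mu> i = m (Suc i') / m i'" for i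
  proof -
    have "\<mu> i \<in> (\<lambda>i. m (Suc i) / m i) ` {..i}" unfolding \<mu>_def by (intro Max_in) auto
    then show ?thesis by auto
  qed
  have "1 \<le> n k * (\<Prod>i<k. C / \<mu> i)"
  proof (rule prod_ge_1_of_low_minimizers)
    fix i
    show "0 < C / \<mu> i" using C \<mu>_pos[of i] by simp
    show "C / \<mu> (Suc i) \<le> C / \<mu> i" using C \<mu>_pos[of i] \<mu>_mono[of i] by (intro divide_left_mono) auto
    obtain i' where i': "i' \<le> i" "\<mu> i = m (Suc i') / m i'" using \<mu>_attained by blast
    \<comment> \<open>At t = 1 / \<mu> i the quotient with index i' equals 1/t, so
      \<open>Gamma_lower\<close> is at most i'. The Gamma condition thus places a minimizer for
      \<theta> i = C / \<mu> i at an index at most i.\<close>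
    have "Gamma_upper n (C * (1 / \<mu> i)) \<le> Gamma_lower m (1 / \<mu> i)" using \<mu>_pos by (intro G) auto
    also have "\<dots> \<le> i'" unfolding Gamma_lower_def by (rule Least_le) (use i' in auto)
    also note i'(1)
    finally have "Gamma_upper n (C / \<mu> i) \<le> i" by simp
    moreover have "0 < C / \<mu> i" using C \<mu>_pos[of i] by simp
    ultimately show "\<exists>k\<le>i. \<forall>l. n k * (C / \<mu> i) ^ k \<le> n l * (C / \<mu> i) ^ l"
      using Gamma_upper_minimizes[OF n lim] by blast
  qed (use n in auto)
  also have "(\<Prod>i<k. C / \<mu> i) = C ^ k / (\<Prod>i<k. \<mu> i)" by (simp add: prod_dividef)
  finally have le: "(\<Prod>i<k. \<mu> i) \<le> C ^ k * n k"
    using \<mu>_pos by (simp add: prod_pos le_divide_eq mult.commute)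
  have m_le: "m l \<le> (\<Prod>i<l. \<mu> i)" for l
  proof (induction l)
    case (Suc l)
    have "m (Suc l) = m l * (m (Suc l) / m l)" using m(1)[of l] by simp
    also have "\<dots> \<le> (\<Prod>i<l. \<mu> i) * \<mu> l"
      using Suc \<mu>[of l l] m(1)[of l] m(1)[of "Suc l"] less_imp_le[OF \<mu>_pos]
      by (intro mult_mono prod_nonneg) (auto simp: less_imp_le)
    finally show ?case by simp
  qed (use m in simp)
  have "m l \<le> (\<Prod>i<l. \<mu> i)" by (rule m_le)
  also have "\<dots> \<le> root k (\<Prod>i<k. \<mu> i) ^ l"
  proof (rule log_convex_le_root_power[OF _ _ _ lk])
    fix k
    have p: "0 < (\<Prod>i<k. \<mu> i)" for k using \<mu>_pos by (intro prod_pos) auto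
    show "0 < (\<Prod>i<k. \<mu> i)" by (rule p)
    have "\<mu> k * \<mu> k \<le> \<mu> k * \<mu> (Suc k)" using \<mu>_mono[of k] \<mu>_pos[of k] by simp
    then have "(\<Prod>i<k. \<mu> i)\<^sup>2 * (\<mu> k * \<mu> k) \<le> (\<Prod>i<k. \<mu> i)\<^sup>2 * (\<mu> k * \<mu> (Suc k))"
      by (rule mult_left_mono) simp
    then show "(\<Prod>i<Suc k. \<mu> i)\<^sup>2 \<le> (\<Prod>i<k. \<mu> i) * (\<Prod>i<Suc (Suc k). \<mu> i)"
      by (simp add: power2_eq_square mult_ac)
  qed simp
  also have "\<dots> \<le> root k (C ^ k * n k) ^ l"
    using le lk \<mu>_pos by (intro power_mono real_root_le_mono real_root_ge_zero prod_nonneg) (auto simp: less_imp_le)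
  also have "root k (C ^ k * n k) = C * root k (n k)"
    using lk C by (simp add: real_root_mult real_root_power_cancel)
  finally show ?thesis .
qed

section \<open>From admissibility to domination\<close>

text \<open>The condition \<open>dominates\<close> with R a multiple of
  \<open>root k (redseq N k)\<close>; up to a constant, this is the largest radius that the second
  half of \<open>dominates\<close> permits.\<close>

definition root_dominated :: "nat \<Rightarrow> (nat \<Rightarrow> real) \<Rightarrow> (nat \<Rightarrow> real) \<Rightarrow> bool" where
  "root_dominated D M N \<longleftrightarrow> (\<exists>K>0. \<forall>k>0. \<forall>l\<le>D * k. redseq M l \<le> (K * root k (redseq N k)) ^ l)"

lemma root_dominated_imp_dominates:
  assumes "root_dominated D M N" "\<And>k. 0 < N k" "1 \<le> c"
  obtains K where "0 < K" "\<And>\<rho> \<rho>'. 0 < \<rho> \<Longrightarrow> K * \<rho> \<le> \<rho>' \<Longrightarrow> dominates D c (\<lambda>k. \<rho> ^ k * M k) (\<lambda>k. \<rho>' ^ k * N k)"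
proof -
  obtain K where K: "K > 0" "\<And>k l. 0 < k \<Longrightarrow> l \<le> D * k \<Longrightarrow> redseq M l \<le> (K * root k (redseq N k)) ^ l"
    using assms(1) unfolding root_dominated_def by blast
  have "dominates D c (\<lambda>k. \<rho> ^ k * M k) (\<lambda>k. \<rho>' ^ k * N k)" if \<rho>: "0 < \<rho>" "c * K * \<rho> \<le> \<rho>'" for \<rho> \<rho>'
    unfolding dominates_def
  proof (rule exI[of _ 1], safe)
    fix k :: nat assume k: "0 < k"
    define s where "s = root k (redseq N k)"
    have s: "s > 0" "s ^ k = redseq N k" using k assms(2)[of k] by (auto simp: s_def redseq_def)
    show "\<exists>R>0. (\<forall>l\<le>D * k. \<rho> ^ l * M l \<le> 1 * fact l * R ^ l) \<and> fact k * (c * R) ^ k \<le> 1 * (\<rho>' ^ k * N k)"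
    proof (intro exI[of _ "\<rho> * (K * s)"] conjI allI impI)
      show "0 < \<rho> * (K * s)" using \<rho>(1) K(1) s(1) by simp
      fix l assume "l \<le> D * k"
      then have "M l \<le> fact l * (K * s) ^ l" using K(2)[OF k] by (simp add: redseq_def s_def divide_le_eq mult.commute)
      then have "\<rho> ^ l * M l \<le> \<rho> ^ l * (fact l * (K * s) ^ l)" using \<rho>(1) by (intro mult_left_mono) auto
      also have "\<dots> = 1 * fact l * (\<rho> * (K * s)) ^ l" by (simp add: power_mult_distrib mult_ac)
      finally show "\<rho> ^ l * M l \<le> 1 * fact l * (\<rho> * (K * s)) ^ l" .
    next
      have "fact k * (c * (\<rho> * (K * s))) ^ k = (c * K * \<rho>) ^ k * N k"
        using s(2) by (simp add: power_mult_distrib redseq_def mult_ac)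
      also have "\<dots> \<le> \<rho>' ^ k * N k"
        using \<rho> K(1) assms(2)[of k] assms(3) by (intro mult_right_mono power_mono) auto
      finally show "fact k * (c * (\<rho> * (K * s))) ^ k \<le> 1 * (\<rho>' ^ k * N k)" by simp
    qed
  qed simp
  then show thesis using that[of "c * K"] K(1) assms(3) by auto
qed

text \<open>For l \<le> k the first bound applies as it is. For l > k, \<open>root k (N k)\<close>
  is at most k, hence at most l, times \<open>root k (redseq N k)\<close>, and l^l \<le> e^l l!
  returns to the reduced sequence of \<open>M\<close> at the price of a factor e per order.\<close>

lemma root_dominatedI:
  assumes low: "\<forall>k>0. \<forall>l\<le>k. redseq M l \<le> (C * root k (redseq N k)) ^ l"
    and high: "\<forall>k>0. \<forall>l\<le>D * k. M l \<le> (C' * root k (N k)) ^ l"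
    and C: "0 < C" "0 < C'" and N: "\<And>k. 0 < N k"
  shows "root_dominated D M N"
  unfolding root_dominated_def
proof (intro exI[of _ "max C (C' * exp 1)"] conjI allI impI)
  show "0 < max C (C' * exp 1)" using C by simp
  fix k l :: nat assume k: "0 < k" and l: "l \<le> D * k"
  define s where "s = root k (redseq N k)"
  have s: "s > 0" "s ^ k = redseq N k" using k N[of k] by (auto simp: s_def redseq_def)
  show "redseq M l \<le> (max C (C' * exp 1) * s) ^ l"
  proof (cases "l \<le> k")
    case True
    then have "redseq M l \<le> (C * s) ^ l" using low k by (simp add: s_def)
    also have "\<dots> \<le> (max C (C' * exp 1) * s) ^ l" using C s by (intro power_mono mult_right_mono) auto
    finally show ?thesis .
  next
    case False
    have fk: "fact k \<le> real k ^ k" by (metis fact_le_power le_refl of_nat_fact of_nat_le_iff of_nat_power)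
    have "N k = fact k * s ^ k" using s(2) by (simp add: redseq_def)
    also have "\<dots> \<le> real k ^ k * s ^ k" using fk s(1) by (intro mult_right_mono) auto
    finally have "root k (N k) \<le> root k ((real k * s) ^ k)" using k by (simp add: power_mult_distrib)
    also have "\<dots> = real k * s" using k s(1) by (simp add: real_root_power_cancel)
    also have "\<dots> \<le> real l * s" using False s(1) by (intro mult_right_mono) auto
    finally have "root k (N k) \<le> real l * s" .
    then have "(C' * root k (N k)) ^ l \<le> (C' * (real l * s)) ^ l"
      using C N[of k] k by (intro power_mono mult_left_mono mult_nonneg_nonneg real_root_ge_zero) (auto simp: less_imp_le)
    moreover have "M l \<le> (C' * root k (N k)) ^ l" using high k l by blast
    ultimately have "M l \<le> (C' * (real l * s)) ^ l" by linarith
    also have "\<dots> = (C' * s) ^ l * real l ^ l" by (simp add: power_mult_distrib mult_ac)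
    also have "\<dots> \<le> (C' * s) ^ l * (exp 1 ^ l * fact l)" using C s(1) by (intro mult_left_mono power_le_exp_fact) auto
    also have "\<dots> = (C' * exp 1 * s) ^ l * fact l" by (simp add: power_mult_distrib mult_ac)
    also have "\<dots> \<le> (max C (C' * exp 1) * s) ^ l * fact l" using C s(1) by (intro mult_right_mono power_mono) auto
    finally show ?thesis by (simp add: redseq_def divide_le_eq)
  qed
qed

text \<open>Iterated moderate growth: q = 2 is the diagonal case of \<open>mg\<close>, and
  composition gives q = 2^p. As D \<le> 2^D, this reaches all orders up to D k.\<close>

definition power_dominated :: "nat \<Rightarrow> (nat \<Rightarrow> real) \<Rightarrow> (nat \<Rightarrow> real) \<Rightarrow> bool" where
  "power_dominated q M N \<longleftrightarrow> (\<exists>C>0. \<forall>k. M (q * k) \<le> C ^ (q * k) * N k ^ q)"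

lemma power_dominated_2_of_mg:
  assumes "weight_sequence M" "weight_sequence N" "mg M N < \<infinity>"
  shows "power_dominated 2 M N"
proof -
  obtain C where C: "C \<ge> 0" "mg M N = ennreal C" using assms(3) by (cases "mg M N") auto
  show ?thesis
    unfolding power_dominated_def
  proof (intro exI[of _ "C + 1"] conjI allI)
    show "0 < C + 1" using C by simp
    fix k
    show "M (2 * k) \<le> (C + 1) ^ (2 * k) * N k ^ 2"
    proof (cases "k = 0")
      case True then show ?thesis using assms by (simp add: weight_sequence_0)
    next
      case False
      have "ennreal (root (k + k) (M (k + k) / (N k * N k))) \<le> mg M N"
        unfolding mg_def by (rule SUP_upper2[of "(k, k)"]) (use False in auto)
      then have "root (2 * k) (M (2 * k) / (N k)\<^sup>2) \<le> C"
        using C by (simp add: ennreal_le_iff mult_2 power2_eq_square)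
      then have "root (2 * k) (M (2 * k) / (N k)\<^sup>2) ^ (2 * k) \<le> (C + 1) ^ (2 * k)"
        using weight_sequence_pos[OF assms(1), of "2 * k"]
        by (intro power_mono real_root_ge_zero) (auto simp: less_imp_le)
      moreover have "root (2 * k) (M (2 * k) / (N k)\<^sup>2) ^ (2 * k) = M (2 * k) / (N k)\<^sup>2"
        using weight_sequence_pos[OF assms(1), of "2 * k"] False by (intro real_root_pow_pos2) (auto simp: less_imp_le)
      ultimately show ?thesis
        using weight_sequence_pos[OF assms(2), of k] by (simp add: divide_le_eq)
    qed
  qed
qed

lemma power_dominated_trans:
  assumes "power_dominated p L M" "power_dominated q M N" "\<And>k. 0 < M k"
  shows "power_dominated (p * q) L N"
proof -
  obtain C where C: "C > 0" "\<And>k. L (p * k) \<le> C ^ (p * k) * M k ^ p" using assms(1) unfolding power_dominated_def by blast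
  obtain C' where C': "C' > 0" "\<And>k. M (q * k) \<le> C' ^ (q * k) * N k ^ q" using assms(2) unfolding power_dominated_def by blast
  show ?thesis
    unfolding power_dominated_def
  proof (intro exI[of _ "C * C'"] conjI allI)
    show "0 < C * C'" using C C' by simp
    fix k
    have "L (p * q * k) \<le> C ^ (p * (q * k)) * M (q * k) ^ p" using C(2)[of "q * k"] by (simp add: mult.assoc)
    also have "\<dots> \<le> C ^ (p * (q * k)) * (C' ^ (q * k) * N k ^ q) ^ p"
      using C(1) C'(2)[of k] less_imp_le[OF assms(3)] by (intro mult_left_mono power_mono) auto
    also have "\<dots> = (C * C') ^ (p * q * k) * N k ^ (p * q)"
      by (simp add: power_mult_distrib power_mult[symmetric] mult_ac)
    finally show "L (p * q * k) \<le> (C * C') ^ (p * q * k) * N k ^ (p * q)" .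
  qed
qed

lemma power_dominated_refl: "power_dominated 1 M M"
  unfolding power_dominated_def by (intro exI[of _ 1]) auto

text \<open>By log-convexity the roots of \<open>M\<close> increase, so the root at q k controls
  every order l \<le> D k.\<close>

lemma power_dominated_root_bound:
  assumes "power_dominated q M N" "weight_sequence M" "weight_sequence N" "0 < q" "D \<le> q"
  obtains C where "0 < C" "\<forall>k>0. \<forall>l\<le>D * k. M l \<le> (C * root k (N k)) ^ l"
proof -
  obtain C where C: "C > 0" "\<And>k. M (q * k) \<le> C ^ (q * k) * N k ^ q" using assms(1) unfolding power_dominated_def by blast
  have "M l \<le> (C * root k (N k)) ^ l" if k: "0 < k" and l: "l \<le> D * k" for k l
  proof -
    have N: "0 \<le> N k" and M: "0 \<le> M (q * k)"
      using weight_sequence_pos[OF assms(3)] weight_sequence_pos[OF assms(2)] by (auto simp: less_imp_le)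
    have "M l \<le> root (q * k) (M (q * k)) ^ l"
      using k l assms(4,5) by (intro weight_sequence_le_root_power assms(2)) (auto intro: order_trans mult_right_mono)
    also have "\<dots> \<le> root (q * k) ((C * root k (N k)) ^ (q * k)) ^ l"
    proof (intro power_mono real_root_le_mono real_root_ge_zero M)
      have "(C * root k (N k)) ^ (q * k) = C ^ (q * k) * (root k (N k) ^ k) ^ q"
        by (simp add: power_mult_distrib power_mult[symmetric] mult.commute)
      also have "root k (N k) ^ k = N k" using k N by simp
      finally show "M (q * k) \<le> (C * root k (N k)) ^ (q * k)" using C(2)[of k] by simp
    qed (use k assms(4) in simp)
    also have "root (q * k) ((C * root k (N k)) ^ (q * k)) = C * root k (N k)"
      using k assms(4) C(1) N by (intro real_root_power_cancel) auto
    finally show ?thesis .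
  qed
  then show thesis using C(1) that by blast
qed

lemma Gamma_root_bound:
  assumes "weight_sequence M" "weight_sequence N" "filterlim (\<lambda>k. root k (redseq N k)) at_top sequentially" "1 \<le> C"
    and "\<forall>t>0. Gamma_upper (redseq N) (C * t) \<le> Gamma_lower (redseq M) t"
  shows "\<forall>k>0. \<forall>l\<le>k. redseq M l \<le> (C * root k (redseq N k)) ^ l"
proof (intro allI impI)
  have rs: "0 < redseq L k" "redseq L 0 = 1" if "weight_sequence L" for L k
    using that by (auto simp: redseq_def weight_sequence_pos weight_sequence_0)
  fix k l :: nat assume "0 < k" "l \<le> k"
  then show "redseq M l \<le> (C * root k (redseq N k)) ^ l"
    using assms(3-5) by (intro Gamma_le_root_power rs assms(1,2)) auto
qed

lemma root_dominated_Roumieu: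
  assumes wm: "weight_matrix \<MM>" and ad: "admissible Roumieu \<MM>" and M: "M \<in> \<MM>"
  shows "\<exists>N\<in>\<MM>. root_dominated D M N"
proof -
  have ws: "weight_sequence M" if "M \<in> \<MM>" for M using wm that by (simp add: weight_matrix_def)
  have tot: "M \<le> N \<or> N \<le> M" if "M \<in> \<MM>" "N \<in> \<MM>" for M N using wm that by (simp add: weight_matrix_def)
  have "\<exists>N\<in>\<MM>. power_dominated (2 ^ p) M N" if "M \<in> \<MM>" for M p
    using that
  proof (induction p arbitrary: M)
    case 0
    then show ?case using power_dominated_refl by auto
  next
    case (Suc p)
    obtain L where L: "L \<in> \<MM>" "mg M L < \<infinity>" using ad Suc.prems by auto
    obtain N where N: "N \<in> \<MM>" "power_dominated (2 ^ p) L N" using Suc.IH[OF L(1)] by blast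
    have "power_dominated (2 * 2 ^ p) M N"
      by (rule power_dominated_trans[OF power_dominated_2_of_mg N(2)]) (use L Suc.prems ws weight_sequence_pos in auto)
    then show ?case using N(1) by auto
  qed
  then obtain N2 where N2: "N2 \<in> \<MM>" "power_dominated (2 ^ D) M N2" using M by blast
  obtain C2 where C2: "0 < C2" "\<forall>k>0. \<forall>l\<le>D * k. M l \<le> (C2 * root k (N2 k)) ^ l"
    by (rule power_dominated_root_bound[OF N2(2) ws[OF M] ws[OF N2(1)], of D]) (auto simp: less_imp_le)
  obtain N1 C1 where N1: "N1 \<in> \<MM>" "C1 \<ge> 1" "\<forall>t>0. Gamma_upper (redseq N1) (C1 * t) \<le> Gamma_lower (redseq M) t"
    using ad M by auto
  have low: "\<forall>k>0. \<forall>l\<le>k. redseq M l \<le> (C1 * root k (redseq N1 k)) ^ l"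
    using ad N1 ws M by (intro Gamma_root_bound) auto
  \<comment> \<open>Both bounds survive an enlargement of \<open>N\<close>, and the matrix is
    totally ordered, so the larger of the two works.\<close>
  define N where "N = (if N1 \<le> N2 then N2 else N1)"
  have N: "N \<in> \<MM>" "N1 \<le> N" "N2 \<le> N" using N1(1) N2(1) tot[of N1 N2] by (auto simp: N_def)
  have "root_dominated D M N"
  proof (rule root_dominatedI)
    show "\<forall>k>0. \<forall>l\<le>k. redseq M l \<le> (C1 * root k (redseq N k)) ^ l"
    proof (intro allI impI)
      fix k l :: nat assume k: "0 < k" and l: "l \<le> k"
      have "redseq M l \<le> (C1 * root k (redseq N1 k)) ^ l" using low k l by blast
      also have "\<dots> \<le> (C1 * root k (redseq N k)) ^ l"
        using k N(2) N1(2) weight_sequence_pos[OF ws[OF N1(1)], of k]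
        by (intro power_mono mult_left_mono real_root_le_mono mult_nonneg_nonneg real_root_ge_zero)
           (auto simp: redseq_def le_fun_def divide_right_mono)
      finally show "redseq M l \<le> (C1 * root k (redseq N k)) ^ l" .
    qed
    show "\<forall>k>0. \<forall>l\<le>D * k. M l \<le> (C2 * root k (N k)) ^ l"
    proof (intro allI impI)
      fix k l :: nat assume k: "0 < k" and l: "l \<le> D * k"
      have "M l \<le> (C2 * root k (N2 k)) ^ l" using C2 k l by blast
      also have "\<dots> \<le> (C2 * root k (N k)) ^ l"
        using k N(3) C2(1) weight_sequence_pos[OF ws[OF N2(1)], of k]
        by (intro power_mono mult_left_mono real_root_le_mono mult_nonneg_nonneg real_root_ge_zero)
           (auto simp: le_fun_def)
      finally show "M l \<le> (C2 * root k (N k)) ^ l" .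
    qed
  qed (use C2 N1 N ws weight_sequence_pos in auto)
  then show ?thesis using N(1) by blast
qed

lemma root_dominated_Beurling:
  assumes wm: "weight_matrix \<MM>" and ad: "admissible Beurling \<MM>" and N: "N \<in> \<MM>"
  shows "\<exists>M\<in>\<MM>. root_dominated D M N"
proof -
  have ws: "weight_sequence M" if "M \<in> \<MM>" for M using wm that by (simp add: weight_matrix_def)
  have tot: "M \<le> N \<or> N \<le> M" if "M \<in> \<MM>" "N \<in> \<MM>" for M N using wm that by (simp add: weight_matrix_def)
  have "\<exists>M\<in>\<MM>. power_dominated (2 ^ p) M N" for p
  proof (induction p)
    case 0
    then show ?case using power_dominated_refl N by auto
  next
    case (Suc p)
    then obtain L where L: "L \<in> \<MM>" "power_dominated (2 ^ p) L N" by blast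
    obtain M where M: "M \<in> \<MM>" "mg M L < \<infinity>" using ad L(1) by auto
    have "power_dominated (2 * 2 ^ p) M N"
      by (rule power_dominated_trans[OF power_dominated_2_of_mg L(2)]) (use L M ws weight_sequence_pos in auto)
    then show ?case using M(1) by auto
  qed
  then obtain M2 where M2: "M2 \<in> \<MM>" "power_dominated (2 ^ D) M2 N" by blast
  obtain C2 where C2: "0 < C2" "\<forall>k>0. \<forall>l\<le>D * k. M2 l \<le> (C2 * root k (N k)) ^ l"
    by (rule power_dominated_root_bound[OF M2(2) ws[OF M2(1)] ws[OF N], of D]) (auto simp: less_imp_le)
  obtain M1 C1 where M1: "M1 \<in> \<MM>" "C1 \<ge> 1" "\<forall>t>0. Gamma_upper (redseq N) (C1 * t) \<le> Gamma_lower (redseq M1) t"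
    using ad N by auto
  have low: "\<forall>k>0. \<forall>l\<le>k. redseq M1 l \<le> (C1 * root k (redseq N k)) ^ l"
    using ad M1 ws N by (intro Gamma_root_bound) auto
  \<comment> \<open>Here both bounds survive when \<open>M\<close> is made smaller.\<close>
  define M where "M = (if M1 \<le> M2 then M1 else M2)"
  have M: "M \<in> \<MM>" "M \<le> M1" "M \<le> M2" using M1(1) M2(1) tot[of M1 M2] by (auto simp: M_def)
  have "root_dominated D M N"
  proof (rule root_dominatedI)
    show "\<forall>k>0. \<forall>l\<le>k. redseq M l \<le> (C1 * root k (redseq N k)) ^ l"
      using low M(2) unfolding redseq_def le_fun_def by (meson divide_right_mono fact_ge_zero order_trans)
    show "\<forall>k>0. \<forall>l\<le>D * k. M l \<le> (C2 * root k (N k)) ^ l"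
      using C2(2) M(3) unfolding le_fun_def by (meson order_trans)
  qed (use C2 M1 N ws weight_sequence_pos in auto)
  then show ?thesis using M(1) by blast
qed

text \<open>A matrix may be uncountable, but pairs of an index k and a rational q are countable. If
  M is not maximal, some M' exceeds it at some k; for q in between, the sequence selected for (k, q)
  exceeds M at k and, by total order, everywhere dominates M. Taking successive larger elements
  makes the selection increasing.\<close>

lemma weight_matrix_cofinal_sequence:
  assumes "weight_matrix \<MM>"
  obtains P where "\<And>n. P n \<in> \<MM>" "\<And>n. P n \<le> P (Suc n)" "\<And>M. M \<in> \<MM> \<Longrightarrow> \<exists>n. M \<le> P n"
proof -
  have tot: "M \<le> N \<or> N \<le> M" if "M \<in> \<MM>" "N \<in> \<MM>" for M N using assms that by (simp add: weight_matrix_def)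
  obtain M0 where M0: "M0 \<in> \<MM>" using assms by (auto simp: weight_matrix_def)
  show thesis
  proof (cases "\<exists>T\<in>\<MM>. \<forall>M\<in>\<MM>. M \<le> T")
    case True
    then obtain T where "T \<in> \<MM>" "\<And>M. M \<in> \<MM> \<Longrightarrow> M \<le> T" by blast
    then show thesis using that[of "\<lambda>_. T"] by blast
  next
    case False
    define d where "d = (\<lambda>(k, q). if \<exists>M\<in>\<MM>. of_rat q < M k then SOME M. M \<in> \<MM> \<and> of_rat q < M k else M0)"
    have d: "d x \<in> \<MM>" for x
      using M0 someI_ex[of "\<lambda>M. M \<in> \<MM> \<and> of_rat (snd x) < M (fst x)"] by (auto simp: d_def case_prod_beta)
    have d_gt: "of_rat q < d (k, q) k" if "M \<in> \<MM>" "of_rat q < M k" for k q M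
      using that someI[of "\<lambda>M. M \<in> \<MM> \<and> of_rat q < M k" M] by (auto simp: d_def)
    define e where "e n = d (from_nat n)" for n
    have "\<exists>P. \<forall>n. (P n \<in> \<MM> \<and> e n \<le> P n) \<and> P n \<le> P (Suc n)"
    proof (rule dependent_nat_choice)
      show "\<exists>N. N \<in> \<MM> \<and> e 0 \<le> N" unfolding e_def using d by blast
      fix N n assume "N \<in> \<MM> \<and> e n \<le> N"
      then show "\<exists>N'. (N' \<in> \<MM> \<and> e (Suc n) \<le> N') \<and> N \<le> N'"
        using tot[of N "e (Suc n)"] d[of "from_nat (Suc n)"] by (auto simp: e_def)
    qed
    then obtain P where P: "\<And>n. P n \<in> \<MM>" "\<And>n. e n \<le> P n" "\<And>n. P n \<le> P (Suc n)" by blast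
    have "\<exists>n. M \<le> P n" if M: "M \<in> \<MM>" for M
    proof -
      obtain M' where M': "M' \<in> \<MM>" "\<not> M' \<le> M" using False M by blast
      then obtain k where "M k < M' k" by (auto simp: le_fun_def not_le)
      then obtain q where q: "M k < of_rat q" "of_rat q < M' k" using of_rat_dense by blast
      have "of_rat q < d (k, q) k" by (rule d_gt[of M']) (use M' q in auto)
      then have "\<not> d (k, q) \<le> M" using q(1) by (metis le_fun_def less_trans not_less)
      then have "M \<le> d (k, q)" using tot[OF M d] by blast
      also have "d (k, q) = e (to_nat (k, q))" by (simp add: e_def)
      also have "\<dots> \<le> P (to_nat (k, q))" by (rule P(2))
      finally show ?thesis by blast
    qed
    then show thesis using that P by blast
  qed
qed

definition matrix_weights :: "(nat \<Rightarrow> real) set \<Rightarrow> (nat \<Rightarrow> real) set" where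
  "matrix_weights \<MM> = {\<lambda>k. \<rho> ^ k * M k | \<rho> M. 0 < \<rho> \<and> M \<in> \<MM>}"

lemma E_matrix_Roumieu_iff:
  fixes f :: "'a::real_normed_vector \<Rightarrow> complex"
  assumes "weight_matrix \<MM>"
  shows "f \<in> E_matrix Roumieu \<MM> U \<longleftrightarrow> smooth_on U f \<and>
    (\<forall>K. compact K \<and> K \<subseteq> U \<longrightarrow> (\<exists>w\<in>matrix_weights \<MM>. deriv_bounded w K f))"
proof -
  have pos: "0 < M k" if "M \<in> \<MM>" for M k using assms that by (simp add: weight_matrix_def weight_sequence_pos)
  have "(\<exists>M\<in>\<MM>. \<exists>\<rho>>0. seminorm_M M K \<rho> f < \<infinity>) \<longleftrightarrow> (\<exists>w\<in>matrix_weights \<MM>. deriv_bounded w K f)" for K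
  proof -
    have "(\<exists>M\<in>\<MM>. \<exists>\<rho>>0. seminorm_M M K \<rho> f < \<infinity>) \<longleftrightarrow> (\<exists>M\<in>\<MM>. \<exists>\<rho>>0. deriv_bounded (\<lambda>k. \<rho> ^ k * M k) K f)"
      using seminorm_M_finite_iff[where 'a = 'a] pos by meson
    then show ?thesis unfolding matrix_weights_def by blast
  qed
  then show ?thesis by simp
qed

lemma E_matrix_Beurling_iff:
  fixes f :: "'a::real_normed_vector \<Rightarrow> complex"
  assumes "weight_matrix \<MM>"
  shows "f \<in> E_matrix Beurling \<MM> U \<longleftrightarrow> smooth_on U f \<and>
    (\<forall>K. compact K \<and> K \<subseteq> U \<longrightarrow> (\<forall>w\<in>matrix_weights \<MM>. deriv_bounded w K f))"
proof -
  have pos: "0 < M k" if "M \<in> \<MM>" for M k using assms that by (simp add: weight_matrix_def weight_sequence_pos)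
  have "(\<forall>M\<in>\<MM>. \<forall>\<rho>>0. seminorm_M M K \<rho> f < \<infinity>) \<longleftrightarrow> (\<forall>w\<in>matrix_weights \<MM>. deriv_bounded w K f)" for K
  proof -
    have "(\<forall>M\<in>\<MM>. \<forall>\<rho>>0. seminorm_M M K \<rho> f < \<infinity>) \<longleftrightarrow> (\<forall>M\<in>\<MM>. \<forall>\<rho>>0. deriv_bounded (\<lambda>k. \<rho> ^ k * M k) K f)"
      using seminorm_M_finite_iff[where 'a = 'a] pos by meson
    then show ?thesis unfolding matrix_weights_def by blast
  qed
  then show ?thesis by simp
qed

lemma joris_matrix:
  fixes f :: "'a::real_normed_vector \<Rightarrow> complex"
  assumes U: "open U" and wm: "weight_matrix \<MM>" and ad: "admissible r \<MM>" and j: "0 < j"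
    and f: "(\<lambda>x. f x ^ j) \<in> E_matrix r \<MM> U" "(\<lambda>x. f x ^ (j + 1)) \<in> E_matrix r \<MM> U"
  shows "f \<in> E_matrix r \<MM> U"
proof -
  have pos: "0 < M k" if "M \<in> \<MM>" for M k using wm that by (simp add: weight_matrix_def weight_sequence_pos)
  have posW: "\<forall>k. 0 < w k" if "w \<in> matrix_weights \<MM>" for w using that pos by (auto simp: matrix_weights_def)
  show ?thesis
  proof (cases r)
    case Roumieu
    note ff = f[unfolded Roumieu E_matrix_Roumieu_iff[OF wm]]
    obtain P where P: "\<And>n. P n \<in> \<MM>" "\<And>n. P n \<le> P (Suc n)" "\<And>M. M \<in> \<MM> \<Longrightarrow> \<exists>n. M \<le> P n"
      by (rule weight_matrix_cofinal_sequence[OF wm]) blast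
    have Pmono: "P n \<le> P m" if "n \<le> m" for n m by (rule lift_Suc_mono_le[of P, OF P(2) that])
    \<comment> \<open>Radius and matrix element grow together, so that one increasing sequence is
      cofinal in both.\<close>
    define v where "v n k = real (Suc n) ^ k * P n k" for n k
    have vW: "v n \<in> matrix_weights \<MM>" for n
      unfolding matrix_weights_def v_def using P(1)[of n] by (intro CollectI exI[of _ "real (Suc n)"] exI[of _ "P n"]) auto
    have vmono: "v n k \<le> v m k" if "n \<le> m" for n m k
      unfolding v_def using that Pmono[OF that] less_imp_le[OF pos[OF P(1)]]
      by (intro mult_mono power_mono) (auto simp: le_fun_def)
    have cof: "\<exists>n. \<exists>C\<ge>0. \<forall>k. w k \<le> C * v n k" if w: "w \<in> matrix_weights \<MM>" for w
    proof -
      obtain \<rho> M where M: "w = (\<lambda>k. \<rho> ^ k * M k)" "0 < \<rho>" "M \<in> \<MM>" using w by (auto simp: matrix_weights_def)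
      obtain n1 where n1: "M \<le> P n1" using P(3) M(3) by blast
      obtain n2 where n2: "\<rho> \<le> real n2" using real_arch_simple by blast
      define n where "n = max n1 n2"
      have "M \<le> P n" using n1 Pmono[of n1 n] by (simp add: n_def)
      moreover have "\<rho> \<le> real (Suc n)" using n2 by (simp add: n_def)
      ultimately have "w k \<le> 1 * v n k" for k
        unfolding M(1) v_def using M(2) less_imp_le[OF pos[OF M(3), of k]]
        by (simp del: of_nat_Suc, intro mult_mono power_mono) (auto simp: le_fun_def)
      then show ?thesis by (intro exI[of _ n] exI[of _ 1]) auto
    qed
    have dom: "\<exists>w'\<in>matrix_weights \<MM>. dominates D c w w'" if c: "1 \<le> c" and w: "w \<in> matrix_weights \<MM>" for D c w
    proof -
      obtain \<rho> M where M: "w = (\<lambda>k. \<rho> ^ k * M k)" "0 < \<rho>" "M \<in> \<MM>" using w by (auto simp: matrix_weights_def)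
      obtain N where N: "N \<in> \<MM>" "root_dominated D M N" using root_dominated_Roumieu[OF wm] ad Roumieu M(3) by blast
      obtain K where K: "0 < K" "\<And>\<rho> \<rho>'. 0 < \<rho> \<Longrightarrow> K * \<rho> \<le> \<rho>' \<Longrightarrow> dominates D c (\<lambda>k. \<rho> ^ k * M k) (\<lambda>k. \<rho>' ^ k * N k)"
        using root_dominated_imp_dominates[OF N(2) pos[OF N(1)] c] by blast
      have "dominates D c w (\<lambda>k. (K * \<rho>) ^ k * N k)" unfolding M(1) by (rule K(2)[OF M(2)]) simp
      moreover have "0 < K * \<rho>" using K(1) M(2) by simp
      ultimately show ?thesis using N(1) unfolding matrix_weights_def by blast
    qed
    have sm: "smooth_on U (\<lambda>x. f x ^ j)" "smooth_on U (\<lambda>x. f x ^ (j + 1))"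
      using ff by blast+
    have b: "\<And>K. compact K \<Longrightarrow> K \<subseteq> U \<Longrightarrow> \<exists>w\<in>matrix_weights \<MM>. deriv_bounded w K (\<lambda>x. f x ^ j)"
      "\<And>K. compact K \<Longrightarrow> K \<subseteq> U \<Longrightarrow> \<exists>w\<in>matrix_weights \<MM>. deriv_bounded w K (\<lambda>x. f x ^ (j + 1))"
      using ff by blast+
    note root = joris_Roumieu[where v = v and W = "matrix_weights \<MM>" and f = f, OF j U posW vW vmono cof dom sm b]
    show ?thesis
      unfolding Roumieu E_matrix_Roumieu_iff[OF wm]
    proof (intro conjI allI impI)
      show "smooth_on U f" by (rule root(1))
      fix K assume "compact K \<and> K \<subseteq> U"
      then show "\<exists>w\<in>matrix_weights \<MM>. deriv_bounded w K f" using root(2) by blast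
    qed
  next
    case Beurling
    note ff = f[unfolded Beurling E_matrix_Beurling_iff[OF wm]]
    have ne: "matrix_weights \<MM> \<noteq> {}"
    proof -
      obtain M where "M \<in> \<MM>" using wm by (auto simp: weight_matrix_def)
      then have "(\<lambda>k. 1 ^ k * M k) \<in> matrix_weights \<MM>" unfolding matrix_weights_def using zero_less_one by blast
      then show ?thesis by blast
    qed
    have dom: "\<exists>w\<in>matrix_weights \<MM>. dominates D c w w'" if c: "1 \<le> c" and w: "w' \<in> matrix_weights \<MM>" for D c w'
    proof -
      obtain \<rho>' N where N: "w' = (\<lambda>k. \<rho>' ^ k * N k)" "0 < \<rho>'" "N \<in> \<MM>" using w by (auto simp: matrix_weights_def)
      obtain M where M: "M \<in> \<MM>" "root_dominated D M N" using root_dominated_Beurling[OF wm] ad Beurling N(3) by blast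
      obtain K where K: "0 < K" "\<And>\<rho> \<rho>'. 0 < \<rho> \<Longrightarrow> K * \<rho> \<le> \<rho>' \<Longrightarrow> dominates D c (\<lambda>k. \<rho> ^ k * M k) (\<lambda>k. \<rho>' ^ k * N k)"
        using root_dominated_imp_dominates[OF M(2) pos[OF N(3)] c] by blast
      have p: "0 < \<rho>' / K" using K(1) N(2) by simp
      have "dominates D c (\<lambda>k. (\<rho>' / K) ^ k * M k) w'" unfolding N(1) by (rule K(2)[OF p]) (use K(1) in simp)
      then show ?thesis using M(1) p unfolding matrix_weights_def by blast
    qed
    have sm: "smooth_on U (\<lambda>x. f x ^ j)" "smooth_on U (\<lambda>x. f x ^ (j + 1))"
      using ff by blast+
    have b: "\<And>K w. compact K \<Longrightarrow> K \<subseteq> U \<Longrightarrow> w \<in> matrix_weights \<MM> \<Longrightarrow> deriv_bounded w K (\<lambda>x. f x ^ j)"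
      "\<And>K w. compact K \<Longrightarrow> K \<subseteq> U \<Longrightarrow> w \<in> matrix_weights \<MM> \<Longrightarrow> deriv_bounded w K (\<lambda>x. f x ^ (j + 1))"
      using ff by blast+
    note root = joris_Beurling[where W = "matrix_weights \<MM>" and f = f, OF j U posW ne dom sm b]
    show ?thesis
      unfolding Beurling E_matrix_Beurling_iff[OF wm]
    proof (intro conjI allI impI ballI)
      show "smooth_on U f" by (rule root(1))
      fix K w assume "compact K \<and> K \<subseteq> U" "w \<in> matrix_weights \<MM>"
      then show "deriv_bounded w K f" using root(2) by blast
    qed
  qed
qed

section \<open>Concave weight functions\<close>

locale concave_weight_function =
  fixes \<omega> :: "real \<Rightarrow> real"
  assumes wf: "weight_function \<omega>" and cc: "concave_on {0..} \<omega>"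
begin

abbreviation \<phi> :: "real \<Rightarrow> real" where "\<phi> \<equiv> phi_conj \<omega>"

definition wt :: "real \<Rightarrow> nat \<Rightarrow> real" where "wt \<rho> k = exp (\<phi> (\<rho> * real k) / \<rho>)"

lemma nonneg: "0 \<le> t \<Longrightarrow> 0 \<le> \<omega> t"
  using wf by (simp add: weight_function_def)

text \<open>Concavity on [0, \<kappa> s] together with \<omega> 0 \<ge> 0. Concavity enters all
  later estimates through this inequality.\<close>

lemma scale_le:
  assumes "1 \<le> \<kappa>" "0 \<le> s"
  shows "\<omega> (\<kappa> * s) \<le> \<kappa> * \<omega> s"
proof -
  have "\<omega> ((1 - 1 / \<kappa>) *\<^sub>R 0 + (1 / \<kappa>) *\<^sub>R (\<kappa> * s)) \<ge> (1 - 1 / \<kappa>) * \<omega> 0 + 1 / \<kappa> * \<omega> (\<kappa> * s)"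
    using assms by (intro concave_onD[OF cc]) auto
  moreover have "0 \<le> (1 - 1 / \<kappa>) * \<omega> 0" using assms nonneg[of 0] by simp
  ultimately have "\<omega> (\<kappa> * s) / \<kappa> \<le> \<omega> s" using assms by simp
  then show ?thesis using assms by (simp add: divide_le_eq mult.commute)
qed

lemma phi_bdd_above:
  assumes y: "0 \<le> y"
  shows "bdd_above ((\<lambda>x. x * y - \<omega> (exp x)) ` {0..})"
proof -
  have "eventually (\<lambda>t. norm (ln t) \<le> 1 / (y + 1) * norm (\<omega> t)) at_top"
    using wf y by (intro landau_o.smallD[of ln at_top \<omega>]) (auto simp: weight_function_def)
  then obtain T where T: "\<And>t. t \<ge> T \<Longrightarrow> \<bar>ln t\<bar> \<le> \<bar>\<omega> t\<bar> / (y + 1)"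
    unfolding eventually_at_top_linorder by auto
  define X where "X = ln (max T 1)"
  have "x * y - \<omega> (exp x) \<le> max 0 (X * y)" if x: "0 \<le> x" for x
  proof (cases "x \<le> X")
    case True
    then have "x * y \<le> X * y" using y by (rule mult_right_mono)
    then show ?thesis using nonneg[of "exp x"] by simp
  next
    case False
    have "T \<le> exp X" by (simp add: X_def)
    also have "\<dots> \<le> exp x" using False by simp
    finally have "x \<le> \<omega> (exp x) / (y + 1)" using T[of "exp x"] nonneg[of "exp x"] x by simp
    then have "x * (y + 1) \<le> \<omega> (exp x)" using y by (simp add: le_divide_eq)
    then have "x * y - \<omega> (exp x) \<le> 0" using x by (simp add: algebra_simps)
    then show ?thesis by simp
  qed
  then show ?thesis by (intro bdd_aboveI2) auto
qed

lemma phi_upper: "0 \<le> y \<Longrightarrow> 0 \<le> x \<Longrightarrow> x * y - \<omega> (exp x) \<le> \<phi> y"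
  unfolding phi_conj_def by (rule cSUP_upper[OF _ phi_bdd_above]) auto

lemma phi_least: "(\<And>x. 0 \<le> x \<Longrightarrow> x * y - \<omega> (exp x) \<le> B) \<Longrightarrow> \<phi> y \<le> B"
  unfolding phi_conj_def by (rule cSUP_least) auto

text \<open>Dual to \<open>scale_le\<close>: shifting x by ln \<kappa> multiplies exp x by \<kappa>.
  The gain \<kappa> y ln \<kappa> later produces the powers that are compared with
  factorials.\<close>

lemma phi_scale:
  assumes "1 \<le> \<kappa>" "0 \<le> y"
  shows "\<kappa> * y * ln \<kappa> + \<kappa> * \<phi> y \<le> \<phi> (\<kappa> * y)"
proof -
  have "\<phi> y \<le> (\<phi> (\<kappa> * y) - \<kappa> * y * ln \<kappa>) / \<kappa>"
  proof (rule phi_least)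
    fix x :: real assume x: "0 \<le> x"
    have "(x + ln \<kappa>) * (\<kappa> * y) - \<kappa> * \<omega> (exp x) \<le> (x + ln \<kappa>) * (\<kappa> * y) - \<omega> (exp (x + ln \<kappa>))"
      using scale_le[OF assms(1), of "exp x"] assms by (simp add: exp_add mult.commute)
    also have "\<dots> \<le> \<phi> (\<kappa> * y)" using assms x by (intro phi_upper) auto
    finally have "\<kappa> * (x * y - \<omega> (exp x)) \<le> \<phi> (\<kappa> * y) - \<kappa> * y * ln \<kappa>" by (simp add: algebra_simps)
    then show "x * y - \<omega> (exp x) \<le> (\<phi> (\<kappa> * y) - \<kappa> * y * ln \<kappa>) / \<kappa>"
      using assms by (simp add: le_divide_eq mult.commute)
  qed
  then show ?thesis using assms by (simp add: le_divide_eq algebra_simps)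
qed

text \<open>As \<omega> \<ge> 0, each x - \<omega> (exp x) / y increases with y, and so does their
  supremum \<phi> y / y.\<close>

lemma phi_star:
  assumes "0 \<le> y" "y \<le> z"
  shows "z * \<phi> y \<le> y * \<phi> z"
proof (cases "z = 0")
  case False
  then have z: "0 < z" using assms by simp
  have "\<phi> y \<le> y * \<phi> z / z"
  proof (rule phi_least)
    fix x :: real assume x: "0 \<le> x"
    have "z * (x * y) - z * \<omega> (exp x) \<le> y * (x * z) - y * \<omega> (exp x)"
      using assms nonneg[of "exp x"] by (simp add: mult_right_mono mult_ac)
    also have "\<dots> = y * (x * z - \<omega> (exp x))" by (simp add: algebra_simps)
    also have "\<dots> \<le> y * \<phi> z" using assms x z by (intro mult_left_mono phi_upper) auto
    finally show "x * y - \<omega> (exp x) \<le> y * \<phi> z / z" using z by (simp add: le_divide_eq algebra_simps)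
  qed
  then show ?thesis using z by (simp add: le_divide_eq mult.commute)
qed (use assms in simp)

lemma phi_0: "\<phi> 0 \<le> 0"
  using phi_star[of 0 1] by simp

lemma wt_pos: "0 < wt \<rho> k"
  by (simp add: wt_def)

lemma wt_mono:
  assumes "0 < \<rho>" "\<rho> \<le> \<rho>'"
  shows "wt \<rho> k \<le> wt \<rho>' k"
proof -
  have "\<phi> (\<rho> * real k) / \<rho> \<le> \<phi> (\<rho>' * real k) / \<rho>'"
  proof (cases "k = 0")
    case True
    have "\<rho> * \<phi> 0 \<ge> \<rho>' * \<phi> 0" using assms phi_0 by (intro mult_right_mono_neg) auto
    then show ?thesis using True assms by (simp add: divide_simps mult.commute)
  next
    case False
    have "real k * (\<rho>' * \<phi> (\<rho> * real k)) \<le> real k * (\<rho> * \<phi> (\<rho>' * real k))"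
      using phi_star[of "\<rho> * real k" "\<rho>' * real k"] assms by (simp add: mult_right_mono mult_ac)
    then have "\<rho>' * \<phi> (\<rho> * real k) \<le> \<rho> * \<phi> (\<rho>' * real k)" using False by simp
    then show ?thesis using assms by (simp add: divide_simps mult.commute)
  qed
  then show ?thesis by (simp add: wt_def)
qed

lemma wt_le_power:
  assumes "0 < \<rho>" "l \<le> n" "0 < n"
  shows "wt \<rho> l \<le> exp (\<phi> (\<rho> * real n) / (\<rho> * real n)) ^ l"
proof -
  have "\<rho> * (real n * \<phi> (\<rho> * real l)) \<le> \<rho> * (real l * \<phi> (\<rho> * real n))"
    using phi_star[of "\<rho> * real l" "\<rho> * real n"] assms by (simp add: mult_left_mono mult_ac)
  then have "real n * \<phi> (\<rho> * real l) \<le> real l * \<phi> (\<rho> * real n)" using assms by simp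
  then have "\<phi> (\<rho> * real l) / \<rho> \<le> real l * (\<phi> (\<rho> * real n) / (\<rho> * real n))"
    using assms by (simp add: field_simps)
  then show ?thesis unfolding wt_def exp_of_nat_mult[symmetric] by simp
qed

text \<open>\<open>phi_scale\<close> with \<kappa> = k / l: its logarithmic term becomes the factor
  (l / k)^l, which is missing in \<open>wt_le_power\<close> and is needed for orders below
  k.\<close>

lemma wt_le_power_low:
  assumes "0 < \<rho>" "l \<le> k" "0 < k"
  shows "wt \<rho> l \<le> (real l / real k * exp (\<phi> (\<rho> * real k) / (\<rho> * real k))) ^ l"
proof (cases "l = 0")
  case True
  then show ?thesis using phi_0 assms by (simp add: wt_def divide_le_0_iff)
next
  case False
  have "real k / real l * (\<rho> * real l) * ln (real k / real l) + real k / real l * \<phi> (\<rho> * real l)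
      \<le> \<phi> (real k / real l * (\<rho> * real l))"
    using assms False by (intro phi_scale) auto
  also have "real k / real l * (\<rho> * real l) = \<rho> * real k" using False by simp
  finally have "real k / real l * \<phi> (\<rho> * real l) \<le> \<phi> (\<rho> * real k) - \<rho> * real k * ln (real k / real l)" by simp
  then have "\<phi> (\<rho> * real l) / \<rho> \<le> real l * (ln (real l / real k) + \<phi> (\<rho> * real k) / (\<rho> * real k))"
    using assms False by (simp add: ln_div field_simps)
  then have "wt \<rho> l \<le> exp (ln (real l / real k) + \<phi> (\<rho> * real k) / (\<rho> * real k)) ^ l"
    unfolding wt_def exp_of_nat_mult[symmetric] by simp
  then show ?thesis using assms False by (simp add: exp_add)
qed

text \<open>With s taken at the top order D k, every weight of order l \<le> D k is at most (l s /
  k)^l: below k by \<open>wt_le_power_low\<close>, above k because l / k \<ge> 1. Then l^l \<le> e^l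
  l! allows the radius R = e s / k.\<close>

lemma dominates_wt:
  assumes \<rho>: "0 < \<rho>" and c: "1 \<le> c" and D: "0 < D"
  shows "dominates D c (wt \<rho>) (wt (c * exp 1 * real D * \<rho>))"
  unfolding dominates_def
proof (rule exI[of _ 1], safe)
  fix k :: nat assume k: "0 < k"
  define s where "s = exp (\<phi> (\<rho> * real (D * k)) / (\<rho> * real (D * k)))"
  show "\<exists>R>0. (\<forall>l\<le>D * k. wt \<rho> l \<le> 1 * fact l * R ^ l) \<and> fact k * (c * R) ^ k \<le> 1 * wt (c * exp 1 * real D * \<rho>) k"
  proof (intro exI[of _ "exp 1 * s / real k"] conjI allI impI)
    show "0 < exp 1 * s / real k" using k by (simp add: s_def)
    fix l assume l: "l \<le> D * k"
    have "wt \<rho> l \<le> (real l / real k * s) ^ l"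
    proof (cases "l \<le> k")
      case True
      have "\<rho> * real k * (\<phi> (\<rho> * real k) * (\<rho> * real (D * k))) \<le> \<rho> * real k * (\<phi> (\<rho> * real (D * k)) * (\<rho> * real k))"
        using phi_star[of "\<rho> * real k" "\<rho> * real (D * k)"] \<rho> k D by (intro mult_left_mono) (auto simp: mult_ac)
      then have "\<phi> (\<rho> * real k) / (\<rho> * real k) \<le> \<phi> (\<rho> * real (D * k)) / (\<rho> * real (D * k))"
        using \<rho> k D by (simp add: divide_simps)
      then have "exp (\<phi> (\<rho> * real k) / (\<rho> * real k)) \<le> s" by (simp add: s_def)
      then have "(real l / real k * exp (\<phi> (\<rho> * real k) / (\<rho> * real k))) ^ l \<le> (real l / real k * s) ^ l"
        by (intro power_mono mult_left_mono) auto
      then show ?thesis using wt_le_power_low[OF \<rho> True k] by linarith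
    next
      case False
      have "wt \<rho> l \<le> (1 * s) ^ l" using wt_le_power[OF \<rho> l] k D by (simp add: s_def)
      also have "\<dots> \<le> (real l / real k * s) ^ l"
        using False k by (intro power_mono mult_right_mono) (auto simp: s_def le_divide_eq)
      finally show ?thesis .
    qed
    also have "\<dots> = real l ^ l * (s / real k) ^ l" by (simp add: power_mult_distrib power_divide)
    also have "\<dots> \<le> exp 1 ^ l * fact l * (s / real k) ^ l"
      by (intro mult_right_mono power_le_exp_fact) (auto simp: s_def)
    also have "\<dots> = 1 * fact l * (exp 1 * s / real k) ^ l" by (simp add: power_mult_distrib power_divide)
    finally show "wt \<rho> l \<le> 1 * fact l * (exp 1 * s / real k) ^ l" .
  next
    have fk: "fact k \<le> real k ^ k" by (metis fact_le_power le_refl of_nat_fact of_nat_le_iff of_nat_power)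
    \<comment> \<open>By k! \<le> k^k, the second condition reduces to (\<kappa> s)^k.
      \<open>phi_scale\<close> absorbs \<kappa>^k into the parameter, and the factor D enters
      because s belongs to order D k.\<close>
    define \<kappa> where "\<kappa> = c * exp 1"
    have \<kappa>: "1 \<le> \<kappa>" using c mult_mono[OF c, of 1 "exp 1"] by (simp add: \<kappa>_def)
    have "fact k * (c * (exp 1 * s / real k)) ^ k \<le> real k ^ k * (c * (exp 1 * s / real k)) ^ k"
      using fk c by (intro mult_right_mono) (auto simp: s_def)
    also have "\<dots> = (\<kappa> * s) ^ k" using k by (simp add: \<kappa>_def power_mult_distrib power_divide)
    also have "\<dots> = exp (real k * (ln \<kappa> + \<phi> (\<rho> * real (D * k)) / (\<rho> * real (D * k))))"
      using \<kappa> unfolding exp_of_nat_mult by (simp add: s_def exp_add)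
    also have "\<dots> \<le> wt (\<kappa> * real D * \<rho>) k"
    proof -
      have "\<kappa> * (\<rho> * real (D * k)) * ln \<kappa> + \<kappa> * \<phi> (\<rho> * real (D * k)) \<le> \<phi> (\<kappa> * (\<rho> * real (D * k)))"
        using \<rho> by (intro phi_scale \<kappa>) auto
      also have "\<kappa> * (\<rho> * real (D * k)) = \<kappa> * real D * \<rho> * real k" by simp
      finally have "(\<kappa> * real D * \<rho> * real k * ln \<kappa> + \<kappa> * \<phi> (\<rho> * real (D * k))) / (\<kappa> * real D * \<rho>)
          \<le> \<phi> (\<kappa> * real D * \<rho> * real k) / (\<kappa> * real D * \<rho>)"
        using \<rho> \<kappa> by (intro divide_right_mono) auto
      also have "(\<kappa> * real D * \<rho> * real k * ln \<kappa> + \<kappa> * \<phi> (\<rho> * real (D * k))) / (\<kappa> * real D * \<rho>)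
          = real k * (ln \<kappa> + \<phi> (\<rho> * real (D * k)) / (\<rho> * real (D * k)))"
        using \<rho> \<kappa> k D by (simp add: field_simps)
      finally show ?thesis by (simp add: wt_def)
    qed
    finally show "fact k * (c * (exp 1 * s / real k)) ^ k \<le> 1 * wt (c * exp 1 * real D * \<rho>) k" by (simp add: \<kappa>_def)
  qed
qed simp

lemma dominates_mono: "dominates D' c w w' \<Longrightarrow> D \<le> D' \<Longrightarrow> dominates D c w w'"
  unfolding dominates_def by (meson mult_le_mono1 order_trans)

lemma E_weight_Roumieu_iff:
  "f \<in> E_weight Roumieu \<omega> U \<longleftrightarrow> smooth_on U f \<and>
    (\<forall>K. compact K \<and> K \<subseteq> U \<longrightarrow> (\<exists>w\<in>wt ` {0<..}. deriv_bounded w K f))"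
  unfolding E_weight.simps mem_Collect_eq seminorm_w_finite_iff wt_def[abs_def] by auto

lemma E_weight_Beurling_iff:
  "f \<in> E_weight Beurling \<omega> U \<longleftrightarrow> smooth_on U f \<and>
    (\<forall>K. compact K \<and> K \<subseteq> U \<longrightarrow> (\<forall>w\<in>wt ` {0<..}. deriv_bounded w K f))"
  unfolding E_weight.simps mem_Collect_eq seminorm_w_finite_iff wt_def[abs_def] by auto

lemma joris_weight:
  fixes f :: "'a::real_normed_vector \<Rightarrow> complex"
  assumes U: "open U" and j: "0 < j"
    and f: "(\<lambda>x. f x ^ j) \<in> E_weight r \<omega> U" "(\<lambda>x. f x ^ (j + 1)) \<in> E_weight r \<omega> U"
  shows "f \<in> E_weight r \<omega> U"
proof -
  have posW: "\<forall>k. 0 < w k" if "w \<in> wt ` {0<..}" for w using that wt_pos by auto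
  show ?thesis
  proof (cases r)
    case Roumieu
    note ff = f[unfolded Roumieu E_weight_Roumieu_iff]
    define v where "v n = wt (real (Suc n))" for n
    have vW: "v n \<in> wt ` {0<..}" for n unfolding v_def by simp
    have vmono: "v n k \<le> v m k" if "n \<le> m" for n m k unfolding v_def using that by (intro wt_mono) auto
    have cof: "\<exists>n. \<exists>C\<ge>0. \<forall>k. w k \<le> C * v n k" if w: "w \<in> wt ` {0<..}" for w
    proof -
      obtain \<rho> where \<rho>: "w = wt \<rho>" "0 < \<rho>" using w by auto
      obtain n where "\<rho> \<le> real n" using real_arch_simple by blast
      then have "wt \<rho> k \<le> 1 * v n k" for k unfolding v_def using \<rho>(2) by (simp del: of_nat_Suc, intro wt_mono) auto
      then show ?thesis unfolding \<rho>(1) by (intro exI[of _ n] exI[of _ 1]) auto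
    qed
    have dom: "\<exists>w'\<in>wt ` {0<..}. dominates D c w w'" if c: "1 \<le> c" and w: "w \<in> wt ` {0<..}" for D c w
    proof -
      obtain \<rho> where \<rho>: "w = wt \<rho>" "0 < \<rho>" using w by auto
      \<comment> \<open>\<open>Suc D\<close> replaces D to meet the positivity hypothesis of
        \<open>dominates_wt\<close>; domination for a larger order range implies that for D.\<close>
      have "dominates D c w (wt (c * exp 1 * real (Suc D) * \<rho>))"
        unfolding \<rho>(1) by (rule dominates_mono[OF dominates_wt[OF \<rho>(2) c]]) auto
      moreover have "0 < c * exp 1 * real (Suc D) * \<rho>" using c \<rho>(2) by (intro mult_pos_pos) auto
      ultimately show ?thesis by (intro bexI[OF _ imageI]) auto
    qed
    have sm: "smooth_on U (\<lambda>x. f x ^ j)" "smooth_on U (\<lambda>x. f x ^ (j + 1))"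
      using ff by blast+
    have b: "\<And>K. compact K \<Longrightarrow> K \<subseteq> U \<Longrightarrow> \<exists>w\<in>wt ` {0<..}. deriv_bounded w K (\<lambda>x. f x ^ j)"
      "\<And>K. compact K \<Longrightarrow> K \<subseteq> U \<Longrightarrow> \<exists>w\<in>wt ` {0<..}. deriv_bounded w K (\<lambda>x. f x ^ (j + 1))"
      using ff by blast+
    note root = joris_Roumieu[where v = v and W = "wt ` {0<..}" and f = f, OF j U posW vW vmono cof dom sm b]
    show ?thesis
      unfolding Roumieu E_weight_Roumieu_iff
    proof (intro conjI allI impI)
      show "smooth_on U f" by (rule root(1))
      fix K assume "compact K \<and> K \<subseteq> U"
      then show "\<exists>w\<in>wt ` {0<..}. deriv_bounded w K f" using root(2) by blast
    qed
  next
    case Beurling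
    note ff = f[unfolded Beurling E_weight_Beurling_iff]
    have ne: "wt ` {0<..} \<noteq> {}" using zero_less_one by blast
    have dom: "\<exists>w\<in>wt ` {0<..}. dominates D c w w'" if c: "1 \<le> c" and w: "w' \<in> wt ` {0<..}" for D c w'
    proof -
      obtain \<rho>' where \<rho>': "w' = wt \<rho>'" "0 < \<rho>'" using w by auto
      define \<rho> where "\<rho> = \<rho>' / (c * exp 1 * real (Suc D))"
      have p: "0 < c * exp 1 * real (Suc D)" using c by (intro mult_pos_pos) auto
      then have \<rho>: "0 < \<rho>" "\<rho>' = c * exp 1 * real (Suc D) * \<rho>" using \<rho>'(2) by (auto simp: \<rho>_def simp del: of_nat_Suc)
      have "dominates D c (wt \<rho>) w'"
        unfolding \<rho>'(1) \<rho>(2) by (rule dominates_mono[OF dominates_wt[OF \<rho>(1) c]]) auto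
      then show ?thesis using \<rho>(1) by (intro bexI[OF _ imageI]) auto
    qed
    have sm: "smooth_on U (\<lambda>x. f x ^ j)" "smooth_on U (\<lambda>x. f x ^ (j + 1))"
      using ff by blast+
    have b: "\<And>K w. compact K \<Longrightarrow> K \<subseteq> U \<Longrightarrow> w \<in> wt ` {0<..} \<Longrightarrow> deriv_bounded w K (\<lambda>x. f x ^ j)"
      "\<And>K w. compact K \<Longrightarrow> K \<subseteq> U \<Longrightarrow> w \<in> wt ` {0<..} \<Longrightarrow> deriv_bounded w K (\<lambda>x. f x ^ (j + 1))"
      using ff by blast+
    note root = joris_Beurling[where W = "wt ` {0<..}" and f = f, OF j U posW ne dom sm b]
    show ?thesis
      unfolding Beurling E_weight_Beurling_iff
    proof (intro conjI allI impI ballI)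
      show "smooth_on U f" by (rule root(1))
      fix K w assume "compact K \<and> K \<subseteq> U" "w \<in> wt ` {0<..}"
      then show "deriv_bounded w K f" using root(2) by blast
    qed
  qed
qed

end

theorem theorem3p2:
  fixes r :: regime and U :: "'a::banach set" and f :: "'a \<Rightarrow> complex"
  assumes "open U"
  shows "(\<forall>\<MM>. weight_matrix \<MM> \<and> admissible r \<MM> \<longrightarrow>
            (\<exists>j>0. (\<lambda>x. f x ^ j) \<in> E_matrix r \<MM> U \<and> (\<lambda>x. f x ^ (j + 1)) \<in> E_matrix r \<MM> U) \<longrightarrow>
            f \<in> E_matrix r \<MM> U) \<and>
         (\<forall>\<omega>. weight_function \<omega> \<and> concave_on {0..} \<omega> \<longrightarrow>
            (\<exists>j>0. (\<lambda>x. f x ^ j) \<in> E_weight r \<omega> U \<and> (\<lambda>x. f x ^ (j + 1)) \<in> E_weight r \<omega> U) \<longrightarrow>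
            f \<in> E_weight r \<omega> U)"
  using joris_matrix[OF assms] concave_weight_function.joris_weight[OF concave_weight_function.intro assms]
  by (intro conjI allI impI) (elim conjE exE, blast)+

end
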